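(* Let $\mathcal A\subseteq B(\mathcal H)$ be a von Neumann algebra and let $\tau:\mathcal A\to\mathcal A$ be a normal unital completely positive map. Then for every natural number $k\ge 1$, the peripheral Poisson boundaries satisfy $$\mathcal P(\tau^k)=\mathcal P(\tau),$$ and the Poisson boundary of $\tau^k$ satisfies $$\mathcal P_{\{1\}}(\tau^k)=\mathcal P_{G_k}(\tau).$$ In particular, the $k$-cyclic Poisson boundary $\mathcal P_{G_k}(\tau)$ is a von Neumann algebra for every $k$.
   Context: All Hilbert spaces are complex and separable; $\mathbb T=\{z\in\mathbb C:|z|=1\}$. For Hilbert spaces $\mathcal H\subseteq\mathcal K$ with $p$ the orthogonal projection of $\mathcal K$ onto $\mathcal H$, an operator $x\in B(\mathcal H)$ is identified with $pxp\in B(\mathcal K)$. Minimal dilation: it is known that for every normal unital completely positive map $\tau$ on a von Neumann algebra $\mathcal A\subseteq B(\mathcal H)$ there is a triple $(\mathcal K,\mathcal B,\theta)$, unique up to unitary equivalence fixing $\mathcal H$ pointwise, such that: $\mathcal K\supseteq\mathcal H$ is a Hilbert space containing $\mathcal H$ as a closed subspace; $\mathcal B\subseteq B(\mathcal K)$ is a von Neumann algebra with $\mathcal A=p\mathcal Bp$ (so $p$ is the identity of $\mathcal A$); $\theta:\mathcal B\to\mathcal B$ is a normal unital $*$-endomorphism; $\tau^n(x)=p\theta^n(x)p$ for all $x\in\mathcal A$, $n\in\mathbb Z_+$; $\mathcal K$ is the closed linear span of $\{\theta^n(x_n)\cdots\theta(x_1)h: x_i\in\mathcal A,\ h\in\mathcal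 H,\ n\in\mathbb Z_+\}$; and $\mathcal B$ is the von Neumann algebra generated by $\{\theta^n(x):n\in\mathbb Z_+,x\in\mathcal A\}$. Peripheral Poisson boundary: let $E_\lambda(\tau)=\{x\in\mathcal A:\tau(x)=\lambda x\}$. $\mathcal P(\tau)$ is the operator norm closure of $\mathrm{span}\bigcup_{\lambda\in\mathbb T}E_\lambda(\tau)$, and $\mathcal P(\theta)$ is defined in the same way from $\theta$ on $\mathcal B$; $\mathcal P(\theta)$ is a unital $C^*$-algebra. The compression $T:\mathcal P(\theta)\to\mathcal P(\tau)$, $T(z)=pzp$, is an isometric bijection, and the product $x\circ y:=T(T^{-1}(x)T^{-1}(y))$ makes $\mathcal P(\tau)$ (with unchanged norm and involution) a unital $C^*$-algebra, called the peripheral Poisson boundary of $\tau$. For a subgroup $G$ of $\mathbb T$, $\mathcal P_G(\tau)$ is the norm closure of $\mathrm{span}\bigcup_{\lambda\in G}E_\lambda(\tau)$, a unital $C^*$-subalgebra of $(\mathcal P(\tau),\circ)$. $\mathcal P_{\{1\}}(\tau)=E_1(\tau)$ is the usual noncommutative Poisson boundary of $\tau$. For $k\in\mathbb N$, $G_k=\{\omega^j:0\le j\le k-1\}$ with $\omega=e^{2\pi i/k}$, and $\mathcal P_{G_k}(\tau)$ is called the $k$-cyclic Poisson boundary of $\tau$. Equalities between these objects are equalities as $C^*$-algebras (same set, norm, involution and product $\circ$, where the product for $\tau^k$ is defined using the minimal dilation of $\tau^k$). "Is a von Neumann algebra" means: is, as an abstract $C^*$-algebra, $*$-isomorphic to a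 von Neumann algebra. *)

theory Defs
  imports "HOL-Analysis.Analysis"
begin

section \<open>Complex separable Hilbert spaces\<close>

class scaleC =
  fixes scaleC :: "complex \<Rightarrow> 'a \<Rightarrow> 'a"  (infixr "*\<^sub>C" 75)

class complex_normed_vector = real_normed_vector + scaleC +
  assumes scaleC_add_right: "a *\<^sub>C (x + y) = a *\<^sub>C x + a *\<^sub>C y"
    and scaleC_add_left: "(a + b) *\<^sub>C x = a *\<^sub>C x + b *\<^sub>C x"
    and scaleC_scaleC: "a *\<^sub>C b *\<^sub>C x = (a * b) *\<^sub>C x"
    and scaleR_scaleC: "r *\<^sub>R x = complex_of_real r *\<^sub>C x"
    and norm_scaleC: "norm (a *\<^sub>C x) = cmod a * norm x"

text \<open>The inner product is conjugate-linear in the first variable.\<close>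

class hilbert_space = complex_normed_vector + complete_space +
  fixes cinner :: "'a \<Rightarrow> 'a \<Rightarrow> complex"
  assumes cinner_commute: "cinner x y = cnj (cinner y x)"
    and cinner_add_right: "cinner x (y + z) = cinner x y + cinner x z"
    and cinner_scaleC_right: "cinner x (c *\<^sub>C y) = c * cinner x y"
    and cinner_self: "cinner x x = complex_of_real ((norm x)\<^sup>2)"
    and separable: "\<exists>D. countable D \<and> (\<forall>x. \<forall>e>0. \<exists>d\<in>D. dist x d < e)"

global_interpretation complex_vector:
  vector_space "scaleC :: complex \<Rightarrow> 'a \<Rightarrow> 'a::complex_normed_vector"
proof
  fix x :: 'a
  show "1 *\<^sub>C x = x"
    using scaleR_scaleC[of 1 x] by simp
qed (simp_all add: scaleC_add_right scaleC_add_left scaleC_scaleC)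

abbreviation cspan :: "'a::complex_normed_vector set \<Rightarrow> 'a set"
  where "cspan \<equiv> complex_vector.span"


section \<open>Bounded operators\<close>

text \<open>
  The library type of bounded linear maps consists of all real-linear ones; it is a complex
  normed space under pointwise multiplication by scalars in the codomain.
\<close>

lemma bounded_linear_scaleC: "bounded_linear (\<lambda>x. c *\<^sub>C (x::'a::complex_normed_vector))"
proof (rule bounded_linear_intro[where K = "cmod c"])
  fix x y :: 'a and r :: real
  show "c *\<^sub>C (x + y) = c *\<^sub>C x + c *\<^sub>C y"
    by (rule scaleC_add_right)
  show "c *\<^sub>C r *\<^sub>R x = r *\<^sub>R c *\<^sub>C x"
    by (simp add: scaleR_scaleC scaleC_scaleC mult.commute)
  show "norm (c *\<^sub>C x) \<le> norm x * cmod c"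
    by (simp add: norm_scaleC)
qed

instantiation blinfun :: (real_normed_vector, complex_normed_vector) complex_normed_vector
begin

lift_definition scaleC_blinfun :: "complex \<Rightarrow> 'a \<Rightarrow>\<^sub>L 'b \<Rightarrow> 'a \<Rightarrow>\<^sub>L 'b"
  is "\<lambda>c f x. c *\<^sub>C f x"
  by (rule bounded_linear_compose[OF bounded_linear_scaleC])

instance
proof
  fix a b :: complex and r :: real and f g :: "'a \<Rightarrow>\<^sub>L 'b"
  show "a *\<^sub>C (f + g) = a *\<^sub>C f + a *\<^sub>C g"
    by transfer (simp add: scaleC_add_right)
  show "(a + b) *\<^sub>C f = a *\<^sub>C f + b *\<^sub>C f"
    by transfer (simp add: scaleC_add_left)
  show "a *\<^sub>C b *\<^sub>C f = (a * b) *\<^sub>C f"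
    by transfer (simp add: scaleC_scaleC)
  show "r *\<^sub>R f = complex_of_real r *\<^sub>C f"
    by transfer (simp add: scaleR_scaleC)
  have le: "norm (c *\<^sub>C h) \<le> cmod c * norm h" for c and h :: "'a \<Rightarrow>\<^sub>L 'b"
  proof (rule norm_blinfun_bound)
    fix x
    have "norm (blinfun_apply h x) \<le> norm h * norm x"
      by (rule norm_blinfun)
    then show "norm (blinfun_apply (c *\<^sub>C h) x) \<le> cmod c * norm h * norm x"
      by (simp add: scaleC_blinfun.rep_eq norm_scaleC mult.assoc mult_left_mono)
  qed simp
  show "norm (a *\<^sub>C f) = cmod a * norm f"
  proof (cases "a = 0")
    case True
    then show ?thesis
      using le[of 0 f] by simp
  next
    case False
    have "inverse a *\<^sub>C a *\<^sub>C f = f"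
      using False by transfer (simp add: scaleC_scaleC complex_vector.scale_one)
    then have "norm f \<le> cmod (inverse a) * norm (a *\<^sub>C f)"
      using le[of "inverse a" "a *\<^sub>C f"] by simp
    then have "cmod a * norm f \<le> norm (a *\<^sub>C f)"
      using False by (simp add: norm_inverse norm_divide field_simps)
    then show ?thesis
      using le[of a f] by simp
  qed
qed

end

definition clinear_op :: "('a::complex_normed_vector \<Rightarrow>\<^sub>L 'b::complex_normed_vector) \<Rightarrow> bool"
  where "clinear_op x \<longleftrightarrow> (\<forall>c v. blinfun_apply x (c *\<^sub>C v) = c *\<^sub>C blinfun_apply x v)"

definition bounded_ops :: "('h::hilbert_space \<Rightarrow>\<^sub>L 'h) set"
  where "bounded_ops = Collect clinear_op"

text \<open>Only meaningful for complex-linear \<open>x\<close>, where the adjoint exists.\<close>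

definition adj :: "('a::hilbert_space \<Rightarrow>\<^sub>L 'b::hilbert_space) \<Rightarrow> 'b \<Rightarrow>\<^sub>L 'a"
  where "adj x =
    (THE y. \<forall>u v. cinner (blinfun_apply x u) v = cinner u (blinfun_apply y v))"


section \<open>Von Neumann algebras and normal unital completely positive maps\<close>

definition commutant :: "('h::hilbert_space \<Rightarrow>\<^sub>L 'h) set \<Rightarrow> ('h \<Rightarrow>\<^sub>L 'h) set"
  where "commutant S = {y \<in> bounded_ops. \<forall>x\<in>S. y o\<^sub>L x = x o\<^sub>L y}"

definition von_neumann_algebra :: "('h::hilbert_space \<Rightarrow>\<^sub>L 'h) set \<Rightarrow> bool"
  where "von_neumann_algebra M \<longleftrightarrow>
    M \<subseteq> bounded_ops \<and> (\<forall>x\<in>M. adj x \<in> M) \<and> commutant (commutant M) = M"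

definition generated_von_neumann_algebra ::
    "('h::hilbert_space \<Rightarrow>\<^sub>L 'h) set \<Rightarrow> ('h \<Rightarrow>\<^sub>L 'h) set"
  where "generated_von_neumann_algebra S = \<Inter>{M. von_neumann_algebra M \<and> S \<subseteq> M}"

text \<open>
  The ultraweak (sigma-weak) topology: the initial topology for the functionals
  \<open>x \<mapsto> \<Sum>n. \<langle>\<xi> n, x (\<eta> n)\<rangle>\<close> with square-summable \<open>\<xi>\<close> and \<open>\<eta>\<close>.
\<close>

definition ultraweak_topology :: "('h::hilbert_space \<Rightarrow>\<^sub>L 'h) topology"
  where "ultraweak_topology = topology_generated_by
    {{x. (\<Sum>n. cinner (\<xi> n) (blinfun_apply x (\<eta> n))) \<in> U} | \<xi> \<eta> U.
      summable (\<lambda>n. (norm (\<xi> n))\<^sup>2) \<and> summable (\<lambda>n. (norm (\<eta> n))\<^sup>2) \<and> open U}"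

definition normal_map ::
    "('h::hilbert_space \<Rightarrow>\<^sub>L 'h) set \<Rightarrow> (('h \<Rightarrow>\<^sub>L 'h) \<Rightarrow> ('h \<Rightarrow>\<^sub>L 'h)) \<Rightarrow> bool"
  where "normal_map A \<tau> \<longleftrightarrow>
    continuous_map (subtopology ultraweak_topology A) ultraweak_topology \<tau>"

definition unital_linear_on ::
    "('h::hilbert_space \<Rightarrow>\<^sub>L 'h) set \<Rightarrow> (('h \<Rightarrow>\<^sub>L 'h) \<Rightarrow> ('h \<Rightarrow>\<^sub>L 'h)) \<Rightarrow> bool"
  where "unital_linear_on A \<tau> \<longleftrightarrow>
    \<tau> \<in> A \<rightarrow> A \<and>
    (\<forall>x\<in>A. \<forall>y\<in>A. \<tau> (x + y) = \<tau> x + \<tau> y) \<and>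
    (\<forall>c. \<forall>x\<in>A. \<tau> (c *\<^sub>C x) = c *\<^sub>C \<tau> x) \<and>
    \<tau> id_blinfun = id_blinfun"

text \<open>
  Positivity of the operator on the \<open>n\<close>-fold direct sum of the Hilbert space given by the
  matrix \<open>(X i j)\<close>, \<open>i, j < n\<close>.
\<close>

definition positive_matrix :: "nat \<Rightarrow> (nat \<Rightarrow> nat \<Rightarrow> 'h::hilbert_space \<Rightarrow>\<^sub>L 'h) \<Rightarrow> bool"
  where "positive_matrix n X \<longleftrightarrow>
    (\<forall>v. (\<Sum>i<n. \<Sum>j<n. cinner (v i) (blinfun_apply (X i j) (v j))) \<in> \<real>\<^sub>\<ge>\<^sub>0)"

definition completely_positive ::
    "('h::hilbert_space \<Rightarrow>\<^sub>L 'h) set \<Rightarrow> (('h \<Rightarrow>\<^sub>L 'h) \<Rightarrow> ('h \<Rightarrow>\<^sub>L 'h)) \<Rightarrow> bool"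
  where "completely_positive A \<tau> \<longleftrightarrow>
    (\<forall>n X. (\<forall>i<n. \<forall>j<n. X i j \<in> A) \<and> positive_matrix n X
      \<longrightarrow> positive_matrix n (\<lambda>i j. \<tau> (X i j)))"

definition normal_ucp_map ::
    "('h::hilbert_space \<Rightarrow>\<^sub>L 'h) set \<Rightarrow> (('h \<Rightarrow>\<^sub>L 'h) \<Rightarrow> ('h \<Rightarrow>\<^sub>L 'h)) \<Rightarrow> bool"
  where "normal_ucp_map A \<tau> \<longleftrightarrow>
    unital_linear_on A \<tau> \<and> completely_positive A \<tau> \<and> normal_map A \<tau>"

definition normal_unital_star_endomorphism ::
    "('h::hilbert_space \<Rightarrow>\<^sub>L 'h) set \<Rightarrow> (('h \<Rightarrow>\<^sub>L 'h) \<Rightarrow> ('h \<Rightarrow>\<^sub>L 'h)) \<Rightarrow> bool"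
  where "normal_unital_star_endomorphism B \<theta> \<longleftrightarrow>
    unital_linear_on B \<theta> \<and>
    (\<forall>x\<in>B. \<forall>y\<in>B. \<theta> (x o\<^sub>L y) = \<theta> x o\<^sub>L \<theta> y) \<and>
    (\<forall>x\<in>B. \<theta> (adj x) = adj (\<theta> x)) \<and>
    normal_map B \<theta>"


section \<open>Minimal dilations\<close>

text \<open>
  The inclusion of \<open>\<H>\<close> into \<open>\<K>\<close> is rendered by a complex-linear isometry \<open>\<iota>\<close>; the projection
  \<open>p\<close> onto \<open>\<H>\<close> is \<open>\<iota> \<iota>\<^sup>*\<close>. An operator \<open>x\<close> on \<open>\<H>\<close> becomes the operator \<open>\<iota> x \<iota>\<^sup>*\<close> on \<open>\<K>\<close>, and
  \<open>p z p\<close>, read as an operator on \<open>\<H>\<close>, is \<open>\<iota>\<^sup>* z \<iota>\<close>.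
\<close>

definition isometric_embedding :: "('h::hilbert_space \<Rightarrow>\<^sub>L 'k::hilbert_space) \<Rightarrow> bool"
  where "isometric_embedding \<iota> \<longleftrightarrow>
    clinear_op \<iota> \<and> (\<forall>v. norm (blinfun_apply \<iota> v) = norm v)"

definition extend_op ::
    "('h::hilbert_space \<Rightarrow>\<^sub>L 'k::hilbert_space) \<Rightarrow> ('h \<Rightarrow>\<^sub>L 'h) \<Rightarrow> ('k \<Rightarrow>\<^sub>L 'k)"
  where "extend_op \<iota> x = \<iota> o\<^sub>L x o\<^sub>L adj \<iota>"

definition compress_op ::
    "('h::hilbert_space \<Rightarrow>\<^sub>L 'k::hilbert_space) \<Rightarrow> ('k \<Rightarrow>\<^sub>L 'k) \<Rightarrow> ('h \<Rightarrow>\<^sub>L 'h)"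
  where "compress_op \<iota> z = adj \<iota> o\<^sub>L z o\<^sub>L \<iota>"

text \<open>\<open>dilation_vector \<iota> \<theta> x h n\<close> is \<open>\<theta>\<^sup>n(x\<^sub>n) \<cdots> \<theta>(x\<^sub>1) h\<close>; the value \<open>x 0\<close> is not used.\<close>

primrec dilation_vector ::
    "('h::hilbert_space \<Rightarrow>\<^sub>L 'k::hilbert_space) \<Rightarrow> (('k \<Rightarrow>\<^sub>L 'k) \<Rightarrow> ('k \<Rightarrow>\<^sub>L 'k)) \<Rightarrow>
      (nat \<Rightarrow> 'h \<Rightarrow>\<^sub>L 'h) \<Rightarrow> 'h \<Rightarrow> nat \<Rightarrow> 'k"
  where
    "dilation_vector \<iota> \<theta> x h 0 = blinfun_apply \<iota> h"
  | "dilation_vector \<iota> \<theta> x h (Suc n) =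
      blinfun_apply ((\<theta> ^^ Suc n) (extend_op \<iota> (x (Suc n)))) (dilation_vector \<iota> \<theta> x h n)"

definition minimal_dilation ::
    "('h::hilbert_space \<Rightarrow>\<^sub>L 'h) set \<Rightarrow> (('h \<Rightarrow>\<^sub>L 'h) \<Rightarrow> ('h \<Rightarrow>\<^sub>L 'h)) \<Rightarrow>
      ('h \<Rightarrow>\<^sub>L 'k::hilbert_space) \<Rightarrow> ('k \<Rightarrow>\<^sub>L 'k) set \<Rightarrow> (('k \<Rightarrow>\<^sub>L 'k) \<Rightarrow> ('k \<Rightarrow>\<^sub>L 'k)) \<Rightarrow> bool"
  where "minimal_dilation A \<tau> \<iota> B \<theta> \<longleftrightarrow>
    isometric_embedding \<iota> \<and>
    von_neumann_algebra B \<and>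
    A = compress_op \<iota> ` B \<and>
    normal_unital_star_endomorphism B \<theta> \<and>
    (\<forall>x\<in>A. \<forall>n. (\<tau> ^^ n) x = compress_op \<iota> ((\<theta> ^^ n) (extend_op \<iota> x))) \<and>
    closure (cspan {dilation_vector \<iota> \<theta> x h n | x h n. range x \<subseteq> A}) = UNIV \<and>
    B = generated_von_neumann_algebra {(\<theta> ^^ n) (extend_op \<iota> x) | n x. x \<in> A}"


section \<open>Peripheral Poisson boundaries\<close>

definition eigenspace ::
    "('h::hilbert_space \<Rightarrow>\<^sub>L 'h) set \<Rightarrow> (('h \<Rightarrow>\<^sub>L 'h) \<Rightarrow> ('h \<Rightarrow>\<^sub>L 'h)) \<Rightarrow> complex \<Rightarrow> ('h \<Rightarrow>\<^sub>L 'h) set"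
  where "eigenspace A \<tau> \<mu> = {x \<in> A. \<tau> x = \<mu> *\<^sub>C x}"

definition peripheral_space ::
    "complex set \<Rightarrow> ('h::hilbert_space \<Rightarrow>\<^sub>L 'h) set \<Rightarrow> (('h \<Rightarrow>\<^sub>L 'h) \<Rightarrow> ('h \<Rightarrow>\<^sub>L 'h)) \<Rightarrow>
      ('h \<Rightarrow>\<^sub>L 'h) set"
  where "peripheral_space G A \<tau> = closure (cspan (\<Union>\<mu>\<in>G. eigenspace A \<tau> \<mu>))"

abbreviation unit_circle :: "complex set"
  where "unit_circle \<equiv> {z. cmod z = 1}"

definition cyclic_subgroup :: "nat \<Rightarrow> complex set"
  where "cyclic_subgroup k = (\<lambda>j. exp (2 * of_real pi * \<i> / of_nat k) ^ j) ` {0..k - 1}"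

definition boundary_mult ::
    "('h::hilbert_space \<Rightarrow>\<^sub>L 'k::hilbert_space) \<Rightarrow> ('k \<Rightarrow>\<^sub>L 'k) set \<Rightarrow>
      (('k \<Rightarrow>\<^sub>L 'k) \<Rightarrow> ('k \<Rightarrow>\<^sub>L 'k)) \<Rightarrow> ('h \<Rightarrow>\<^sub>L 'h) \<Rightarrow> ('h \<Rightarrow>\<^sub>L 'h) \<Rightarrow> ('h \<Rightarrow>\<^sub>L 'h)"
  where "boundary_mult \<iota> B \<theta> x y =
    (let T_inv = inv_into (peripheral_space unit_circle B \<theta>) (compress_op \<iota>)
     in compress_op \<iota> (T_inv x o\<^sub>L T_inv y))"

text \<open>
  A C*-algebra carried by a subspace of an ambient complex vector space, from which it inherits
  its linear structure. The operations are made undefined off the carrier, so that equality of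
  records is equality of C*-algebras.
\<close>

record 'a cstar =
  carrier :: "'a set"
  mult :: "'a \<Rightarrow> 'a \<Rightarrow> 'a"
  star :: "'a \<Rightarrow> 'a"
  cnorm :: "'a \<Rightarrow> real"

definition make_cstar ::
    "'a set \<Rightarrow> ('a \<Rightarrow> 'a \<Rightarrow> 'a) \<Rightarrow> ('a \<Rightarrow> 'a) \<Rightarrow> ('a \<Rightarrow> real) \<Rightarrow> 'a cstar"
  where "make_cstar S m s \<nu> =
    \<lparr>carrier = S, mult = (\<lambda>x\<in>S. \<lambda>y\<in>S. m x y), star = (\<lambda>x\<in>S. s x), cnorm = (\<lambda>x\<in>S. \<nu> x)\<rparr>"

definition operator_cstar :: "('h::hilbert_space \<Rightarrow>\<^sub>L 'h) set \<Rightarrow> ('h \<Rightarrow>\<^sub>L 'h) cstar"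
  where "operator_cstar M = make_cstar M (\<lambda>x y. x o\<^sub>L y) adj norm"

text \<open>
  The boundary \<open>\<P>\<^sub>G(\<tau>)\<close>, with the product computed from the minimal dilation \<open>(\<iota>, B, \<theta>)\<close> of \<open>\<tau>\<close>.
\<close>

definition poisson_boundary ::
    "complex set \<Rightarrow> ('h::hilbert_space \<Rightarrow>\<^sub>L 'h) set \<Rightarrow> (('h \<Rightarrow>\<^sub>L 'h) \<Rightarrow> ('h \<Rightarrow>\<^sub>L 'h)) \<Rightarrow>
      ('h \<Rightarrow>\<^sub>L 'k::hilbert_space) \<Rightarrow> ('k \<Rightarrow>\<^sub>L 'k) set \<Rightarrow> (('k \<Rightarrow>\<^sub>L 'k) \<Rightarrow> ('k \<Rightarrow>\<^sub>L 'k)) \<Rightarrow>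
      ('h \<Rightarrow>\<^sub>L 'h) cstar"
  where "poisson_boundary G A \<tau> \<iota> B \<theta> =
    make_cstar (peripheral_space G A \<tau>) (boundary_mult \<iota> B \<theta>) adj norm"

definition cstar_isomorphism ::
    "('a::complex_normed_vector \<Rightarrow> 'b::complex_normed_vector) \<Rightarrow> 'a cstar \<Rightarrow> 'b cstar \<Rightarrow> bool"
  where "cstar_isomorphism \<phi> C D \<longleftrightarrow>
    bij_betw \<phi> (carrier C) (carrier D) \<and>
    (\<forall>x\<in>carrier C. \<forall>y\<in>carrier C. \<phi> (x + y) = \<phi> x + \<phi> y) \<and>
    (\<forall>c. \<forall>x\<in>carrier C. \<phi> (c *\<^sub>C x) = c *\<^sub>C \<phi> x) \<and>
    (\<forall>x\<in>carrier C. \<forall>y\<in>carrier C. \<phi> (mult C x y) = mult D (\<phi> x) (\<phi> y)) \<and>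
    (\<forall>x\<in>carrier C. \<phi> (star C x) = star D (\<phi> x)) \<and>
    (\<forall>x\<in>carrier C. cnorm D (\<phi> x) = cnorm C x)"

end

theory Submission
  imports Defs
begin

text \<open>
  Let \<open>(\<iota>, B, \<theta>)\<close> be the minimal dilation of \<open>\<tau>\<close>, let \<open>p\<close> be the projection onto \<open>\<H>\<close>, and write
  \<open>pzp\<close> for the compression of \<open>z\<close>. The whole proof rests on the identity
  \<open>\<theta>\<^sup>n(pzp) = \<theta>\<^sup>n(p) \<theta>\<^sup>n(z) \<theta>\<^sup>n(p)\<close> (\<open>theta_compress\<close>), on the fact that the projections \<open>\<theta>\<^sup>n(p)\<close>
  increase strongly to the identity (\<open>tendsto_proj\<close>, a consequence of minimality and \<open>\<tau>(1) = 1\<close>), and on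
  recurrence: there is a filter of times \<open>n\<close> along which \<open>c\<^sup>n \<rightarrow> 1\<close> for every \<open>c\<close> on the unit circle
  (\<open>return_times\<close>), and along it \<open>\<theta>\<^sup>n(z) \<rightarrow> z\<close> in norm for all \<open>z\<close> in the peripheral space of \<open>\<theta>\<close>
  (\<open>peripheral_recurrent\<close>).

  For peripheral \<open>z\<close> these facts give \<open>\<theta>\<^sup>n(pzp) \<rightarrow> z\<close> strongly along return times. As \<open>\<theta>\<close> is
  contractive, the compression is isometric on the peripheral space (\<open>norm_compress\<close>). It is onto because
  an eigenvector \<open>x\<close> of \<open>\<tau>\<close> for \<open>\<mu>\<close> lifts to the strong limit of \<open>\<mu>\<^bsup>-n\<^esup> \<theta>\<^sup>n(x)\<close>, which exists by a
  martingale argument (\<open>eigenvector_lift\<close>). The same facts show that the boundary product is the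
  strong limit of \<open>\<tau>\<^sup>n(xy)\<close> along return times (\<open>tendsto_boundary_mult\<close>), so it depends on \<open>\<tau>\<close> alone;
  and since \<open>n \<mapsto> kn\<close> preserves return times, \<open>\<tau>\<^sup>k\<close> yields the same product (\<open>boundary_mult_funpow\<close>).

  That the underlying spaces agree is linear algebra: a finite Fourier transform writes an eigenvector of
  \<open>\<tau>\<^sup>k\<close> for \<open>\<mu>\<close> as a sum of eigenvectors of \<open>\<tau>\<close> for the \<open>k\<close>-th roots of \<open>\<mu>\<close>
  (\<open>peripheral_space_funpow\<close>).

  Applied to \<open>\<theta>\<close> instead of \<open>\<tau>\<close>, the same decomposition identifies the \<open>k\<close>-cyclic peripheral space of
  \<open>\<theta>\<close> with the fixed points of \<open>\<theta>\<^sup>k\<close>. These form an ultraweakly closed \<open>*\<close>-subalgebra of \<open>B\<close>, which is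
  a von Neumann algebra by the bicommutant theorem (\<open>bicommutant_density\<close>, \<open>fixed_points_von_neumann\<close>),
  and the compression carries it isomorphically onto the \<open>k\<close>-cyclic boundary of \<open>\<tau>\<close>.
\<close>

section \<open>Hilbert space geometry\<close>

instance hilbert_space \<subseteq> banach ..

lemma cinner_add_left: "cinner (x + y) z = cinner x z + cinner y (z::'a::hilbert_space)"
  by (metis cinner_add_right cinner_commute complex_cnj_add)

lemma cinner_scaleC_left: "cinner (c *\<^sub>C x) y = cnj c * cinner x (y::'a::hilbert_space)"
  by (metis cinner_commute cinner_scaleC_right complex_cnj_mult)

lemma cinner_zero_right [simp]: "cinner x 0 = 0"
  using cinner_add_right[of x 0 0] by simp

lemma cinner_zero_left [simp]: "cinner 0 x = 0"
  using cinner_add_left[of 0 0 x] by simp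

lemma cinner_minus_right: "cinner x (- y) = - cinner x y"
  using cinner_add_right[of x y "- y"] by (simp add: eq_neg_iff_add_eq_0 add.commute)

lemma cinner_minus_left: "cinner (- x) y = - cinner x y"
  using cinner_add_left[of x "- x" y] by (simp add: eq_neg_iff_add_eq_0 add.commute)

lemma cinner_diff_right: "cinner x (y - z) = cinner x y - cinner x z"
  using cinner_add_right[of x y "- z"] by (simp add: cinner_minus_right)

lemma cinner_diff_left: "cinner (x - y) z = cinner x z - cinner y z"
  using cinner_add_left[of x "- y" z] by (simp add: cinner_minus_left)

lemma cinner_scaleR_right: "cinner x (r *\<^sub>R y) = r *\<^sub>R cinner x y"
  by (simp add: scaleR_scaleC cinner_scaleC_right scaleR_conv_of_real)

lemma cinner_scaleR_left: "cinner (r *\<^sub>R x) y = r *\<^sub>R cinner x y"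
  by (simp add: scaleR_scaleC cinner_scaleC_left scaleR_conv_of_real)

lemmas cinner_simps = cinner_add_left cinner_add_right cinner_diff_left cinner_diff_right
  cinner_scaleC_left cinner_scaleC_right

lemma cinner_self_eq_0_iff [simp]: "cinner x x = 0 \<longleftrightarrow> x = 0"
  by (simp add: cinner_self)

lemma cinner_ext:
  assumes "\<And>u. cinner u x = cinner u y"
  shows "x = y"
proof -
  have "cinner (x - y) (x - y) = 0"
    using assms[of "x - y"] by (simp add: cinner_diff_right)
  then show ?thesis
    by simp
qed

lemma norm_power2_add:
  "(norm (x + y))\<^sup>2 = (norm x)\<^sup>2 + (norm y)\<^sup>2 + 2 * Re (cinner x (y::'a::hilbert_space))"
proof -
  have "complex_of_real ((norm (x + y))\<^sup>2)
      = of_real ((norm x)\<^sup>2) + of_real ((norm y)\<^sup>2) + (cinner x y + cnj (cinner x y))"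
    unfolding cinner_self[symmetric] cinner_commute[of y x, symmetric]
    by (simp add: cinner_simps)
  also have "cinner x y + cnj (cinner x y) = of_real (2 * Re (cinner x y))"
    by (simp add: complex_add_cnj)
  finally show ?thesis
    by (metis of_real_add of_real_eq_iff)
qed

lemma norm_power2_diff:
  "(norm (x - y))\<^sup>2 = (norm x)\<^sup>2 + (norm y)\<^sup>2 - 2 * Re (cinner x (y::'a::hilbert_space))"
  using norm_power2_add[of x "- y"] by (simp add: cinner_minus_right)

lemma parallelogram:
  "(norm (x + y))\<^sup>2 + (norm (x - y))\<^sup>2 = 2 * (norm x)\<^sup>2 + 2 * (norm (y::'a::hilbert_space))\<^sup>2"
  by (simp add: norm_power2_add norm_power2_diff)

lemma Re_cinner_le: "Re (cinner x y) \<le> norm x * norm (y::'a::hilbert_space)"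
proof (cases "x = 0 \<or> y = 0")
  case False
  have "0 \<le> (norm (norm y *\<^sub>R x - norm x *\<^sub>R y))\<^sup>2"
    by simp
  also have "\<dots> = 2 * (norm x * norm y) * (norm x * norm y - Re (cinner x y))"
    unfolding norm_power2_diff
    by (simp add: cinner_scaleR_left cinner_scaleR_right power2_eq_square algebra_simps)
  finally have "0 \<le> 2 * (norm x * norm y) * (norm x * norm y - Re (cinner x y))" .
  moreover have "0 < 2 * (norm x * norm y)"
    using False by simp
  ultimately show ?thesis
    by (simp only: zero_le_mult_iff) linarith
qed auto

lemma cmod_cinner_le: "cmod (cinner x y) \<le> norm x * norm (y::'a::hilbert_space)"
proof (cases "cinner x y = 0")
  case False
  \<comment> \<open>Rotating \<open>x\<close> makes the inner product real.\<close>
  define c where "c = cinner x y / cmod (cinner x y)"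
  have c: "cmod c = 1"
    using False by (simp add: c_def norm_divide)
  have "cnj c * cinner x y = of_real (cmod (cinner x y))"
  proof -
    have "cnj c * cinner x y = (cinner x y * cnj (cinner x y)) / cmod (cinner x y)"
      by (simp add: c_def)
    also have "\<dots> = of_real (cmod (cinner x y))"
      using False by (simp add: complex_norm_square[symmetric] power2_eq_square)
    finally show ?thesis .
  qed
  then have "cmod (cinner x y) = Re (cinner (c *\<^sub>C x) y)"
    by (simp add: cinner_scaleC_left)
  also have "\<dots> \<le> norm (c *\<^sub>C x) * norm y"
    by (rule Re_cinner_le)
  finally show ?thesis
    by (simp add: norm_scaleC c)
qed simp

lemma bounded_bilinear_cinner: "bounded_bilinear (cinner :: 'a::hilbert_space \<Rightarrow> 'a \<Rightarrow> complex)"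
  by (rule bounded_bilinear.intro)
     (auto simp: cinner_simps cinner_scaleR_left cinner_scaleR_right
       intro!: exI[of _ 1] cmod_cinner_le)

lemmas tendsto_cinner [tendsto_intros] = bounded_bilinear.tendsto[OF bounded_bilinear_cinner]

lemma tendsto_scaleC [tendsto_intros]:
  assumes "(f \<longlongrightarrow> a) F" "(g \<longlongrightarrow> (b::'a::complex_normed_vector)) F"
  shows "((\<lambda>x. f x *\<^sub>C g x) \<longlongrightarrow> a *\<^sub>C b) F"
proof -
  have "bounded_bilinear (scaleC :: complex \<Rightarrow> 'a \<Rightarrow> 'a)"
    by (rule bounded_bilinear.intro)
       (auto simp: scaleC_add_left scaleC_add_right scaleR_scaleC scaleC_scaleC norm_scaleC
         mult.commute scaleR_conv_of_real intro!: exI[of _ 1])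
  from bounded_bilinear.tendsto[OF this assms] show ?thesis .
qed

text \<open>
  The parallelogram law makes every minimizing sequence Cauchy, so a closed subspace contains a
  point nearest to \<open>v\<close>; there the first variation of the distance vanishes.
\<close>

lemma orthogonal_decomposition:
  fixes v :: "'a::hilbert_space"
  assumes M: "complex_vector.subspace M" and cl: "closed M"
  obtains m where "m \<in> M" "\<And>w. w \<in> M \<Longrightarrow> cinner w (v - m) = 0"
proof -
  define d where "d = Inf ((\<lambda>m. norm (v - m)) ` M)"
  have M0: "0 \<in> M" and Madd: "\<And>x y. x \<in> M \<Longrightarrow> y \<in> M \<Longrightarrow> x + y \<in> M"
    and Mscale: "\<And>c x. x \<in> M \<Longrightarrow> c *\<^sub>C x \<in> M"
    using M by (auto simp: complex_vector.subspace_def)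
  have bdd: "bdd_below ((\<lambda>m. norm (v - m)) ` M)"
    by (rule bdd_belowI[of _ 0]) auto
  have d_le: "d \<le> norm (v - m)" if "m \<in> M" for m
    unfolding d_def using that bdd by (auto intro: cInf_lower)
  have d0: "d \<ge> 0"
    unfolding d_def using M0 by (intro cInf_greatest) auto
  have "\<exists>m\<in>M. norm (v - m) < d + 1 / Suc n" for n
  proof -
    have "Inf ((\<lambda>m. norm (v - m)) ` M) < d + 1 / Suc n"
      by (simp add: d_def)
    from cInf_lessD[OF _ this] show ?thesis
      using M0 by blast
  qed
  then obtain s where sM: "\<And>n. s n \<in> M" and s: "\<And>n. norm (v - s n) < d + 1 / Suc n"
    by metis
  have dist2: "(norm (x - y))\<^sup>2 \<le> 2 * (norm (v - x))\<^sup>2 + 2 * (norm (v - y))\<^sup>2 - 4 * d\<^sup>2"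
    if "x \<in> M" "y \<in> M" for x y
  proof -
    have "(1/2) *\<^sub>R (x + y) \<in> M"
      using Mscale[OF Madd[OF that], of "of_real (1/2)"] by (simp add: scaleR_scaleC)
    from d_le[OF this] have "d\<^sup>2 \<le> (norm (v - (1/2) *\<^sub>R (x + y)))\<^sup>2"
      using d0 by (intro power_mono)
    moreover have "(v - x) + (v - y) = 2 *\<^sub>R (v - (1/2) *\<^sub>R (x + y))"
      by (simp add: algebra_simps scaleR_2)
    then have "(norm ((v - x) + (v - y)))\<^sup>2 = 4 * (norm (v - (1/2) *\<^sub>R (x + y)))\<^sup>2"
      by (simp add: power_mult_distrib)
    moreover have "norm ((v - x) - (v - y)) = norm (x - y)"
      by (simp add: norm_minus_commute)
    ultimately show ?thesis
      using parallelogram[of "v - x" "v - y"] by simp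
  qed
  have norm_s: "(\<lambda>n. norm (v - s n)) \<longlonglongrightarrow> d"
  proof (rule tendsto_sandwich[of "\<lambda>_. d"])
    show "(\<lambda>n. d + 1 / Suc n) \<longlonglongrightarrow> d"
      using tendsto_add[OF tendsto_const LIMSEQ_inverse_real_of_nat, of d]
      by (simp add: inverse_eq_divide)
    show "\<forall>\<^sub>F n in sequentially. norm (v - s n) \<le> d + 1 / Suc n"
      using s by (intro always_eventually allI less_imp_le)
  qed (auto intro!: always_eventually d_le sM)
  have "Cauchy s"
  proof (rule metric_CauchyI)
    fix e :: real assume e: "e > 0"
    have "(\<lambda>n. (norm (v - s n))\<^sup>2) \<longlonglongrightarrow> d\<^sup>2"
      by (intro tendsto_intros norm_s)
    then have "\<forall>\<^sub>F n in sequentially. (norm (v - s n))\<^sup>2 < d\<^sup>2 + e\<^sup>2 / 4"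
      using e by (intro order_tendstoD) auto
    then obtain N where N: "\<And>n. n \<ge> N \<Longrightarrow> (norm (v - s n))\<^sup>2 < d\<^sup>2 + e\<^sup>2 / 4"
      by (auto simp: eventually_sequentially)
    have "dist (s m) (s n) < e" if "m \<ge> N" "n \<ge> N" for m n
    proof -
      have "(norm (s m - s n))\<^sup>2 < e\<^sup>2"
        using dist2[OF sM sM, of m n] N[OF that(1)] N[OF that(2)] by simp
      then show ?thesis
        using e by (simp add: dist_norm power2_less_imp_less)
    qed
    then show "\<exists>N. \<forall>m\<ge>N. \<forall>n\<ge>N. dist (s m) (s n) < e"
      by blast
  qed
  then obtain m where m: "s \<longlonglongrightarrow> m"
    using Cauchy_convergent convergent_def by blast
  have mM: "m \<in> M"
    using closed_sequentially[OF cl sM m] .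
  have nm: "norm (v - m) = d"
    by (rule LIMSEQ_unique[OF _ norm_s]) (intro tendsto_intros m)
  have "cinner w (v - m) = 0" if w: "w \<in> M" for w
  proof (rule ccontr)
    assume ne: "cinner w (v - m) \<noteq> 0"
    then have w0: "w \<noteq> 0"
      by auto
    \<comment> \<open>Moving from \<open>m\<close> along \<open>w\<close> by the Fourier coefficient would decrease the distance.\<close>
    define c where "c = cinner w (v - m) / (norm w)\<^sup>2"
    have "m + c *\<^sub>C w \<in> M"
      using mM w Madd Mscale by blast
    then have "d\<^sup>2 \<le> (norm ((v - m) - c *\<^sub>C w))\<^sup>2"
      using d_le[of "m + c *\<^sub>C w"] d0 by (simp add: diff_diff_eq power_mono)
    also have "\<dots> = d\<^sup>2 + (cmod c * norm w)\<^sup>2 - 2 * Re (c * cinner (v - m) w)"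
      by (simp add: norm_power2_diff nm norm_scaleC cinner_scaleC_right)
    also have "c * cinner (v - m) w = of_real ((cmod c * norm w)\<^sup>2)"
    proof -
      have "cinner (v - m) w = cnj c * (norm w)\<^sup>2"
        using w0 by (subst cinner_commute) (simp add: c_def)
      then show ?thesis
        using complex_norm_square[of c] by (simp add: power_mult_distrib)
    qed
    finally have "cmod c * norm w = 0"
      by simp
    then show False
      using ne w0 by (simp add: c_def)
  qed
  with mM show ?thesis
    using that by blast
qed

text \<open>
  The kernel of \<open>f\<close> is closed and has codimension at most one; a suitable multiple of a vector orthogonal
  to it represents \<open>f\<close>.
\<close>

lemma riesz_representation:
  fixes f :: "'a::hilbert_space \<Rightarrow> complex"
  assumes bl: "bounded_linear f" and hom: "\<And>c v. f (c *\<^sub>C v) = c * f v"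
  shows "\<exists>w. \<forall>v. f v = cinner w v"
proof (cases "\<forall>v. f v = 0")
  case True
  then show ?thesis
    by (intro exI[of _ 0]) simp
next
  case False
  then obtain u where u: "f u \<noteq> 0"
    by blast
  interpret bounded_linear f by fact
  let ?M = "{v. f v = 0}"
  have "complex_vector.subspace ?M"
    by (auto simp: complex_vector.subspace_def zero add hom)
  moreover have "closed ?M"
    using continuous_closed_preimage_constant[of UNIV f 0]
      linear_continuous_on[OF bl, of UNIV] by simp
  ultimately obtain m where m: "m \<in> ?M" "\<And>w. w \<in> ?M \<Longrightarrow> cinner w (u - m) = 0"
    using orthogonal_decomposition by metis
  define e where "e = u - m"
  have fe: "f e = f u"
    using m by (simp add: e_def diff)
  then have e0: "e \<noteq> 0"
    using u zero by auto
  define w where "w = cnj (f e / (norm e)\<^sup>2) *\<^sub>C e"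
  have "f v = cinner w v" for v
  proof -
    have "cinner (v - (f v / f e) *\<^sub>C e) e = 0"
      unfolding e_def[symmetric]
      by (rule m(2)[folded e_def]) (use u fe in \<open>simp add: diff hom\<close>)
    then have "cinner v e = cnj (f v / f e) * (norm e)\<^sup>2"
      by (simp add: cinner_simps cinner_self)
    then have "cinner e v = (f v / f e) * (norm e)\<^sup>2"
      by (subst cinner_commute) simp
    then show ?thesis
      using e0 u fe by (simp add: w_def cinner_scaleC_left)
  qed
  then show ?thesis
    by blast
qed


section \<open>Adjoints\<close>

lemma blinfun_cinner_bound:
  "cmod (cinner u (blinfun_apply x v)) \<le> norm x * norm v * norm u"
  using cmod_cinner_le[of u "blinfun_apply x v"] norm_blinfun[of x v]
  by (smt (verit, best) mult.commute mult_right_mono norm_ge_zero)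

lemma adj_exists:
  fixes x :: "'a::hilbert_space \<Rightarrow>\<^sub>L 'b::hilbert_space"
  assumes x: "clinear_op x"
  shows "\<exists>y. \<forall>u v. cinner (blinfun_apply x u) v = cinner u (blinfun_apply y v)"
proof -
  have "\<exists>w. \<forall>u. cinner v (blinfun_apply x u) = cinner w u" for v
  proof (rule riesz_representation)
    show "bounded_linear (\<lambda>u. cinner v (blinfun_apply x u))"
      by (intro bounded_linear_compose[OF bounded_bilinear.bounded_linear_right[OF bounded_bilinear_cinner]]
          blinfun.bounded_linear_right)
    show "cinner v (blinfun_apply x (c *\<^sub>C u)) = c * cinner v (blinfun_apply x u)" for c u
      using x by (simp add: clinear_op_def cinner_scaleC_right)
  qed
  then obtain g where g: "\<And>v u. cinner v (blinfun_apply x u) = cinner (g v) u"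
    by metis
  have g': "cinner (blinfun_apply x u) v = cinner u (g v)" for u v
    by (metis g cinner_commute)
  have "bounded_linear g"
  proof (rule bounded_linear_intro[where K = "norm x"])
    show "g (v + w) = g v + g w" for v w
      by (rule cinner_ext) (simp add: cinner_add_right flip: g')
    show "g (r *\<^sub>R v) = r *\<^sub>R g v" for r v
      by (rule cinner_ext) (simp add: cinner_scaleR_right flip: g')
    show "norm (g v) \<le> norm v * norm x" for v
    proof (cases "g v = 0")
      case False
      have "(norm (g v))\<^sup>2 = cmod (cinner v (blinfun_apply x (g v)))"
        by (simp add: g cinner_self norm_power)
      also have "\<dots> \<le> norm x * norm (g v) * norm v"
        by (rule blinfun_cinner_bound)
      finally show ?thesis
        using False by (simp add: power2_eq_square mult_ac)
    qed simp
  qed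
  then show ?thesis
    by (intro exI[of _ "Blinfun g"]) (simp add: bounded_linear_Blinfun_apply g')
qed

lemma adj_unique:
  assumes "\<And>u v. cinner (blinfun_apply x u) v = cinner u (blinfun_apply y v)"
  shows "adj x = y"
  unfolding adj_def
proof (rule the_equality)
  show "\<forall>u v. cinner (blinfun_apply x u) v = cinner u (blinfun_apply y v)"
    using assms by blast
next
  fix z
  assume z: "\<forall>u v. cinner (blinfun_apply x u) v = cinner u (blinfun_apply z v)"
  show "z = y"
    by (intro blinfun_eqI cinner_ext) (metis z assms)
qed

lemma cinner_adj_right:
  assumes "clinear_op x"
  shows "cinner u (blinfun_apply (adj x) v) = cinner (blinfun_apply x u) v"
proof -
  obtain y where "\<And>u v. cinner (blinfun_apply x u) v = cinner u (blinfun_apply y v)"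
    using adj_exists[OF assms] by blast
  with adj_unique[OF this] show ?thesis
    by simp
qed

lemma cinner_adj_left:
  assumes "clinear_op x"
  shows "cinner (blinfun_apply (adj x) u) v = cinner u (blinfun_apply x v)"
  by (metis assms cinner_adj_right cinner_commute)

lemma clinear_opD: "clinear_op x \<Longrightarrow> blinfun_apply x (c *\<^sub>C v) = c *\<^sub>C blinfun_apply x v"
  by (simp add: clinear_op_def)

lemma clinear_op_adj: "clinear_op x \<Longrightarrow> clinear_op (adj x)"
  unfolding clinear_op_def[of "adj x"]
  by (intro allI cinner_ext) (simp add: cinner_adj_right cinner_scaleC_right)

lemma clinear_op_compose: "clinear_op x \<Longrightarrow> clinear_op y \<Longrightarrow> clinear_op (x o\<^sub>L y)"
  by (simp add: clinear_op_def)

lemma clinear_op_simps: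
  "clinear_op 0" "clinear_op id_blinfun"
  "clinear_op x \<Longrightarrow> clinear_op y \<Longrightarrow> clinear_op (x + y)"
  "clinear_op x \<Longrightarrow> clinear_op y \<Longrightarrow> clinear_op (x - y)"
  "clinear_op x \<Longrightarrow> clinear_op (c *\<^sub>C x)"
  by (simp_all add: clinear_op_def blinfun.add_left blinfun.diff_left scaleC_blinfun.rep_eq
      scaleC_add_right complex_vector.scale_right_diff_distrib scaleC_scaleC mult.commute)

lemma adj_compose: "clinear_op x \<Longrightarrow> clinear_op y \<Longrightarrow> adj (x o\<^sub>L y) = adj y o\<^sub>L adj x"
  by (rule adj_unique) (simp add: cinner_adj_right)

lemma blinfun_compose_simps:
  fixes x x' :: "'b::real_normed_vector \<Rightarrow>\<^sub>L 'c::complex_normed_vector"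
    and y y' :: "'a::complex_normed_vector \<Rightarrow>\<^sub>L 'b"
  shows "(x + x') o\<^sub>L y = (x o\<^sub>L y) + (x' o\<^sub>L y)"
    "(x - x') o\<^sub>L y = (x o\<^sub>L y) - (x' o\<^sub>L y)"
    "x o\<^sub>L (y + y') = (x o\<^sub>L y) + (x o\<^sub>L y')"
    "x o\<^sub>L (y - y') = (x o\<^sub>L y) - (x o\<^sub>L y')"
    "(c *\<^sub>C x) o\<^sub>L y = c *\<^sub>C (x o\<^sub>L y)"
  by (auto intro!: blinfun_eqI simp: blinfun.bilinear_simps scaleC_blinfun.rep_eq)

lemma blinfun_compose_scaleC_right:
  fixes x :: "'b::complex_normed_vector \<Rightarrow>\<^sub>L 'c::complex_normed_vector"
  shows "clinear_op x \<Longrightarrow> x o\<^sub>L (c *\<^sub>C y) = c *\<^sub>C (x o\<^sub>L y)"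
  by (auto intro!: blinfun_eqI simp: scaleC_blinfun.rep_eq clinear_op_def)

lemma norm_adj_le: "clinear_op x \<Longrightarrow> norm (adj x) \<le> norm x"
proof (rule norm_blinfun_bound)
  fix v assume x: "clinear_op x"
  show "norm (blinfun_apply (adj x) v) \<le> norm x * norm v"
  proof (cases "blinfun_apply (adj x) v = 0")
    case False
    have "(norm (blinfun_apply (adj x) v))\<^sup>2 = cmod (cinner v (blinfun_apply x (blinfun_apply (adj x) v)))"
      by (simp add: cinner_adj_left[OF x, symmetric] cinner_self norm_power)
    also have "\<dots> \<le> norm x * norm (blinfun_apply (adj x) v) * norm v"
      by (rule blinfun_cinner_bound)
    finally show ?thesis
      using False by (simp add: power2_eq_square mult_ac)
  qed simp
qed simp

lemma norm_apply_power2: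
  assumes "clinear_op x"
  shows "(norm (blinfun_apply x v))\<^sup>2 = Re (cinner v (blinfun_apply (adj x) (blinfun_apply x v)))"
  by (simp add: cinner_adj_right[OF assms] cinner_self)

lemma isometry_adj_compose:
  assumes "isometric_embedding \<iota>"
  shows "adj \<iota> o\<^sub>L \<iota> = id_blinfun"
proof -
  have cl: "clinear_op \<iota>" and nm: "norm (blinfun_apply \<iota> v) = norm v" for v
    using assms by (auto simp: isometric_embedding_def)
  have re: "Re (cinner (blinfun_apply \<iota> u) (blinfun_apply \<iota> v)) = Re (cinner u v)" for u v
    using norm_power2_add[of u v] norm_power2_add[of "blinfun_apply \<iota> u" "blinfun_apply \<iota> v"]
    by (simp add: nm flip: blinfun.add_right)
  \<comment> \<open>Polarization: the imaginary part is the real part after multiplication by \<open>\<i>\<close>.\<close>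
  have im: "Im (cinner (blinfun_apply \<iota> u) (blinfun_apply \<iota> v)) = Im (cinner u v)" for u v
    using re[of "\<i> *\<^sub>C u" v] by (simp add: clinear_opD[OF cl] cinner_scaleC_left)
  show ?thesis
    by (intro blinfun_eqI cinner_ext) (simp add: cinner_adj_right[OF cl] complex_eq_iff re im)
qed

lemma norm_isometry_le:
  assumes "isometric_embedding \<iota>"
  shows "norm \<iota> \<le> 1" "norm (adj \<iota>) \<le> 1"
proof -
  show "norm \<iota> \<le> 1"
    by (rule norm_blinfun_bound) (use assms in \<open>auto simp: isometric_embedding_def\<close>)
  with norm_adj_le[of \<iota>] assms show "norm (adj \<iota>) \<le> 1"
    by (simp add: isometric_embedding_def)
qed

section \<open>Von Neumann algebras and their endomorphisms\<close>

lemma blinfun_compose_assoc: "(x o\<^sub>L y) o\<^sub>L z = x o\<^sub>L (y o\<^sub>L z)"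
  by (rule blinfun_eqI) simp

lemma blinfun_compose_id [simp]: "x o\<^sub>L id_blinfun = x" "id_blinfun o\<^sub>L x = x"
  by (rule blinfun_eqI; simp)+

lemma tendsto_blinfun_apply:
  assumes "(X \<longlongrightarrow> Z) F"
  shows "((\<lambda>n. blinfun_apply (X n) v) \<longlongrightarrow> blinfun_apply Z v) F"
  by (intro tendsto_intros assms)

text \<open>
  The estimate behind the joint strong continuity of multiplication on norm-bounded nets.
\<close>

lemma tendsto_bounded_apply:
  fixes X :: "'i \<Rightarrow> 'a::real_normed_vector \<Rightarrow>\<^sub>L 'b::real_normed_vector"
  assumes X: "((\<lambda>n. blinfun_apply (X n) v) \<longlongrightarrow> w) F"
    and bound: "\<forall>\<^sub>F n in F. norm (X n) \<le> C"
    and V: "(V \<longlongrightarrow> v) F"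
  shows "((\<lambda>n. blinfun_apply (X n) (V n)) \<longlongrightarrow> w) F"
proof -
  have "((\<lambda>n. blinfun_apply (X n) (V n - v)) \<longlongrightarrow> 0) F"
  proof (rule Lim_null_comparison)
    show "\<forall>\<^sub>F n in F. norm (blinfun_apply (X n) (V n - v)) \<le> C * norm (V n - v)"
      using bound
      by eventually_elim (meson norm_blinfun mult_right_mono norm_ge_zero order_trans)
    have "((\<lambda>n. C * norm (V n - v)) \<longlongrightarrow> C * norm (v - v)) F"
      by (intro tendsto_intros V)
    then show "((\<lambda>n. C * norm (V n - v)) \<longlongrightarrow> 0) F"
      by simp
  qed
  from tendsto_add[OF this X] show ?thesis
    by (simp add: blinfun.diff_right)
qed

lemma commutantI:
  "clinear_op y \<Longrightarrow> (\<And>x. x \<in> S \<Longrightarrow> y o\<^sub>L x = x o\<^sub>L y) \<Longrightarrow> y \<in> commutant S"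
  by (simp add: commutant_def bounded_ops_def)

lemma commutantD:
  assumes "y \<in> commutant S"
  shows "clinear_op y" "x \<in> S \<Longrightarrow> y o\<^sub>L x = x o\<^sub>L y"
  using assms by (auto simp: commutant_def bounded_ops_def)

lemma commutant_antimono: "S \<subseteq> T \<Longrightarrow> commutant T \<subseteq> commutant S"
  by (auto simp: commutant_def)

lemma commutant_id: "id_blinfun \<in> commutant S"
  by (rule commutantI) (auto simp: clinear_op_simps intro: blinfun_eqI)

lemma commutant_compose:
  assumes x: "x \<in> commutant S" and y: "y \<in> commutant S"
  shows "x o\<^sub>L y \<in> commutant S"
proof (rule commutantI)
  show "clinear_op (x o\<^sub>L y)"
    using assms by (intro clinear_op_compose commutantD(1))
  show "(x o\<^sub>L y) o\<^sub>L z = z o\<^sub>L (x o\<^sub>L y)" if "z \<in> S" for z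
    using commutantD(2)[OF x that] commutantD(2)[OF y that]
    by (simp add: blinfun_compose_assoc) (simp flip: blinfun_compose_assoc)
qed

lemma commutant_add:
  assumes x: "x \<in> commutant S" and y: "y \<in> commutant S" and S: "S \<subseteq> bounded_ops"
  shows "x + y \<in> commutant S"
  using commutantD[OF x] commutantD[OF y] S
  by (intro commutantI) (auto simp: clinear_op_simps blinfun_compose_simps)

lemma commutant_scaleC:
  assumes x: "x \<in> commutant S" and S: "S \<subseteq> bounded_ops"
  shows "c *\<^sub>C x \<in> commutant S"
  using commutantD[OF x] S
  by (intro commutantI)
     (auto simp: clinear_op_simps blinfun_compose_simps blinfun_compose_scaleC_right bounded_ops_def
       subset_iff)

text \<open>
  Commutation with a fixed operator is a strongly closed condition. A double commutant therefore contains
  the strong limits of its elements, which is how the lift of an eigenvector is seen to lie in \<open>B\<close>.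
\<close>

lemma commutant_strong_limit:
  assumes F: "F \<noteq> bot" and X: "\<forall>\<^sub>F n in F. X n \<in> commutant S"
    and lim: "\<And>v. ((\<lambda>n. blinfun_apply (X n) v) \<longlongrightarrow> blinfun_apply Z v) F"
  shows "Z \<in> commutant S"
proof (rule commutantI)
  show "clinear_op Z"
    unfolding clinear_op_def
  proof (intro allI)
    fix c v
    have "((\<lambda>n. c *\<^sub>C blinfun_apply (X n) v) \<longlongrightarrow> c *\<^sub>C blinfun_apply Z v) F"
      by (intro tendsto_intros lim)
    moreover have "\<forall>\<^sub>F n in F. c *\<^sub>C blinfun_apply (X n) v = blinfun_apply (X n) (c *\<^sub>C v)"
      using X by eventually_elim (simp add: clinear_opD commutantD(1))
    ultimately have "((\<lambda>n. blinfun_apply (X n) (c *\<^sub>C v)) \<longlongrightarrow> c *\<^sub>C blinfun_apply Z v) F"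
      by (rule Lim_transform_eventually)
    then show "blinfun_apply Z (c *\<^sub>C v) = c *\<^sub>C blinfun_apply Z v"
      using tendsto_unique[OF F lim] by blast
  qed
next
  fix x assume x: "x \<in> S"
  show "Z o\<^sub>L x = x o\<^sub>L Z"
  proof (rule blinfun_eqI)
    fix v
    have "((\<lambda>n. blinfun_apply x (blinfun_apply (X n) v)) \<longlongrightarrow> blinfun_apply x (blinfun_apply Z v)) F"
      by (intro tendsto_intros lim)
    moreover have "\<forall>\<^sub>F n in F. blinfun_apply x (blinfun_apply (X n) v)
        = blinfun_apply (X n) (blinfun_apply x v)"
      using X
    proof eventually_elim
      case (elim n)
      from commutantD(2)[OF elim x] show ?case
        by (metis blinfun_apply_blinfun_compose)
    qed
    ultimately have
      "((\<lambda>n. blinfun_apply (X n) (blinfun_apply x v)) \<longlongrightarrow> blinfun_apply x (blinfun_apply Z v)) F"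
      by (rule Lim_transform_eventually)
    then show "blinfun_apply (Z o\<^sub>L x) v = blinfun_apply (x o\<^sub>L Z) v"
      using tendsto_unique[OF F lim] by simp
  qed
qed

context
  fixes M :: "('k::hilbert_space \<Rightarrow>\<^sub>L 'k) set"
  assumes M: "von_neumann_algebra M"
begin

lemma vN_clinear: "x \<in> M \<Longrightarrow> clinear_op x"
  using M by (auto simp: von_neumann_algebra_def bounded_ops_def)

lemma vN_adj: "x \<in> M \<Longrightarrow> adj x \<in> M"
  using M by (auto simp: von_neumann_algebra_def)

lemma vN_bicommutant: "commutant (commutant M) = M"
  using M by (auto simp: von_neumann_algebra_def)

lemma commutant_subset_bounded_ops: "commutant S \<subseteq> bounded_ops"
  by (auto simp: commutant_def)

lemma vN_id: "id_blinfun \<in> M"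
  using commutant_id[of "commutant M"] by (simp add: vN_bicommutant)

lemma vN_compose: "x \<in> M \<Longrightarrow> y \<in> M \<Longrightarrow> x o\<^sub>L y \<in> M"
  using commutant_compose[of x "commutant M" y] by (simp add: vN_bicommutant)

lemma vN_add: "x \<in> M \<Longrightarrow> y \<in> M \<Longrightarrow> x + y \<in> M"
  using commutant_add[OF _ _ commutant_subset_bounded_ops, of x M y] by (simp add: vN_bicommutant)

lemma vN_scaleC: "x \<in> M \<Longrightarrow> c *\<^sub>C x \<in> M"
  using commutant_scaleC[OF _ commutant_subset_bounded_ops, of x M c] by (simp add: vN_bicommutant)

lemma vN_zero: "0 \<in> M"
  using vN_scaleC[OF vN_id, of 0] by simp

lemma vN_diff: "x \<in> M \<Longrightarrow> y \<in> M \<Longrightarrow> x - y \<in> M"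
  using vN_add[of x "(-1) *\<^sub>C y"] vN_scaleC[of y "-1"] by simp

lemma vN_subspace: "complex_vector.subspace M"
  by (simp add: complex_vector.subspace_def vN_zero vN_add vN_scaleC)

lemma vN_strong_limit:
  assumes "F \<noteq> bot" "\<forall>\<^sub>F n in F. X n \<in> M"
    and "\<And>v. ((\<lambda>n. blinfun_apply (X n) v) \<longlongrightarrow> blinfun_apply Z v) F"
  shows "Z \<in> M"
  using commutant_strong_limit[of F X "commutant M" Z] assms by (simp add: vN_bicommutant)

lemma vN_closed: "closed M"
  unfolding closed_sequential_limits
  by (auto intro!: vN_strong_limit[OF sequentially_bot] tendsto_blinfun_apply)

end

locale star_endomorphism =
  fixes B :: "('k::hilbert_space \<Rightarrow>\<^sub>L 'k) set" and \<theta> :: "('k \<Rightarrow>\<^sub>L 'k) \<Rightarrow> ('k \<Rightarrow>\<^sub>L 'k)"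
  assumes vN: "von_neumann_algebra B"
    and endo: "normal_unital_star_endomorphism B \<theta>"
begin

lemma unital_linear: "unital_linear_on B \<theta>"
  using endo by (simp add: normal_unital_star_endomorphism_def)

lemma in_B: "x \<in> B \<Longrightarrow> \<theta> x \<in> B"
  and add: "x \<in> B \<Longrightarrow> y \<in> B \<Longrightarrow> \<theta> (x + y) = \<theta> x + \<theta> y"
  and scaleC: "x \<in> B \<Longrightarrow> \<theta> (c *\<^sub>C x) = c *\<^sub>C \<theta> x"
  and one: "\<theta> id_blinfun = id_blinfun"
  and mult: "x \<in> B \<Longrightarrow> y \<in> B \<Longrightarrow> \<theta> (x o\<^sub>L y) = \<theta> x o\<^sub>L \<theta> y"
  and adj: "x \<in> B \<Longrightarrow> \<theta> (adj x) = adj (\<theta> x)"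
  using endo by (auto simp: normal_unital_star_endomorphism_def unital_linear_on_def)

lemma diff: "x \<in> B \<Longrightarrow> y \<in> B \<Longrightarrow> \<theta> (x - y) = \<theta> x - \<theta> y"
  using add[of x "(-1) *\<^sub>C y"] scaleC[of y "-1"] vN_scaleC[OF vN, of y "-1"]
  by simp

text \<open>
  Suppose \<open>c = \<parallel>\<theta> x\<parallel> > \<parallel>x\<parallel>\<close>. Then \<open>1 - x\<^sup>* x / c\<^sup>2\<close> has a left inverse in \<open>B\<close> (its Neumann series,
  here obtained as the fixed point of a contraction), so that \<open>1 - T\<^sup>* T / c\<^sup>2\<close> with \<open>T = \<theta> x\<close> is bounded below.
  But \<open>\<parallel>v - T\<^sup>* T v / c\<^sup>2\<parallel>\<^sup>2 \<le> \<parallel>v\<parallel>\<^sup>2 - \<parallel>T v\<parallel>\<^sup>2 / c\<^sup>2\<close>, which forces \<open>\<parallel>T\<parallel> < c\<close>.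
\<close>

lemma contractive:
  assumes x: "x \<in> B"
  shows "norm (\<theta> x) \<le> norm x"
proof (rule ccontr)
  define T where "T = \<theta> x"
  define c where "c = norm T"
  assume "\<not> norm (\<theta> x) \<le> norm x"
  then have xc: "norm x < c" and c: "c > 0"
    by (auto simp: c_def T_def intro: le_less_trans[OF norm_ge_zero])
  define a where "a = complex_of_real (1 / c\<^sup>2) *\<^sub>C (adj x o\<^sub>L x)"
  have clx: "clinear_op x" and clT: "clinear_op T"
    using x in_B by (auto simp: T_def intro: vN_clinear[OF vN])
  have aB: "a \<in> B"
    using x by (simp add: a_def vN_scaleC[OF vN] vN_compose[OF vN] vN_adj[OF vN])
  have "norm (adj x o\<^sub>L x) \<le> norm x * norm x"
    using norm_blinfun_compose[of "adj x" x] norm_adj_le[OF clx]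
    by (meson mult_right_mono norm_ge_zero order_trans)
  then have na: "norm a \<le> (norm x / c)\<^sup>2"
    by (simp add: a_def norm_scaleC norm_divide norm_power norm_mult power2_eq_square divide_right_mono)
  also have "(norm x / c)\<^sup>2 < 1"
    using xc c by (simp add: power_divide power_strict_mono)
  finally have a1: "norm a < 1" .
  have "\<exists>!y. y \<in> B \<and> id_blinfun + (y o\<^sub>L a) = y"
  proof (rule Banach_fix[where c = "norm a"])
    show "complete B"
      using vN_closed[OF vN] by (simp add: complete_eq_closed)
    show "B \<noteq> {}"
      using x by blast
    show "(\<lambda>y. id_blinfun + (y o\<^sub>L a)) ` B \<subseteq> B"
      using aB by (auto simp: vN_id[OF vN] vN_compose[OF vN] vN_add[OF vN])
    show "dist (id_blinfun + (y o\<^sub>L a)) (id_blinfun + (z o\<^sub>L a)) \<le> norm a * dist y z"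
      if "y \<in> B" "z \<in> B" for y z
      using norm_blinfun_compose[of "y - z" a]
      by (simp add: dist_norm blinfun_compose_simps mult.commute)
  qed (use a1 in auto)
  then obtain y where y: "y \<in> B" "id_blinfun + (y o\<^sub>L a) = y"
    by blast
  have "\<theta> y = id_blinfun + (\<theta> y o\<^sub>L \<theta> a)"
    using y aB add[of id_blinfun "y o\<^sub>L a"] mult[of y a]
    by (simp add: vN_id[OF vN] vN_compose[OF vN] one)
  moreover have ta: "\<theta> a = complex_of_real (1 / c\<^sup>2) *\<^sub>C (adj T o\<^sub>L T)"
    using x by (simp add: a_def T_def scaleC mult adj vN_compose[OF vN] vN_adj[OF vN])
  ultimately have left_inv: "v = blinfun_apply (\<theta> y) (v - (1 / c\<^sup>2) *\<^sub>R blinfun_apply (adj T) (blinfun_apply T v))" for v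
  proof -
    assume *: "\<theta> y = id_blinfun + (\<theta> y o\<^sub>L \<theta> a)" and
      "\<theta> a = complex_of_real (1 / c\<^sup>2) *\<^sub>C (adj T o\<^sub>L T)"
    then have "blinfun_apply (\<theta> a) v = (1 / c\<^sup>2) *\<^sub>R blinfun_apply (adj T) (blinfun_apply T v)"
      by (simp add: scaleC_blinfun.rep_eq scaleR_scaleC)
    then show ?thesis
      using arg_cong[OF *, of "\<lambda>z. blinfun_apply z v"]
      by (simp add: blinfun.add_left blinfun.diff_right)
  qed
  \<comment> \<open>The summand \<open>1\<close> keeps \<open>1 / K\<close> in \<open>(0, 1]\<close>.\<close>
  define K where "K = (norm (\<theta> y))\<^sup>2 + 1"
  have K: "K \<ge> 1"
    by (simp add: K_def)
  have Tv: "(norm (blinfun_apply T v))\<^sup>2 \<le> c\<^sup>2 * (1 - 1 / K) * (norm v)\<^sup>2" for v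
  proof -
    define w where "w = v - (1 / c\<^sup>2) *\<^sub>R blinfun_apply (adj T) (blinfun_apply T v)"
    have "norm (blinfun_apply (adj T) (blinfun_apply T v)) \<le> norm (adj T) * norm (blinfun_apply T v)"
      by (rule norm_blinfun)
    also have "\<dots> \<le> c * norm (blinfun_apply T v)"
      using norm_adj_le[OF clT] by (simp add: c_def mult_right_mono)
    finally have "(norm (blinfun_apply (adj T) (blinfun_apply T v)))\<^sup>2 \<le> (c * norm (blinfun_apply T v))\<^sup>2"
      by (rule power_mono) simp
    then have adjT: "(1 / c\<^sup>2)\<^sup>2 * (norm (blinfun_apply (adj T) (blinfun_apply T v)))\<^sup>2
        \<le> (norm (blinfun_apply T v))\<^sup>2 / c\<^sup>2"
      using c by (simp add: power_mult_distrib field_simps power2_eq_square)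
    have "(norm w)\<^sup>2 = (norm v)\<^sup>2 + (1 / c\<^sup>2)\<^sup>2 * (norm (blinfun_apply (adj T) (blinfun_apply T v)))\<^sup>2
        - 2 * ((norm (blinfun_apply T v))\<^sup>2 / c\<^sup>2)"
      by (simp add: w_def norm_power2_diff cinner_scaleR_right norm_apply_power2[OF clT, symmetric]
          power_mult_distrib power_divide)
    with adjT have w_le: "(norm w)\<^sup>2 \<le> (norm v)\<^sup>2 - (norm (blinfun_apply T v))\<^sup>2 / c\<^sup>2"
      by linarith
    have "norm v \<le> norm (\<theta> y) * norm w"
      using norm_blinfun[of "\<theta> y" w] left_inv[of v] by (simp add: w_def)
    then have "(norm v)\<^sup>2 \<le> (norm (\<theta> y))\<^sup>2 * (norm w)\<^sup>2"
      by (metis power_mono norm_ge_zero power_mult_distrib)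
    also have "\<dots> \<le> K * (norm w)\<^sup>2"
      by (simp add: K_def mult_right_mono)
    also have "\<dots> \<le> K * ((norm v)\<^sup>2 - (norm (blinfun_apply T v))\<^sup>2 / c\<^sup>2)"
      using w_le K by (intro mult_left_mono) auto
    finally show ?thesis
      using K c by (simp add: field_simps)
  qed
  have "norm T \<le> c * sqrt (1 - 1 / K)"
  proof (rule norm_blinfun_bound)
    show "0 \<le> c * sqrt (1 - 1 / K)"
      using K c by simp
    show "norm (blinfun_apply T v) \<le> c * sqrt (1 - 1 / K) * norm v" for v
    proof (rule power2_le_imp_le)
      show "(norm (blinfun_apply T v))\<^sup>2 \<le> (c * sqrt (1 - 1 / K) * norm v)\<^sup>2"
        using Tv[of v] K by (simp add: power_mult_distrib)
    qed (use K c in simp)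
  qed
  moreover have "sqrt (1 - 1 / K) < 1"
    using K by simp
  ultimately show False
    using c by (simp add: c_def)
qed

lemma normal: "continuous_map (subtopology ultraweak_topology B) (subtopology ultraweak_topology B) \<theta>"
  using endo in_B
  by (auto simp: normal_unital_star_endomorphism_def normal_map_def continuous_map_in_subtopology)

end

lemma star_endomorphism_funpow:
  assumes "star_endomorphism B \<theta>"
  shows "star_endomorphism B (\<theta> ^^ n)"
proof -
  interpret star_endomorphism B \<theta> by fact
  have B: "(\<theta> ^^ n) x \<in> B" if "x \<in> B" for x n
    using that by (induction n) (auto simp: in_B)
  have "(\<theta> ^^ n) (x + y) = (\<theta> ^^ n) x + (\<theta> ^^ n) y"
    "(\<theta> ^^ n) (c *\<^sub>C x) = c *\<^sub>C (\<theta> ^^ n) x"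
    "(\<theta> ^^ n) (x o\<^sub>L y) = (\<theta> ^^ n) x o\<^sub>L (\<theta> ^^ n) y"
    "(\<theta> ^^ n) (adj x) = adj ((\<theta> ^^ n) x)"
    if "x \<in> B" "y \<in> B" for x y c
    using that by (induction n) (auto simp: B add scaleC mult adj)
  moreover have "(\<theta> ^^ n) id_blinfun = id_blinfun"
    by (induction n) (auto simp: one)
  moreover have "continuous_map (subtopology ultraweak_topology B) (subtopology ultraweak_topology B) (\<theta> ^^ n)"
  proof (induction n)
    case 0
    then show ?case
      by (simp add: id_def)
  next
    case (Suc n)
    then show ?case
      using continuous_map_compose[OF Suc normal] by (simp add: o_def)
  qed
  ultimately have "normal_unital_star_endomorphism B (\<theta> ^^ n)"
    by (auto simp: normal_unital_star_endomorphism_def unital_linear_on_def normal_map_def B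
        continuous_map_in_subtopology)
  with vN show ?thesis
    by (simp add: star_endomorphism_def)
qed

section \<open>Eigenspaces of powers\<close>

lemma closure_cspan_subspace:
  "complex_vector.subspace (closure (cspan S))"
proof -
  let ?V = "closure (cspan S)"
  have add: "x + y \<in> ?V" if "x \<in> ?V" "y \<in> ?V" for x y
  proof -
    from that obtain f g where f: "\<And>n. f n \<in> cspan S" "f \<longlonglongrightarrow> x"
      and g: "\<And>n. g n \<in> cspan S" "g \<longlonglongrightarrow> y"
      by (auto simp: closure_sequential)
    then show ?thesis
      unfolding closure_sequential
      by (intro exI[of _ "\<lambda>n. f n + g n"] conjI allI tendsto_add complex_vector.span_add) auto
  qed
  have scale: "c *\<^sub>C x \<in> ?V" if "x \<in> ?V" for x c
  proof -
    from that obtain f where f: "\<And>n. f n \<in> cspan S" "f \<longlonglongrightarrow> x"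
      by (auto simp: closure_sequential)
    then show ?thesis
      unfolding closure_sequential
      by (intro exI[of _ "\<lambda>n. c *\<^sub>C f n"] conjI allI tendsto_scaleC tendsto_const
          complex_vector.span_scale) auto
  qed
  show ?thesis
    using add scale complex_vector.span_zero[of S] closure_subset[of "cspan S"]
    by (auto simp: complex_vector.subspace_def)
qed

lemma peripheral_space_subset:
  assumes "\<And>\<mu>. \<mu> \<in> G \<Longrightarrow> eigenspace A \<tau> \<mu> \<subseteq> V"
    and "complex_vector.subspace V" "closed V"
  shows "peripheral_space G A \<tau> \<subseteq> V"
  unfolding peripheral_space_def
  using assms by (intro closure_minimal complex_vector.span_minimal) auto

lemma eigenspace_subset_peripheral:
  "\<mu> \<in> G \<Longrightarrow> eigenspace A \<tau> \<mu> \<subseteq> peripheral_space G A \<tau>"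
  unfolding peripheral_space_def
  using closure_subset complex_vector.span_superset by fastforce

lemma unital_linear_on_funpow:
  assumes "unital_linear_on A \<tau>"
  shows "unital_linear_on A (\<tau> ^^ n)"
proof -
  have A: "(\<tau> ^^ n) x \<in> A" if "x \<in> A" for x n
    using that assms by (induction n) (auto simp: unital_linear_on_def)
  have "(\<tau> ^^ n) (x + y) = (\<tau> ^^ n) x + (\<tau> ^^ n) y"
    "(\<tau> ^^ n) (c *\<^sub>C x) = c *\<^sub>C (\<tau> ^^ n) x"
    if "x \<in> A" "y \<in> A" for x y c
    using that assms by (induction n) (auto simp: A unital_linear_on_def)
  moreover have "(\<tau> ^^ n) id_blinfun = id_blinfun"
    using assms by (induction n) (auto simp: unital_linear_on_def)
  ultimately show ?thesis
    by (auto simp: unital_linear_on_def A)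
qed

lemma funpow_eigenvector:
  assumes lin: "unital_linear_on A \<tau>" and x: "x \<in> eigenspace A \<tau> \<mu>"
  shows "(\<tau> ^^ n) x = \<mu> ^ n *\<^sub>C x"
proof (induction n)
  case (Suc n)
  then show ?case
    using assms by (simp add: unital_linear_on_def eigenspace_def scaleC_scaleC mult.commute)
qed simp

definition root_of_unity :: "nat \<Rightarrow> complex"
  where "root_of_unity k = exp (2 * of_real pi * \<i> / of_nat k)"

lemma root_of_unity_power:
  assumes "k \<ge> 1"
  shows "root_of_unity k ^ m = 1 \<longleftrightarrow> k dvd m"
proof -
  have "root_of_unity k ^ m = exp (2 * of_real pi * \<i> * of_nat m / of_nat k)"
    by (simp add: root_of_unity_def exp_of_nat_mult[symmetric] field_simps)
  then show ?thesis
    using complex_root_unity_eq_1[OF assms, of m] by simp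
qed

lemma cyclic_subgroup_eq:
  assumes "k \<ge> 1"
  shows "cyclic_subgroup k = {z. z ^ k = 1}"
proof -
  have "{z::complex. z ^ k = 1} = {exp (2 * of_real pi * \<i> * of_nat j / of_nat k) |j. j < k}"
    using complex_roots_unity[OF assms] by simp
  also have "\<dots> = {root_of_unity k ^ j |j. j < k}"
    by (simp add: root_of_unity_def exp_of_nat_mult[symmetric] field_simps)
  also have "\<dots> = cyclic_subgroup k"
    using assms by (auto simp: cyclic_subgroup_def root_of_unity_def image_iff)
  finally show ?thesis ..
qed

text \<open>
  The finite Fourier transform splits \<open>x\<close>: for each \<open>k\<close>-th root \<open>\<nu>\<close> of \<open>l\<^sup>k\<close>, the average of
  \<open>\<nu>\<^bsup>-m\<^esup> \<tau>\<^sup>m(x)\<close> over \<open>m < k\<close> is an eigenvector of \<open>\<tau>\<close> for \<open>\<nu>\<close>, and these averages add up to \<open>x\<close>.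
\<close>

lemma eigenspace_funpow_subset_span:
  assumes A: "complex_vector.subspace A" and lin: "unital_linear_on A \<tau>"
    and k: "k \<ge> 1" and l: "l \<noteq> 0" and x: "x \<in> eigenspace A (\<tau> ^^ k) (l ^ k)"
  shows "x \<in> cspan (\<Union>\<nu>\<in>{z. z ^ k = l ^ k}. eigenspace A \<tau> \<nu>)"
proof -
  define \<omega> where "\<omega> = root_of_unity k"
  have \<omega>: "\<omega> ^ m = 1 \<longleftrightarrow> k dvd m" for m
    by (simp add: \<omega>_def root_of_unity_power[OF k])
  have \<omega>0: "\<omega> \<noteq> 0"
    by (simp add: \<omega>_def root_of_unity_def)
  have xA: "x \<in> A" and tx: "(\<tau> ^^ k) x = l ^ k *\<^sub>C x"
    using x by (auto simp: eigenspace_def)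
  have pA: "(\<tau> ^^ m) x \<in> A" for m
    using unital_linear_on_funpow[OF lin, of m] xA by (auto simp: unital_linear_on_def)
  have tau_scale: "\<tau> (c *\<^sub>C y) = c *\<^sub>C \<tau> y" if "y \<in> A" for c y
    using lin that by (simp add: unital_linear_on_def)
  have tau_sum: "\<tau> (\<Sum>i\<in>I. f i) = (\<Sum>i\<in>I. \<tau> (f i))" if "finite I" "\<And>i. f i \<in> A" for f and I :: "nat set"
    using that(1)
  proof (induction I)
    case empty
    have "\<tau> 0 = 0"
      using tau_scale[of 0 0] complex_vector.subspace_0[OF A] by simp
    then show ?case
      by simp
  next
    case (insert i I)
    have "sum f I \<in> A"
      using that(2) by (intro complex_vector.subspace_sum[OF A])
    with insert show ?case
      using lin that(2)[of i] by (simp add: unital_linear_on_def)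
  qed
  define y where "y j = (\<Sum>m<k. inverse (l * \<omega> ^ j) ^ m *\<^sub>C (\<tau> ^^ m) x)" for j
  have y_eigen: "y j \<in> eigenspace A \<tau> (l * \<omega> ^ j)" for j
  proof -
    define \<nu> where "\<nu> = l * \<omega> ^ j"
    have \<nu>0: "\<nu> \<noteq> 0"
      using l \<omega>0 by (simp add: \<nu>_def)
    have \<nu>k: "\<nu> ^ k = l ^ k"
      using \<omega>[of "j * k"] by (simp add: \<nu>_def power_mult_distrib flip: power_mult)
    define g where "g m = inverse \<nu> ^ m *\<^sub>C (\<tau> ^^ m) x" for m
    have gA: "g m \<in> A" for m
      by (simp add: g_def pA complex_vector.subspace_scale[OF A])
    have gk: "g k = g 0"
      using \<nu>k \<nu>0 l by (simp add: g_def tx scaleC_scaleC power_inverse)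
    have "\<tau> (g m) = \<nu> *\<^sub>C g (Suc m)" for m
      using \<nu>0 by (simp add: g_def tau_scale pA scaleC_scaleC)
    then have "\<tau> (y j) = \<nu> *\<^sub>C (\<Sum>m<k. g (Suc m))"
      using gA tau_sum[of "{..<k}" g]
      by (simp add: y_def g_def \<nu>_def complex_vector.scale_sum_right)
    also have "(\<Sum>m<k. g (Suc m)) = (\<Sum>m<k. g m)"
      using sum.lessThan_Suc_shift[of g k] sum.lessThan_Suc[of g k] gk by simp
    finally show ?thesis
      using gA by (auto simp: eigenspace_def y_def g_def \<nu>_def intro!: complex_vector.subspace_sum[OF A])
  qed
  have char_sum: "(\<Sum>j<k. inverse (\<omega> ^ j) ^ m) = (if m = 0 then of_nat k else 0)" if "m < k" for m
  proof (cases "m = 0")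
    case False
    define z where "z = inverse (\<omega> ^ m)"
    have "z \<noteq> 1"
      using \<omega>[of m] False that by (auto simp: z_def inverse_eq_1_iff dest: dvd_imp_le)
    moreover have "z ^ k = 1"
      using \<omega>[of "m * k"] by (simp add: z_def power_inverse flip: power_mult)
    moreover have "inverse (\<omega> ^ j) ^ m = z ^ j" for j
      by (simp add: z_def power_inverse mult.commute flip: power_mult)
    ultimately show ?thesis
      using False by (simp add: geometric_sum)
  qed simp
  have "(\<Sum>j<k. y j) = (\<Sum>m<k. \<Sum>j<k. inverse (l * \<omega> ^ j) ^ m *\<^sub>C (\<tau> ^^ m) x)"
    unfolding y_def by (rule sum.swap)
  also have "\<dots> = (\<Sum>m<k. (inverse l ^ m * (\<Sum>j<k. inverse (\<omega> ^ j) ^ m)) *\<^sub>C (\<tau> ^^ m) x)"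
    by (simp add: complex_vector.scale_sum_left[symmetric] sum_distrib_left power_mult_distrib)
  also have "\<dots> = (\<Sum>m<k. if m = 0 then of_nat k *\<^sub>C x else 0)"
    by (intro sum.cong) (auto simp: char_sum)
  also have "\<dots> = of_nat k *\<^sub>C x"
    using k by simp
  finally have "x = inverse (of_nat k) *\<^sub>C (\<Sum>j<k. y j)"
    using k by (simp add: scaleC_scaleC)
  moreover have "y j \<in> cspan (\<Union>\<nu>\<in>{z. z ^ k = l ^ k}. eigenspace A \<tau> \<nu>)" for j
  proof (rule complex_vector.span_base)
    have "(l * \<omega> ^ j) ^ k = l ^ k"
      using \<omega>[of "j * k"] by (simp add: power_mult_distrib flip: power_mult)
    then show "y j \<in> (\<Union>\<nu>\<in>{z. z ^ k = l ^ k}. eigenspace A \<tau> \<nu>)"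
      using y_eigen by blast
  qed
  ultimately show ?thesis
    by (metis complex_vector.span_scale complex_vector.span_sum)
qed

lemma peripheral_space_funpow:
  assumes A: "complex_vector.subspace A" and lin: "unital_linear_on A \<tau>"
    and k: "k \<ge> 1" and G: "0 \<notin> G"
  shows "peripheral_space G A (\<tau> ^^ k) = peripheral_space {z. z ^ k \<in> G} A \<tau>"
proof -
  let ?S = "\<Union>\<mu>\<in>G. eigenspace A (\<tau> ^^ k) \<mu>"
  let ?T = "\<Union>\<nu>\<in>{z. z ^ k \<in> G}. eigenspace A \<tau> \<nu>"
  have "?S \<subseteq> cspan ?T"
  proof
    fix x assume "x \<in> ?S"
    then obtain \<mu> where \<mu>: "\<mu> \<in> G" "x \<in> eigenspace A (\<tau> ^^ k) \<mu>"
      by blast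
    then obtain l where l: "l \<noteq> 0" "\<mu> = l ^ k"
      using exists_complex_root_nonzero[of \<mu> k] G k by (metis not_one_le_zero)
    have "x \<in> cspan (\<Union>\<nu>\<in>{z. z ^ k = l ^ k}. eigenspace A \<tau> \<nu>)"
      using eigenspace_funpow_subset_span[OF A lin k l(1)] \<mu> l by simp
    also have "\<dots> \<subseteq> cspan ?T"
      using \<mu>(1) l(2) by (intro complex_vector.span_mono UN_mono) auto
    finally show "x \<in> cspan ?T" .
  qed
  moreover have "?T \<subseteq> ?S"
  proof
    fix x assume "x \<in> ?T"
    then obtain \<nu> where \<nu>: "\<nu> ^ k \<in> G" "x \<in> eigenspace A \<tau> \<nu>"
      by blast
    then have "x \<in> eigenspace A (\<tau> ^^ k) (\<nu> ^ k)"
      using funpow_eigenvector[OF lin \<nu>(2), of k] by (simp add: eigenspace_def)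
    then show "x \<in> ?S"
      using \<nu> by blast
  qed
  ultimately have "cspan ?S = cspan ?T"
    by (metis complex_vector.span_eq complex_vector.span_superset order_trans)
  then show ?thesis
    by (simp add: peripheral_space_def)
qed


section \<open>Return times\<close>

text \<open>
  The return times common to all rotations of the circle. Being a filter, it treats uncountably many
  eigenvalues at once, so that limits along it can be compared for different elements and different
  dilations without passing to common subsequences.
\<close>

definition return_times :: "nat filter"
  where "return_times =
    (INF \<nu>\<in>unit_circle. inf sequentially (filtercomap (\<lambda>n. \<nu> ^ n) (nhds (1::complex))))"

lemma filterlim_return_times_iff:
  "filterlim s return_times F \<longleftrightarrow>
    filterlim s sequentially F \<and> (\<forall>\<nu>\<in>unit_circle. ((\<lambda>n. \<nu> ^ s n) \<longlongrightarrow> 1) F)"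
proof -
  have "1 \<in> unit_circle"
    by simp
  then show ?thesis
    unfolding return_times_def filterlim_INF filterlim_inf filterlim_filtercomap_iff o_def
    by blast
qed

lemma return_times_sequentially: "return_times \<le> sequentially"
  and tendsto_power_return_times: "cmod \<nu> = 1 \<Longrightarrow> ((\<lambda>n. \<nu> ^ n) \<longlongrightarrow> 1) return_times"
  using filterlim_return_times_iff[of "\<lambda>n. n" return_times] by (auto simp: filterlim_def)

text \<open>
  Compactness of the circle, applied to one number after the other.
\<close>

lemma simultaneously_convergent_powers:
  assumes "finite X" "X \<subseteq> unit_circle"
  shows "\<exists>r::nat \<Rightarrow> nat. strict_mono r \<and> (\<forall>\<nu>\<in>X. convergent (\<lambda>n. \<nu> ^ r n))"
  using assms
proof (induction X)
  case empty
  show ?case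
    by (intro exI[of _ id]) (simp add: strict_mono_def)
next
  case (insert \<nu> X)
  then obtain r :: "nat \<Rightarrow> nat" where r: "strict_mono r" "\<And>\<mu>. \<mu> \<in> X \<Longrightarrow> convergent (\<lambda>n. \<mu> ^ r n)"
    by auto
  have "bounded (range (\<lambda>n. \<nu> ^ r n))"
    using insert.prems by (auto simp: bounded_iff norm_power)
  from bounded_imp_convergent_subsequence[OF this] obtain l s
    where s: "strict_mono s" "((\<lambda>n. \<nu> ^ r n) \<circ> s) \<longlonglongrightarrow> l"
    by blast
  have "convergent (\<lambda>n. \<mu> ^ r (s n))" if "\<mu> \<in> insert \<nu> X" for \<mu>
  proof (cases "\<mu> = \<nu>")
    case True
    then show ?thesis
      using s by (auto simp: convergent_def o_def)
  next
    case False
    then have "convergent (\<lambda>n. \<mu> ^ r n)"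
      using that by (intro r) simp
    then obtain l' where "(\<lambda>n. \<mu> ^ r n) \<longlonglongrightarrow> l'"
      by (auto simp: convergent_def)
    from LIMSEQ_subseq_LIMSEQ[OF this s(1)] show ?thesis
      by (auto simp: convergent_def o_def)
  qed
  then show ?case
    using strict_mono_o[OF r(1) s(1)] by (intro exI[of _ "r \<circ> s"]) (simp add: o_def)
qed

text \<open>
  For finitely many numbers on the circle take a subsequence \<open>r\<close> along which all their powers converge.
  The differences \<open>r m - r n\<close> with \<open>m\<close> much larger than \<open>n\<close> are then return times, because a quotient of
  two nearly equal powers is close to \<open>1\<close>.
\<close>

lemma return_times_neq_bot: "return_times \<noteq> bot"
  unfolding return_times_def
proof (rule INF_filter_not_bot)
  fix X :: "complex set"
  assume X: "X \<subseteq> unit_circle" "finite X"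
  obtain r :: "nat \<Rightarrow> nat" where r: "strict_mono r" "\<And>\<nu>. \<nu> \<in> X \<Longrightarrow> convergent (\<lambda>n. \<nu> ^ r n)"
    using simultaneously_convergent_powers[OF X(2,1)] by blast
  define s where "s n = r (r n + n) - r n" for n
  have r_le: "m \<le> r m" for m
    using r(1) by (rule strict_mono_imp_increasing)
  have s_ge: "n \<le> s n" for n
    using r_le[of "r n + n"] by (simp add: s_def)
  have "filterlim s (INF \<nu>\<in>X. inf sequentially (filtercomap (\<lambda>n. \<nu> ^ n) (nhds 1))) sequentially"
    unfolding filterlim_INF filterlim_inf filterlim_filtercomap_iff o_def
  proof (intro ballI conjI)
    show "filterlim s sequentially sequentially"
      by (rule filterlim_at_top_mono[OF filterlim_ident]) (simp add: s_ge)
    fix \<nu> assume \<nu>: "\<nu> \<in> X"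
    then have c1: "cmod \<nu> = 1"
      using X by auto
    obtain l where l: "(\<lambda>n. \<nu> ^ r n) \<longlonglongrightarrow> l"
      using r(2)[OF \<nu>] by (auto simp: convergent_def)
    have "(\<lambda>n. cmod (\<nu> ^ r n)) \<longlonglongrightarrow> cmod l"
      by (intro tendsto_norm l)
    then have "cmod l = 1"
      by (simp add: norm_power c1 LIMSEQ_const_iff)
    then have l0: "l \<noteq> 0"
      by auto
    have "filterlim (\<lambda>n. r n + n) sequentially sequentially"
      by (rule filterlim_at_top_mono[OF filterlim_ident]) simp
    from filterlim_compose[OF l this] have "(\<lambda>n. \<nu> ^ r (r n + n) / \<nu> ^ r n) \<longlonglongrightarrow> l / l"
      by (intro tendsto_divide l l0)
    moreover have "\<nu> ^ s n = \<nu> ^ r (r n + n) / \<nu> ^ r n" for n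
    proof -
      have "r n \<le> r (r n + n)"
        using r(1) r_le[of n] by (simp add: strict_mono_less_eq)
      then show ?thesis
        using c1 by (subst s_def, subst power_diff) auto
    qed
    ultimately show "(\<lambda>n. \<nu> ^ s n) \<longlonglongrightarrow> 1"
      using l0 by simp
  qed
  then show "(INF \<nu>\<in>X. inf sequentially (filtercomap (\<lambda>n. \<nu> ^ n) (nhds 1))) \<noteq> bot"
    by (metis bot.extremum_uniqueI filterlim_def filtermap_bot_iff sequentially_bot)
qed

text \<open>
  If \<open>c\<^sup>n\<close> is close to \<open>1\<close>, so is \<open>c\<^bsup>kn\<^esup>\<close>; this is what relates the boundaries of \<open>\<tau>\<close> and \<open>\<tau>\<^sup>k\<close>.
\<close>

lemma filterlim_mult_return_times:
  assumes "k \<ge> 1"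
  shows "filterlim (\<lambda>n. k * n) return_times return_times"
  unfolding filterlim_return_times_iff
proof (intro conjI ballI)
  have "filterlim (\<lambda>n::nat. k * n) sequentially sequentially"
    by (rule filterlim_at_top_mono[OF filterlim_ident]) (use assms in simp)
  then show "filterlim (\<lambda>n. k * n) sequentially return_times"
    using return_times_sequentially by (rule filterlim_mono[OF _ order_refl])
  fix \<nu> :: complex assume "\<nu> \<in> unit_circle"
  then have "((\<lambda>n. (\<nu> ^ n) ^ k) \<longlongrightarrow> 1 ^ k) return_times"
    by (intro tendsto_power tendsto_power_return_times) simp
  then show "((\<lambda>n. \<nu> ^ (k * n)) \<longlongrightarrow> 1) return_times"
    by (simp add: mult.commute[of k] power_mult)
qed

context star_endomorphism
begin

lemma peripheral_subset: "peripheral_space G B \<theta> \<subseteq> B"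
  by (intro peripheral_space_subset vN_subspace vN_closed vN) (auto simp: eigenspace_def)

lemma funpow_in_B: "x \<in> B \<Longrightarrow> (\<theta> ^^ n) x \<in> B"
  and funpow_add: "x \<in> B \<Longrightarrow> y \<in> B \<Longrightarrow> (\<theta> ^^ n) (x + y) = (\<theta> ^^ n) x + (\<theta> ^^ n) y"
  and funpow_diff: "x \<in> B \<Longrightarrow> y \<in> B \<Longrightarrow> (\<theta> ^^ n) (x - y) = (\<theta> ^^ n) x - (\<theta> ^^ n) y"
  and funpow_scaleC: "x \<in> B \<Longrightarrow> (\<theta> ^^ n) (c *\<^sub>C x) = c *\<^sub>C (\<theta> ^^ n) x"
  and funpow_mult: "x \<in> B \<Longrightarrow> y \<in> B \<Longrightarrow> (\<theta> ^^ n) (x o\<^sub>L y) = (\<theta> ^^ n) x o\<^sub>L (\<theta> ^^ n) y"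
  and funpow_adj: "x \<in> B \<Longrightarrow> (\<theta> ^^ n) (adj x) = adj ((\<theta> ^^ n) x)"
  and funpow_contractive: "x \<in> B \<Longrightarrow> norm ((\<theta> ^^ n) x) \<le> norm x"
proof -
  interpret n: star_endomorphism B "\<theta> ^^ n"
    by (rule star_endomorphism_funpow) (rule star_endomorphism_axioms)
  show "x \<in> B \<Longrightarrow> (\<theta> ^^ n) x \<in> B"
    "x \<in> B \<Longrightarrow> y \<in> B \<Longrightarrow> (\<theta> ^^ n) (x + y) = (\<theta> ^^ n) x + (\<theta> ^^ n) y"
    "x \<in> B \<Longrightarrow> y \<in> B \<Longrightarrow> (\<theta> ^^ n) (x - y) = (\<theta> ^^ n) x - (\<theta> ^^ n) y"
    "x \<in> B \<Longrightarrow> (\<theta> ^^ n) (c *\<^sub>C x) = c *\<^sub>C (\<theta> ^^ n) x"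
    "x \<in> B \<Longrightarrow> y \<in> B \<Longrightarrow> (\<theta> ^^ n) (x o\<^sub>L y) = (\<theta> ^^ n) x o\<^sub>L (\<theta> ^^ n) y"
    "x \<in> B \<Longrightarrow> (\<theta> ^^ n) (adj x) = adj ((\<theta> ^^ n) x)"
    "x \<in> B \<Longrightarrow> norm ((\<theta> ^^ n) x) \<le> norm x"
    by (simp_all add: n.in_B n.add n.diff n.scaleC n.mult n.adj n.contractive)
qed

text \<open>
  On eigenvectors \<open>\<theta>\<^sup>n\<close> acts by \<open>\<mu>\<^sup>n \<rightarrow> 1\<close>; linear combinations follow, and so do their norm limits,
  because the \<open>\<theta>\<^sup>n\<close> are uniformly bounded.
\<close>

lemma peripheral_recurrent:
  assumes "z \<in> peripheral_space unit_circle B \<theta>"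
  shows "((\<lambda>n. (\<theta> ^^ n) z) \<longlongrightarrow> z) return_times"
proof -
  let ?V = "{z \<in> B. ((\<lambda>n. (\<theta> ^^ n) z) \<longlongrightarrow> z) return_times}"
  have "peripheral_space unit_circle B \<theta> \<subseteq> ?V"
  proof (rule peripheral_space_subset)
    fix \<mu> assume \<mu>: "\<mu> \<in> unit_circle"
    have "((\<lambda>n. (\<theta> ^^ n) x) \<longlongrightarrow> x) return_times" if "x \<in> eigenspace B \<theta> \<mu>" for x
      using tendsto_scaleC[OF tendsto_power_return_times tendsto_const, of \<mu> x] \<mu>
      by (simp add: funpow_eigenvector[OF unital_linear that])
    then show "eigenspace B \<theta> \<mu> \<subseteq> ?V"
      by (auto simp: eigenspace_def)
  next
    show "complex_vector.subspace ?V"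
      unfolding complex_vector.subspace_def
    proof (intro conjI allI impI ballI)
      show "0 \<in> ?V"
        using vN_zero[OF vN] funpow_scaleC[OF vN_zero[OF vN], of _ 0] by simp
      show "x + y \<in> ?V" if "x \<in> ?V" "y \<in> ?V" for x y
        using that by (auto simp: funpow_add vN_add[OF vN] intro: tendsto_add)
      show "c *\<^sub>C x \<in> ?V" if "x \<in> ?V" for x c
        using that by (auto simp: funpow_scaleC vN_scaleC[OF vN] intro!: tendsto_intros)
    qed
    show "closed ?V"
      unfolding closed_sequential_limits
    proof (intro allI impI, elim conjE)
      fix X z
      assume X: "\<forall>i. X i \<in> ?V" and lim: "X \<longlonglongrightarrow> z"
      have XB: "X i \<in> B" for i
        using X by simp
      have zB: "z \<in> B"
        using closed_sequentially[OF vN_closed[OF vN] XB lim] .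
      have "((\<lambda>n. (\<theta> ^^ n) z) \<longlongrightarrow> z) return_times"
      proof (rule tendstoI)
        fix e :: real assume e: "e > 0"
        then obtain i where i: "dist (X i) z < e / 3"
          using metric_LIMSEQ_D[OF lim, of "e / 3"] by auto
        have "((\<lambda>n. (\<theta> ^^ n) (X i)) \<longlongrightarrow> X i) return_times"
          using X by simp
        then have "\<forall>\<^sub>F n in return_times. dist ((\<theta> ^^ n) (X i)) (X i) < e / 3"
          using e by (intro tendstoD) auto
        then show "\<forall>\<^sub>F n in return_times. dist ((\<theta> ^^ n) z) z < e"
        proof eventually_elim
          case (elim n)
          have "dist ((\<theta> ^^ n) z) ((\<theta> ^^ n) (X i)) \<le> dist z (X i)"
            using funpow_contractive[of "z - X i" n] zB XB
            by (simp add: dist_norm funpow_diff vN_diff[OF vN])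
          then have "dist ((\<theta> ^^ n) z) ((\<theta> ^^ n) (X i)) < e / 3"
            using i by (simp add: dist_commute)
          moreover have "dist ((\<theta> ^^ n) z) z \<le>
              dist ((\<theta> ^^ n) z) ((\<theta> ^^ n) (X i)) + dist ((\<theta> ^^ n) (X i)) (X i) + dist (X i) z"
            by (meson dist_triangle dist_triangle_le add_mono order_refl order_trans)
          ultimately show ?case
            using elim i by linarith
        qed
      qed
      with zB show "z \<in> ?V"
        by simp
    qed
  qed
  with assms show ?thesis
    by blast
qed

end

section \<open>Minimal dilations\<close>

text \<open>
  The common norm bound spreads the Cauchy property from the dense set to every vector and bounds the
  pointwise limit.
\<close>

lemma strong_limit_exists:
  fixes X :: "nat \<Rightarrow> 'a::real_normed_vector \<Rightarrow>\<^sub>L 'b::banach"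
  assumes bound: "\<And>n. norm (X n) \<le> C" and D: "closure D = UNIV"
    and conv: "\<And>u. u \<in> D \<Longrightarrow> convergent (\<lambda>n. blinfun_apply (X n) u)"
  shows "\<exists>Z. \<forall>u. (\<lambda>n. blinfun_apply (X n) u) \<longlonglongrightarrow> blinfun_apply Z u"
proof -
  have C: "C \<ge> 0"
    using norm_ge_zero bound by (rule order_trans)
  have Xle: "norm (blinfun_apply (X n) w) \<le> C * norm w" for n w
    using norm_blinfun bound by (meson mult_right_mono norm_ge_zero order_trans)
  have "Cauchy (\<lambda>n. blinfun_apply (X n) u)" for u
  proof (rule metric_CauchyI)
    fix e :: real assume e: "e > 0"
    define d where "d = e / (3 * (C + 1))"
    have d: "d > 0"
      using e C by (simp add: d_def)
    have "u \<in> closure D"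
      using D by simp
    then obtain w where w: "w \<in> D" "dist w u < d"
      using d by (auto simp: closure_approachable)
    have close: "dist (blinfun_apply (X n) u) (blinfun_apply (X n) w) < e / 3" for n
    proof -
      have "dist (blinfun_apply (X n) u) (blinfun_apply (X n) w) \<le> C * dist w u"
        using Xle[of n "u - w"] by (simp add: dist_norm blinfun.diff_right norm_minus_commute)
      also have "\<dots> \<le> C * d"
        using w C by (intro mult_left_mono) auto
      also have "\<dots> < e / 3"
        using e C by (simp add: d_def field_simps)
      finally show ?thesis .
    qed
    have "Cauchy (\<lambda>n. blinfun_apply (X n) w)"
      using conv[OF w(1)] by (rule convergent_Cauchy)
    from metric_CauchyD[OF this, of "e / 3"] e obtain N where
      N: "\<forall>m\<ge>N. \<forall>n\<ge>N. dist (blinfun_apply (X m) w) (blinfun_apply (X n) w) < e / 3"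
      by auto
    have "dist (blinfun_apply (X m) u) (blinfun_apply (X n) u) < e" if "m \<ge> N" "n \<ge> N" for m n
    proof -
      have "dist (blinfun_apply (X m) u) (blinfun_apply (X n) u) \<le>
          dist (blinfun_apply (X m) u) (blinfun_apply (X m) w)
          + dist (blinfun_apply (X m) w) (blinfun_apply (X n) w)
          + dist (blinfun_apply (X n) w) (blinfun_apply (X n) u)"
        by (meson dist_triangle dist_triangle_le add_mono order_refl order_trans)
      then show ?thesis
        using close[of m] close[of n] N[rule_format, OF that]
        by (simp add: dist_commute)
    qed
    then show "\<exists>N. \<forall>m\<ge>N. \<forall>n\<ge>N. dist (blinfun_apply (X m) u) (blinfun_apply (X n) u) < e"
      by blast
  qed
  then have "\<exists>z. (\<lambda>n. blinfun_apply (X n) u) \<longlonglongrightarrow> z" for u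
    using Cauchy_convergent convergent_def by blast
  then obtain z where z: "\<And>u. (\<lambda>n. blinfun_apply (X n) u) \<longlonglongrightarrow> z u"
    by metis
  have "bounded_linear z"
  proof (rule bounded_linear_intro[where K = C])
    show "z (u + w) = z u + z w" for u w
      using LIMSEQ_unique[OF z[of "u + w"]] tendsto_add[OF z[of u] z[of w]]
      by (simp add: blinfun.add_right)
    show "z (r *\<^sub>R u) = r *\<^sub>R z u" for r u
      using LIMSEQ_unique[OF z[of "r *\<^sub>R u"]] tendsto_scaleR[OF tendsto_const z[of u]]
      by (simp add: blinfun.scaleR_right)
    show "norm (z u) \<le> norm u * C" for u
      using tendsto_norm[OF z[of u]] Xle
      by (intro tendsto_upperbound[of "\<lambda>n. norm (blinfun_apply (X n) u)" _ sequentially])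
         (auto intro!: always_eventually simp: mult.commute)
  qed
  then show ?thesis
    using z by (intro exI[of _ "Blinfun z"]) (simp add: bounded_linear_Blinfun_apply)
qed

locale dilation = star_endomorphism B \<theta>
  for A :: "('h::hilbert_space \<Rightarrow>\<^sub>L 'h) set" and \<tau> :: "('h \<Rightarrow>\<^sub>L 'h) \<Rightarrow> ('h \<Rightarrow>\<^sub>L 'h)"
    and \<iota> :: "'h \<Rightarrow>\<^sub>L 'k::hilbert_space"
    and B :: "('k \<Rightarrow>\<^sub>L 'k) set" and \<theta> :: "('k \<Rightarrow>\<^sub>L 'k) \<Rightarrow> ('k \<Rightarrow>\<^sub>L 'k)" +
  assumes vN_A: "von_neumann_algebra A" and lin_\<tau>: "unital_linear_on A \<tau>"
    and minimal: "minimal_dilation A \<tau> \<iota> B \<theta>"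

lemma dilationI:
  assumes "von_neumann_algebra A" "unital_linear_on A \<tau>" "minimal_dilation A \<tau> \<iota> B \<theta>"
  shows "dilation A \<tau> \<iota> B \<theta>"
  using assms unfolding dilation_def star_endomorphism_def dilation_axioms_def minimal_dilation_def
  by (elim conjE) (intro conjI; assumption)

context dilation
begin

lemma iso: "isometric_embedding \<iota>"
  and A_eq: "A = compress_op \<iota> ` B"
  and dilates: "x \<in> A \<Longrightarrow> (\<tau> ^^ n) x = compress_op \<iota> ((\<theta> ^^ n) (extend_op \<iota> x))"
  and dense: "closure (cspan {dilation_vector \<iota> \<theta> x h n | x h n. range x \<subseteq> A}) = UNIV"
  and B_eq: "B = generated_von_neumann_algebra {(\<theta> ^^ n) (extend_op \<iota> x) | n x. x \<in> A}"
  using minimal unfolding minimal_dilation_def by blast+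

lemma clinear_iota: "clinear_op \<iota>"
  using iso by (simp add: isometric_embedding_def)

lemma clinear_adj_iota: "clinear_op (adj \<iota>)"
  by (rule clinear_op_adj[OF clinear_iota])

lemma adj_iota [simp]: "blinfun_apply (adj \<iota>) (blinfun_apply \<iota> h) = h"
  using arg_cong[OF isometry_adj_compose[OF iso], of "\<lambda>x. blinfun_apply x h"] by simp

lemma extend_in_B: "x \<in> A \<Longrightarrow> extend_op \<iota> x \<in> B"
  unfolding B_eq generated_von_neumann_algebra_def
  by (fastforce intro: exI[of _ 0])

lemma compress_in_A: "z \<in> B \<Longrightarrow> compress_op \<iota> z \<in> A"
  by (simp add: A_eq)

lemma compress_extend [simp]: "compress_op \<iota> (extend_op \<iota> x) = x"
  by (rule blinfun_eqI) (simp add: compress_op_def extend_op_def)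

lemma extend_compose: "extend_op \<iota> x o\<^sub>L extend_op \<iota> y = extend_op \<iota> (x o\<^sub>L y)"
  by (rule blinfun_eqI) (simp add: extend_op_def)

lemma extend_scaleC: "extend_op \<iota> (c *\<^sub>C x) = c *\<^sub>C extend_op \<iota> x"
  by (rule blinfun_eqI) (simp add: extend_op_def scaleC_blinfun.rep_eq clinear_opD[OF clinear_iota])

lemma bounded_linear_compress: "bounded_linear (compress_op \<iota>)"
  unfolding compress_op_def[abs_def]
  by (intro bounded_linear_compose[OF bounded_bilinear.bounded_linear_left[OF bounded_bilinear_blinfun_compose]]
      bounded_linear_compose[OF bounded_bilinear.bounded_linear_right[OF bounded_bilinear_blinfun_compose]]
      bounded_linear_ident)

lemma compress_add: "compress_op \<iota> (x + y) = compress_op \<iota> x + compress_op \<iota> y"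
  and compress_diff: "compress_op \<iota> (x - y) = compress_op \<iota> x - compress_op \<iota> y"
  by (simp_all add: compress_op_def blinfun_compose_simps)

lemma compress_scaleC: "compress_op \<iota> (c *\<^sub>C x) = c *\<^sub>C compress_op \<iota> x"
  by (rule blinfun_eqI)
     (simp add: compress_op_def scaleC_blinfun.rep_eq clinear_opD[OF clinear_adj_iota])

lemma compress_adj: "clinear_op z \<Longrightarrow> compress_op \<iota> (adj z) = adj (compress_op \<iota> z)"
  by (rule sym, rule adj_unique)
     (simp add: compress_op_def cinner_adj_left clinear_iota cinner_adj_right)

lemma norm_compress_le: "norm (compress_op \<iota> z) \<le> norm z"
proof -
  have "norm (compress_op \<iota> z) \<le> norm (adj \<iota> o\<^sub>L z) * norm \<iota>"
    unfolding compress_op_def by (rule norm_blinfun_compose)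
  also have "\<dots> \<le> norm (adj \<iota>) * norm z * norm \<iota>"
    by (intro mult_right_mono norm_blinfun_compose) simp
  also have "\<dots> \<le> 1 * norm z * 1"
    using norm_isometry_le[OF iso] by (intro mult_mono) auto
  finally show ?thesis
    by simp
qed

lemma norm_extend_le: "norm (extend_op \<iota> x) \<le> norm x"
proof -
  have "norm (extend_op \<iota> x) \<le> norm (\<iota> o\<^sub>L x) * norm (adj \<iota>)"
    unfolding extend_op_def by (rule norm_blinfun_compose)
  also have "\<dots> \<le> norm \<iota> * norm x * norm (adj \<iota>)"
    by (intro mult_right_mono norm_blinfun_compose) simp
  also have "\<dots> \<le> 1 * norm x * 1"
    using norm_isometry_le[OF iso] by (intro mult_mono) auto
  finally show ?thesis
    by simp
qed

text \<open>The projection \<open>\<theta>\<^sup>n(p)\<close>, where \<open>p\<close> projects onto the range of \<open>\<iota>\<close>.\<close>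

definition proj :: "nat \<Rightarrow> 'k \<Rightarrow>\<^sub>L 'k"
  where "proj n = (\<theta> ^^ n) (extend_op \<iota> id_blinfun)"

lemma proj_in_B: "proj n \<in> B"
  by (simp add: proj_def funpow_in_B extend_in_B vN_id[OF vN_A])

lemma extend_compress: "extend_op \<iota> (compress_op \<iota> z) = proj 0 o\<^sub>L z o\<^sub>L proj 0"
  by (rule blinfun_eqI) (simp add: extend_op_def compress_op_def proj_def)

lemma norm_proj_le: "norm (proj n) \<le> 1"
proof -
  have "norm (proj n) \<le> norm (extend_op \<iota> id_blinfun)"
    unfolding proj_def by (intro funpow_contractive extend_in_B vN_id[OF vN_A])
  also have "\<dots> \<le> norm (id_blinfun :: 'h \<Rightarrow>\<^sub>L 'h)"
    by (rule norm_extend_le)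
  also have "\<dots> \<le> 1"
    by (rule norm_blinfun_bound) auto
  finally show ?thesis .
qed

lemma norm_proj_apply_le: "norm (blinfun_apply (proj n) v) \<le> norm v"
  using norm_blinfun[of "proj n" v] norm_proj_le[of n]
  by (meson mult_left_le_one_le mult_right_mono norm_ge_zero order_trans mult_le_one
      mult_cancel_right1 mult_left_mono order_refl le_numeral_extra(1))

lemma adj_proj: "adj (proj n) = proj n"
proof -
  have "adj (extend_op \<iota> id_blinfun) = extend_op \<iota> id_blinfun"
    by (rule adj_unique) (simp add: extend_op_def clinear_iota flip: cinner_adj_left cinner_adj_right)
  then show ?thesis
    by (simp add: proj_def funpow_adj[symmetric] extend_in_B vN_id[OF vN_A])
qed

text \<open>
  Since \<open>\<tau>\<^sup>n(1) = 1\<close>, compressing \<open>\<theta>\<^sup>n(p)\<close> gives the identity; a contraction with this property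
  fixes every vector of \<open>\<H>\<close>.
\<close>

lemma proj_iota [simp]: "blinfun_apply (proj n) (blinfun_apply \<iota> h) = blinfun_apply \<iota> h"
proof -
  define w where "w = blinfun_apply \<iota> h"
  have "compress_op \<iota> (proj n) = id_blinfun"
    using dilates[OF vN_id[OF vN_A], of n] unital_linear_on_funpow[OF lin_\<tau>, of n]
    by (simp add: proj_def unital_linear_on_def)
  from arg_cong[OF this, of "\<lambda>z. blinfun_apply z h"]
  have "blinfun_apply (adj \<iota>) (blinfun_apply (proj n) w) = h"
    by (simp add: w_def compress_op_def)
  then have "cinner w (blinfun_apply (proj n) w) = cinner h h"
    using cinner_adj_right[OF clinear_iota, of h "blinfun_apply (proj n) w"] by (simp add: w_def)
  then have "Re (cinner w (blinfun_apply (proj n) w)) = (norm w)\<^sup>2"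
    using iso by (simp add: cinner_self w_def isometric_embedding_def)
  moreover have "(norm (blinfun_apply (proj n) w))\<^sup>2 \<le> (norm w)\<^sup>2"
    by (intro power_mono norm_proj_apply_le) simp
  ultimately have "(norm (w - blinfun_apply (proj n) w))\<^sup>2 \<le> 0"
    by (simp add: norm_power2_diff)
  then show ?thesis
    by (simp add: w_def)
qed

lemma adj_iota_proj [simp]:
  "blinfun_apply (adj \<iota>) (blinfun_apply (proj n) v) = blinfun_apply (adj \<iota>) v"
proof (rule cinner_ext)
  fix u
  have "cinner (blinfun_apply \<iota> u) (blinfun_apply (proj n) v)
      = cinner (blinfun_apply (proj n) (blinfun_apply \<iota> u)) v"
    using cinner_adj_right[OF vN_clinear[OF vN proj_in_B], of "blinfun_apply \<iota> u" n v]
    by (simp add: adj_proj)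
  then show "cinner u (blinfun_apply (adj \<iota>) (blinfun_apply (proj n) v))
      = cinner u (blinfun_apply (adj \<iota>) v)"
    by (simp add: cinner_adj_right[OF clinear_iota])
qed

text \<open>
  Apply \<open>\<theta>\<^sup>m\<close> to \<open>\<theta>\<^bsup>n-m\<^esup>(p) p = p\<close>, which holds because \<open>\<theta>\<^bsup>n-m\<^esup>(p)\<close> fixes the range of \<open>p\<close>.
  The second equation is the adjoint of the first.
\<close>

lemma proj_compose:
  assumes "m \<le> n"
  shows "proj n o\<^sub>L proj m = proj m" "proj m o\<^sub>L proj n = proj m"
proof -
  obtain d where d: "n = m + d"
    using le_Suc_ex[OF assms] by blast
  have p: "extend_op \<iota> id_blinfun \<in> B"
    by (intro extend_in_B vN_id[OF vN_A])
  have "proj d o\<^sub>L extend_op \<iota> id_blinfun = extend_op \<iota> id_blinfun"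
    by (rule blinfun_eqI) (simp add: extend_op_def)
  from arg_cong[OF this, of "\<theta> ^^ m"] show *: "proj n o\<^sub>L proj m = proj m"
    by (simp add: funpow_mult proj_in_B p) (simp add: proj_def d Nat.funpow_add)
  show "proj m o\<^sub>L proj n = proj m"
    using arg_cong[OF *, of adj]
    by (simp add: adj_compose vN_clinear[OF vN proj_in_B] adj_proj)
qed

lemma proj_idem [simp]: "blinfun_apply (proj n) (blinfun_apply (proj n) v) = blinfun_apply (proj n) v"
  using arg_cong[OF proj_compose(1)[of n n], of "\<lambda>z. blinfun_apply z v"] by simp

text \<open>
  The factor \<open>\<theta>\<^sup>m(x\<^sub>m)\<close> absorbs \<open>\<theta>\<^sup>m(p)\<close> on its left, and \<open>\<theta>\<^sup>n(p)\<close> dominates \<open>\<theta>\<^sup>m(p)\<close>. By minimality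
  these vectors span a dense subspace, so \<open>\<theta>\<^sup>n(p)\<close> will tend strongly to the identity.
\<close>

lemma proj_dilation_vector:
  assumes "range x \<subseteq> A" "m \<le> n"
  shows "blinfun_apply (proj n) (dilation_vector \<iota> \<theta> x h m) = dilation_vector \<iota> \<theta> x h m"
proof (cases m)
  case 0
  then show ?thesis
    by simp
next
  case (Suc j)
  have xA: "x m \<in> A"
    using assms(1) by blast
  have "extend_op \<iota> id_blinfun o\<^sub>L extend_op \<iota> (x m) = extend_op \<iota> (x m)"
    by (simp add: extend_compose)
  from arg_cong[OF this, of "\<theta> ^^ m"]
  have pm: "proj m o\<^sub>L (\<theta> ^^ m) (extend_op \<iota> (x m)) = (\<theta> ^^ m) (extend_op \<iota> (x m))"
    using funpow_mult[of "extend_op \<iota> id_blinfun" "extend_op \<iota> (x m)" m]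
    by (simp add: proj_def extend_in_B vN_id[OF vN_A] xA)
  have "proj n o\<^sub>L (\<theta> ^^ m) (extend_op \<iota> (x m)) = (\<theta> ^^ m) (extend_op \<iota> (x m))"
    by (metis pm proj_compose(1)[OF assms(2)] blinfun_compose_assoc)
  from arg_cong[OF this, of "\<lambda>z. blinfun_apply z (dilation_vector \<iota> \<theta> x h j)"]
  show ?thesis
    unfolding Suc dilation_vector.simps by simp
qed

lemma tendsto_proj: "(\<lambda>n. blinfun_apply (proj n) v) \<longlonglongrightarrow> v"
proof -
  let ?V = "{v. (\<lambda>n. blinfun_apply (proj n) v) \<longlonglongrightarrow> v}"
  have "complex_vector.subspace ?V"
    by (auto simp: complex_vector.subspace_def blinfun.add_right
        clinear_opD[OF vN_clinear[OF vN proj_in_B]] intro: tendsto_intros)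
  moreover have "{dilation_vector \<iota> \<theta> x h n | x h n. range x \<subseteq> A} \<subseteq> ?V"
  proof safe
    fix x :: "nat \<Rightarrow> 'h \<Rightarrow>\<^sub>L 'h" and h m
    assume x: "range x \<subseteq> A"
    have "\<forall>\<^sub>F n in sequentially.
        blinfun_apply (proj n) (dilation_vector \<iota> \<theta> x h m) = dilation_vector \<iota> \<theta> x h m"
      using eventually_ge_at_top[of m] by eventually_elim (rule proj_dilation_vector[OF x])
    then show "(\<lambda>n. blinfun_apply (proj n) (dilation_vector \<iota> \<theta> x h m))
        \<longlonglongrightarrow> dilation_vector \<iota> \<theta> x h m"
      by (rule tendsto_eventually)
  qed
  ultimately have span: "cspan {dilation_vector \<iota> \<theta> x h n | x h n. range x \<subseteq> A} \<subseteq> ?V"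
    by (intro complex_vector.span_minimal)
  show ?thesis
  proof (rule metric_LIMSEQ_I)
    fix e :: real assume e: "e > 0"
    have "v \<in> closure (cspan {dilation_vector \<iota> \<theta> x h n | x h n. range x \<subseteq> A})"
      using dense by simp
    then obtain w where w: "w \<in> ?V" "dist w v < e / 3"
      using e span by (force simp: closure_approachable dest!: spec[of _ "e / 3"])
    then obtain N where N: "\<And>n. n \<ge> N \<Longrightarrow> dist (blinfun_apply (proj n) w) w < e / 3"
      using metric_LIMSEQ_D[of "\<lambda>n. blinfun_apply (proj n) w" w "e / 3"] e by auto
    have "dist (blinfun_apply (proj n) v) v < e" if "n \<ge> N" for n
    proof -
      have "dist (blinfun_apply (proj n) v) (blinfun_apply (proj n) w) \<le> dist v w"
        using norm_proj_apply_le[of n "v - w"] by (simp add: dist_norm blinfun.diff_right)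
      moreover have "dist (blinfun_apply (proj n) v) v \<le>
          dist (blinfun_apply (proj n) v) (blinfun_apply (proj n) w)
          + dist (blinfun_apply (proj n) w) w + dist w v"
        by (meson dist_triangle dist_triangle_le add_mono order_refl order_trans)
      ultimately show ?thesis
        using N[OF that] w by (simp add: dist_commute)
    qed
    then show "\<exists>N. \<forall>n\<ge>N. dist (blinfun_apply (proj n) v) v < e"
      by blast
  qed
qed

lemma tendsto_proj_apply:
  assumes "F \<le> sequentially" "(V \<longlongrightarrow> v) F"
  shows "((\<lambda>n. blinfun_apply (proj n) (V n)) \<longlongrightarrow> v) F"
proof (rule tendsto_bounded_apply[OF _ _ assms(2)])
  show "((\<lambda>n. blinfun_apply (proj n) v) \<longlongrightarrow> v) F"
    using tendsto_proj assms(1) by (rule tendsto_mono[rotated])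
  show "\<forall>\<^sub>F n in F. norm (proj n) \<le> 1"
    by (intro always_eventually allI norm_proj_le)
qed

lemma theta_compress:
  assumes "z \<in> B"
  shows "(\<theta> ^^ n) (extend_op \<iota> (compress_op \<iota> z)) = proj n o\<^sub>L (\<theta> ^^ n) z o\<^sub>L proj n"
proof -
  have "(\<theta> ^^ n) (proj 0) = proj n"
    by (simp add: proj_def)
  then show ?thesis
    by (simp add: extend_compress funpow_mult assms proj_in_B vN_compose[OF vN])
qed


section \<open>The compression is an isometric bijection\<close>

text \<open>
  For \<open>z\<close> in the peripheral space, \<open>\<theta>\<^sup>n(pzp) = \<theta>\<^sup>n(p) \<theta>\<^sup>n(z) \<theta>\<^sup>n(p)\<close> tends strongly to \<open>z\<close> along
  return times, whereas its norm is at most \<open>\<parallel>pzp\<parallel>\<close>.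
\<close>

lemma norm_compress:
  assumes z: "z \<in> peripheral_space unit_circle B \<theta>"
  shows "norm (compress_op \<iota> z) = norm z"
proof (rule antisym[OF norm_compress_le])
  have zB: "z \<in> B"
    using z peripheral_subset by blast
  show "norm z \<le> norm (compress_op \<iota> z)"
  proof (rule norm_blinfun_bound)
    fix v
    let ?f = "\<lambda>n. blinfun_apply ((\<theta> ^^ n) (extend_op \<iota> (compress_op \<iota> z))) v"
    have "(?f \<longlongrightarrow> blinfun_apply z v) return_times"
      unfolding theta_compress[OF zB] blinfun_apply_blinfun_compose
      by (intro tendsto_proj_apply blinfun.tendsto peripheral_recurrent z
          return_times_sequentially tendsto_const)
    moreover have "norm (?f n) \<le> norm (compress_op \<iota> z) * norm v" for n
    proof -
      have "norm (?f n) \<le> norm ((\<theta> ^^ n) (extend_op \<iota> (compress_op \<iota> z))) * norm v"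
        by (rule norm_blinfun)
      also have "\<dots> \<le> norm (extend_op \<iota> (compress_op \<iota> z)) * norm v"
        by (intro mult_right_mono funpow_contractive extend_in_B compress_in_A zB) simp
      also have "\<dots> \<le> norm (compress_op \<iota> z) * norm v"
        by (intro mult_right_mono norm_extend_le) simp
      finally show ?thesis .
    qed
    ultimately show "norm (blinfun_apply z v) \<le> norm (compress_op \<iota> z) * norm v"
      by (intro tendsto_upperbound[OF tendsto_norm _ return_times_neq_bot])
         (auto intro: always_eventually)
  qed simp
qed

lemma peripheral_complex_subspace: "complex_vector.subspace (peripheral_space G B \<theta>)"
  unfolding peripheral_space_def by (rule closure_cspan_subspace)

lemma inj_on_compress: "inj_on (compress_op \<iota>) (peripheral_space unit_circle B \<theta>)"
proof (rule inj_onI)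
  fix x y
  assume xy: "x \<in> peripheral_space unit_circle B \<theta>" "y \<in> peripheral_space unit_circle B \<theta>"
    and eq: "compress_op \<iota> x = compress_op \<iota> y"
  have "x - y \<in> peripheral_space unit_circle B \<theta>"
    using xy by (intro complex_vector.subspace_diff peripheral_complex_subspace)
  from norm_compress[OF this] show "x = y"
    by (simp add: compress_diff eq)
qed

text \<open>
  \<open>\<tau>(pzp)\<close> is the compression of \<open>\<theta>(p) \<theta>(z) \<theta>(p)\<close>, and \<open>\<theta>(p)\<close> is absorbed by \<open>p\<close>.
\<close>

lemma compress_eigenspace:
  assumes "z \<in> eigenspace B \<theta> \<mu>"
  shows "compress_op \<iota> z \<in> eigenspace A \<tau> \<mu>"
proof -
  have z: "z \<in> B" "\<theta> z = \<mu> *\<^sub>C z"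
    using assms by (auto simp: eigenspace_def)
  have "\<tau> (compress_op \<iota> z) = compress_op \<iota> (proj 1 o\<^sub>L \<theta> z o\<^sub>L proj 1)"
    using dilates[OF compress_in_A[OF z(1)], of 1] theta_compress[OF z(1), of 1] by simp
  also have "\<dots> = compress_op \<iota> (\<theta> z)"
    by (rule blinfun_eqI) (simp add: compress_op_def)
  finally show ?thesis
    using z by (simp add: eigenspace_def compress_in_A compress_scaleC)
qed

lemma norm_power2_minus_proj:
  "(norm (v - blinfun_apply (proj n) v))\<^sup>2 = (norm v)\<^sup>2 - (norm (blinfun_apply (proj n) v))\<^sup>2"
  using norm_apply_power2[OF vN_clinear[OF vN proj_in_B], of n v]
  by (simp add: norm_power2_diff adj_proj)

text \<open>
  Put \<open>X\<^sub>n = \<mu>\<^bsup>-n\<^esup> \<theta>\<^sup>n(x)\<close> and \<open>p\<^sub>n = \<theta>\<^sup>n(p)\<close>. As \<open>\<tau>(x) = \<mu> x\<close>, this is a martingale: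
  \<open>p\<^sub>m X\<^sub>n p\<^sub>m = X\<^sub>m\<close> for \<open>m \<le> n\<close>. Hence for \<open>u\<close> in the range of some \<open>p\<^sub>m\<close> the increments of \<open>X\<^sub>n u\<close>
  are orthogonal and \<open>X\<^sub>n u\<close> is bounded, so it converges. The strong limit \<open>Z\<close> satisfies
  \<open>p\<^sub>m Z p\<^sub>m = X\<^sub>m\<close>, which gives both \<open>\<theta>(Z) = \<mu> Z\<close> and \<open>pZp = x\<close>.
\<close>

lemma eigenvector_lift:
  assumes \<mu>: "cmod \<mu> = 1" and x: "x \<in> eigenspace A \<tau> \<mu>"
  shows "\<exists>Z \<in> eigenspace B \<theta> \<mu>. compress_op \<iota> Z = x"
proof -
  have xA: "x \<in> A"
    using x by (simp add: eigenspace_def)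
  have \<mu>0: "\<mu> \<noteq> 0"
    using \<mu> by auto
  define X where "X n = inverse \<mu> ^ n *\<^sub>C (\<theta> ^^ n) (extend_op \<iota> x)" for n
  have XB: "X n \<in> B" for n
    by (simp add: X_def vN_scaleC[OF vN] funpow_in_B extend_in_B xA)
  have martingale: "proj m o\<^sub>L X n o\<^sub>L proj m = X m" if mn: "m \<le> n" for m n
  proof -
    obtain d where d: "n = m + d"
      using le_Suc_ex[OF mn] by blast
    have thB: "(\<theta> ^^ d) (extend_op \<iota> x) \<in> B"
      by (simp add: funpow_in_B extend_in_B xA)
    have "proj m o\<^sub>L (\<theta> ^^ m) ((\<theta> ^^ d) (extend_op \<iota> x)) o\<^sub>L proj m
        = (\<theta> ^^ m) (extend_op \<iota> (compress_op \<iota> ((\<theta> ^^ d) (extend_op \<iota> x))))"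
      by (rule theta_compress[OF thB, symmetric])
    also have "compress_op \<iota> ((\<theta> ^^ d) (extend_op \<iota> x)) = \<mu> ^ d *\<^sub>C x"
      using dilates[OF xA, of d] funpow_eigenvector[OF lin_\<tau> x, of d] by simp
    also have "(\<theta> ^^ m) (extend_op \<iota> (\<mu> ^ d *\<^sub>C x)) = \<mu> ^ d *\<^sub>C (\<theta> ^^ m) (extend_op \<iota> x)"
      by (simp add: extend_scaleC funpow_scaleC extend_in_B xA)
    finally have eq: "proj m o\<^sub>L (\<theta> ^^ n) (extend_op \<iota> x) o\<^sub>L proj m
        = \<mu> ^ d *\<^sub>C (\<theta> ^^ m) (extend_op \<iota> x)"
      by (simp add: d Nat.funpow_add)
    have "proj m o\<^sub>L X n o\<^sub>L proj m
        = inverse \<mu> ^ n *\<^sub>C (proj m o\<^sub>L (\<theta> ^^ n) (extend_op \<iota> x) o\<^sub>L proj m)"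
      by (simp add: X_def blinfun_compose_scaleC_right vN_clinear[OF vN proj_in_B] blinfun_compose_simps)
    also have "\<dots> = X m"
      unfolding eq using \<mu>0 by (simp add: X_def scaleC_scaleC d power_add power_inverse)
    finally show ?thesis .
  qed
  have X_bound: "norm (X n) \<le> norm x" for n
  proof -
    have "norm (X n) = norm ((\<theta> ^^ n) (extend_op \<iota> x))"
      by (simp add: X_def norm_scaleC norm_power norm_inverse \<mu>)
    also have "\<dots> \<le> norm (extend_op \<iota> x)"
      by (intro funpow_contractive extend_in_B xA)
    also have "\<dots> \<le> norm x"
      by (rule norm_extend_le)
    finally show ?thesis .
  qed
  define D where "D = {u. \<exists>m. blinfun_apply (proj m) u = u}"
  have "\<exists>Z. \<forall>u. (\<lambda>n. blinfun_apply (X n) u) \<longlonglongrightarrow> blinfun_apply Z u"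
  proof (rule strong_limit_exists[OF X_bound])
    show "closure D = UNIV"
    proof -
      have "v \<in> closure D" for v
        unfolding closure_sequential
        by (intro exI[of _ "\<lambda>n. blinfun_apply (proj n) v"])
           (use tendsto_proj[of v] in \<open>auto simp: D_def intro: proj_idem\<close>)
      then show ?thesis
        by blast
    qed
  next
    fix u assume "u \<in> D"
    then obtain m where m: "blinfun_apply (proj m) u = u"
      by (auto simp: D_def)
    define w where "w n = blinfun_apply (X (n + m)) u" for n
    have pw: "blinfun_apply (proj (l + m)) (w n) = w l" if "l \<le> n" for l n
    proof -
      have "blinfun_apply (proj (l + m)) u = u"
        using arg_cong[OF proj_compose(1)[of m "l + m"], of "\<lambda>z. blinfun_apply z u"] m by simp
      then show ?thesis
        using arg_cong[OF martingale[of "l + m" "n + m"], of "\<lambda>z. blinfun_apply z u"] that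
        by (simp add: w_def)
    qed
    have increment: "(norm (w n - w l))\<^sup>2 = (norm (w n))\<^sup>2 - (norm (w l))\<^sup>2" if "l \<le> n" for l n
      using norm_power2_minus_proj[of "w n" "l + m"] by (simp add: pw[OF that])
    have "incseq (\<lambda>n. (norm (w n))\<^sup>2)"
      unfolding incseq_def using increment by (metis diff_ge_0_iff_ge zero_le_power2)
    moreover have "(norm (w n))\<^sup>2 \<le> (norm x * norm u)\<^sup>2" for n
      unfolding w_def
      by (intro power_mono order_trans[OF norm_blinfun] mult_right_mono X_bound) auto
    ultimately have "convergent (\<lambda>n. (norm (w n))\<^sup>2)"
      using incseq_convergent[of "\<lambda>n. (norm (w n))\<^sup>2"] by (metis convergentI)
    then have Cn: "Cauchy (\<lambda>n. (norm (w n))\<^sup>2)"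
      by (rule convergent_Cauchy)
    have "Cauchy w"
      unfolding Cauchy_altdef
    proof (intro allI impI)
      fix e :: real assume e: "e > 0"
      then obtain N where N: "\<And>l n. l \<ge> N \<Longrightarrow> n > l \<Longrightarrow> dist ((norm (w l))\<^sup>2) ((norm (w n))\<^sup>2) < e\<^sup>2"
        using Cn[unfolded Cauchy_altdef, rule_format, of "e\<^sup>2"] by auto
      have "dist (w l) (w n) < e" if "l \<ge> N" "n > l" for l n
      proof -
        have "(norm (w n - w l))\<^sup>2 < e\<^sup>2"
          using increment[of l n] N[OF that] that by (auto simp: dist_real_def)
        then show ?thesis
          using e by (simp add: dist_norm norm_minus_commute power2_less_imp_less)
      qed
      then show "\<exists>M. \<forall>m\<ge>M. \<forall>n>m. dist (w m) (w n) < e"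
        by blast
    qed
    then have "convergent w"
      by (rule Cauchy_convergent)
    then show "convergent (\<lambda>n. blinfun_apply (X n) u)"
      unfolding w_def by (rule convergent_ignore_initial_segment[THEN iffD1])
  qed
  then obtain Z where Z: "\<And>u. (\<lambda>n. blinfun_apply (X n) u) \<longlonglongrightarrow> blinfun_apply Z u"
    by blast
  have ZB: "Z \<in> B"
    by (rule vN_strong_limit[OF vN sequentially_bot _ Z]) (simp add: XB)
  have pZp: "proj m o\<^sub>L Z o\<^sub>L proj m = X m" for m
  proof (rule blinfun_eqI)
    fix v
    have "(\<lambda>n. blinfun_apply (proj m) (blinfun_apply (X n) (blinfun_apply (proj m) v)))
        \<longlonglongrightarrow> blinfun_apply (proj m) (blinfun_apply Z (blinfun_apply (proj m) v))"
      by (intro tendsto_intros Z)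
    moreover have "\<forall>\<^sub>F n in sequentially.
        blinfun_apply (proj m) (blinfun_apply (X n) (blinfun_apply (proj m) v)) = blinfun_apply (X m) v"
      using eventually_ge_at_top[of m]
    proof eventually_elim
      case (elim n)
      from arg_cong[OF martingale[OF elim], of "\<lambda>z. blinfun_apply z v"] show ?case
        by simp
    qed
    ultimately have "(\<lambda>n. blinfun_apply (X m) v)
        \<longlonglongrightarrow> blinfun_apply (proj m) (blinfun_apply Z (blinfun_apply (proj m) v))"
      by (rule Lim_transform_eventually)
    then show "blinfun_apply (proj m o\<^sub>L Z o\<^sub>L proj m) v = blinfun_apply (X m) v"
      by (simp add: LIMSEQ_const_iff)
  qed
  have thZ: "proj (Suc m) o\<^sub>L \<theta> Z o\<^sub>L proj (Suc m) = proj (Suc m) o\<^sub>L (\<mu> *\<^sub>C Z) o\<^sub>L proj (Suc m)" for m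
  proof -
    have "\<theta> (proj m) = proj (Suc m)"
      by (simp add: proj_def)
    then have "proj (Suc m) o\<^sub>L \<theta> Z o\<^sub>L proj (Suc m) = \<theta> (X m)"
      by (simp add: pZp[symmetric] mult proj_in_B ZB vN_compose[OF vN])
    also have "\<dots> = \<mu> *\<^sub>C X (Suc m)"
      using \<mu>0 by (simp add: X_def scaleC funpow_in_B extend_in_B xA scaleC_scaleC)
    also have "\<dots> = proj (Suc m) o\<^sub>L (\<mu> *\<^sub>C Z) o\<^sub>L proj (Suc m)"
      by (simp add: pZp[symmetric] blinfun_compose_scaleC_right vN_clinear[OF vN proj_in_B]
          blinfun_compose_simps)
    finally show ?thesis .
  qed
  have "\<theta> Z = \<mu> *\<^sub>C Z"
  proof (rule blinfun_eqI)
    fix v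
    have lim: "(\<lambda>n. blinfun_apply (proj (Suc n) o\<^sub>L Y o\<^sub>L proj (Suc n)) v) \<longlonglongrightarrow> blinfun_apply Y v" for Y
      unfolding blinfun_apply_blinfun_compose
      by (rule LIMSEQ_Suc) (intro tendsto_proj_apply blinfun.tendsto tendsto_const order_refl)
    show "blinfun_apply (\<theta> Z) v = blinfun_apply (\<mu> *\<^sub>C Z) v"
      by (rule LIMSEQ_unique[OF lim[of "\<theta> Z"]]) (unfold thZ, rule lim)
  qed
  moreover have "compress_op \<iota> Z = x"
  proof -
    have "compress_op \<iota> Z = compress_op \<iota> (proj 0 o\<^sub>L Z o\<^sub>L proj 0)"
      by (rule blinfun_eqI) (simp add: compress_op_def)
    also have "\<dots> = x"
      by (simp only: pZp) (simp add: X_def)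
    finally show ?thesis .
  qed
  ultimately show ?thesis
    using ZB by (auto simp: eigenspace_def)
qed

text \<open>
  The isometric image of a closed subspace is closed, so it suffices to match the eigenspaces.
\<close>

lemma compress_peripheral:
  assumes G: "G \<subseteq> unit_circle"
  shows "compress_op \<iota> ` peripheral_space G B \<theta> = peripheral_space G A \<tau>"
proof
  have sub: "complex_vector.subspace (peripheral_space G A \<tau>)"
    and cl: "closed (peripheral_space G A \<tau>)"
    by (simp_all add: peripheral_space_def closure_cspan_subspace)
  have "peripheral_space G B \<theta> \<subseteq> compress_op \<iota> -` peripheral_space G A \<tau>"
  proof (rule peripheral_space_subset)
    show "eigenspace B \<theta> \<mu> \<subseteq> compress_op \<iota> -` peripheral_space G A \<tau>" if "\<mu> \<in> G" for \<mu>
      using compress_eigenspace eigenspace_subset_peripheral[OF that] by blast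
    show "complex_vector.subspace (compress_op \<iota> -` peripheral_space G A \<tau>)"
      using sub compress_scaleC[of 0 0]
      by (auto simp: complex_vector.subspace_def compress_add compress_scaleC)
    show "closed (compress_op \<iota> -` peripheral_space G A \<tau>)"
      by (intro closed_vimage cl linear_continuous_on bounded_linear_compress)
  qed
  then show "compress_op \<iota> ` peripheral_space G B \<theta> \<subseteq> peripheral_space G A \<tau>"
    by blast
next
  let ?P = "peripheral_space G B \<theta>"
  have le: "?P \<subseteq> peripheral_space unit_circle B \<theta>"
    unfolding peripheral_space_def using G
    by (intro closure_mono complex_vector.span_mono) auto
  have Psub: "complex_vector.subspace ?P"
    by (rule peripheral_complex_subspace)
  show "peripheral_space G A \<tau> \<subseteq> compress_op \<iota> ` ?P"
  proof (rule peripheral_space_subset)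
    show "eigenspace A \<tau> \<mu> \<subseteq> compress_op \<iota> ` ?P" if \<mu>: "\<mu> \<in> G" for \<mu>
    proof
      fix x assume "x \<in> eigenspace A \<tau> \<mu>"
      then obtain Z where "Z \<in> eigenspace B \<theta> \<mu>" "compress_op \<iota> Z = x"
        using eigenvector_lift[of \<mu> x] \<mu> G by auto
      then show "x \<in> compress_op \<iota> ` ?P"
        using eigenspace_subset_peripheral[OF \<mu>] by blast
    qed
    show "complex_vector.subspace (compress_op \<iota> ` ?P)"
      unfolding complex_vector.subspace_def
    proof (intro conjI ballI allI)
      have "compress_op \<iota> 0 = 0"
        using compress_scaleC[of 0 0] by simp
      then show "0 \<in> compress_op \<iota> ` ?P"
        using complex_vector.subspace_0[OF Psub] by (metis imageI)
      show "x + y \<in> compress_op \<iota> ` ?P"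
        if "x \<in> compress_op \<iota> ` ?P" "y \<in> compress_op \<iota> ` ?P" for x y
        using that complex_vector.subspace_add[OF Psub] by (auto simp flip: compress_add)
      show "c *\<^sub>C x \<in> compress_op \<iota> ` ?P" if "x \<in> compress_op \<iota> ` ?P" for c x
        using that complex_vector.subspace_scale[OF Psub] by (auto simp flip: compress_scaleC)
    qed
    have "complete (compress_op \<iota> ` ?P)"
    proof (rule complete_isometric_image[of 1])
      show "subspace ?P"
        using Psub by (auto simp: complex_vector.subspace_def subspace_def scaleR_scaleC)
      show "complete ?P"
        by (simp add: complete_eq_closed peripheral_space_def)
      show "\<forall>z\<in>?P. norm (compress_op \<iota> z) \<ge> 1 * norm z"
        using le norm_compress by auto
    qed (simp_all add: bounded_linear_compress)
    then show "closed (compress_op \<iota> ` ?P)"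
      by (rule complete_imp_closed)
  qed
qed


section \<open>The product of the boundary\<close>

lemma boundary_mult_compress:
  assumes "Z \<in> peripheral_space unit_circle B \<theta>" "W \<in> peripheral_space unit_circle B \<theta>"
  shows "boundary_mult \<iota> B \<theta> (compress_op \<iota> Z) (compress_op \<iota> W) = compress_op \<iota> (Z o\<^sub>L W)"
  using assms by (simp add: boundary_mult_def Let_def inj_on_compress)

text \<open>
  The product can be read off from \<open>\<tau>\<close> alone: with \<open>x = pZp\<close> and \<open>y = pWp\<close>, \<open>\<tau>\<^sup>n(xy)\<close> is the
  compression of \<open>\<theta>\<^sup>n(p) \<theta>\<^sup>n(Z) \<theta>\<^sup>n(p) \<theta>\<^sup>n(W) \<theta>\<^sup>n(p)\<close>, which tends to \<open>ZW\<close> along return times.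
\<close>

lemma tendsto_boundary_mult:
  assumes x: "x \<in> peripheral_space unit_circle A \<tau>" and y: "y \<in> peripheral_space unit_circle A \<tau>"
  shows "((\<lambda>n. blinfun_apply ((\<tau> ^^ n) (x o\<^sub>L y)) h)
    \<longlongrightarrow> blinfun_apply (boundary_mult \<iota> B \<theta> x y) h) return_times"
proof -
  obtain Z W where Z: "Z \<in> peripheral_space unit_circle B \<theta>" "x = compress_op \<iota> Z"
    and W: "W \<in> peripheral_space unit_circle B \<theta>" "y = compress_op \<iota> W"
    using x y unfolding compress_peripheral[OF order_refl, symmetric] by blast
  have B: "Z \<in> B" "W \<in> B"
    using Z W peripheral_subset by auto
  then have A: "x \<in> A" "y \<in> A"
    by (simp_all add: Z W compress_in_A)
  have "(\<tau> ^^ n) (x o\<^sub>L y) =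
      compress_op \<iota> ((proj n o\<^sub>L (\<theta> ^^ n) Z o\<^sub>L proj n) o\<^sub>L (proj n o\<^sub>L (\<theta> ^^ n) W o\<^sub>L proj n))" for n
    using B A
    by (simp add: dilates vN_compose[OF vN_A] extend_compose[symmetric] funpow_mult extend_in_B
        theta_compress Z W)
  then have eq: "blinfun_apply ((\<tau> ^^ n) (x o\<^sub>L y)) h =
      blinfun_apply (adj \<iota>) (blinfun_apply (proj n) (blinfun_apply ((\<theta> ^^ n) Z)
        (blinfun_apply (proj n) (blinfun_apply ((\<theta> ^^ n) W)
          (blinfun_apply (proj n) (blinfun_apply \<iota> h))))))" for n
    by (simp add: compress_op_def)
  have "((\<lambda>n. blinfun_apply ((\<tau> ^^ n) (x o\<^sub>L y)) h) \<longlongrightarrow>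
      blinfun_apply (adj \<iota>) (blinfun_apply Z (blinfun_apply W (blinfun_apply \<iota> h)))) return_times"
    unfolding eq
    by (intro tendsto_proj_apply blinfun.tendsto peripheral_recurrent Z W
        return_times_sequentially tendsto_const)
  moreover have "boundary_mult \<iota> B \<theta> x y = compress_op \<iota> (Z o\<^sub>L W)"
    using Z W by (simp add: boundary_mult_compress)
  ultimately show ?thesis
    by (simp add: compress_op_def)
qed

end

text \<open>
  Since \<open>n \<mapsto> kn\<close> preserves return times, the limit formula for the product gives the same
  result for \<open>\<tau>\<close> and \<open>\<tau>\<^sup>k\<close>.
\<close>

lemma boundary_mult_funpow:
  assumes "dilation A \<tau> \<iota> B \<theta>" "dilation A (\<tau> ^^ k) \<iota>' B' \<theta>'" and k: "k \<ge> 1"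
    and x: "x \<in> peripheral_space unit_circle A \<tau>" "x \<in> peripheral_space unit_circle A (\<tau> ^^ k)"
    and y: "y \<in> peripheral_space unit_circle A \<tau>" "y \<in> peripheral_space unit_circle A (\<tau> ^^ k)"
  shows "boundary_mult \<iota>' B' \<theta>' x y = boundary_mult \<iota> B \<theta> x y"
proof (rule blinfun_eqI)
  fix h
  have "((\<lambda>n. blinfun_apply ((\<tau> ^^ (k * n)) (x o\<^sub>L y)) h)
      \<longlongrightarrow> blinfun_apply (boundary_mult \<iota> B \<theta> x y) h) return_times"
    by (rule filterlim_compose[OF dilation.tendsto_boundary_mult[OF assms(1) x(1) y(1)]
          filterlim_mult_return_times[OF k]])
  moreover have "((\<lambda>n. blinfun_apply ((\<tau> ^^ (k * n)) (x o\<^sub>L y)) h)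
      \<longlongrightarrow> blinfun_apply (boundary_mult \<iota>' B' \<theta>' x y) h) return_times"
    using dilation.tendsto_boundary_mult[OF assms(2) x(2) y(2), of h]
    by (simp add: funpow_mult mult.commute)
  ultimately show "blinfun_apply (boundary_mult \<iota>' B' \<theta>' x y) h
      = blinfun_apply (boundary_mult \<iota> B \<theta> x y) h"
    using tendsto_unique[OF return_times_neq_bot] by blast
qed

section \<open>Square-summable sequences\<close>

text \<open>
  Ultraweakly continuous functionals involve square-summable sequences of vectors. Viewing these as the
  vectors of one Hilbert space \<open>\<ell>\<^sup>2(\<H>)\<close> makes the orthogonal decomposition available for them.
\<close>

typedef (overloaded) 'a l2 = "{f :: nat \<Rightarrow> 'a::hilbert_space. summable (\<lambda>n. (norm (f n))\<^sup>2)}"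
  morphisms nth_l2 Abs_l2
  by (rule exI[of _ "\<lambda>_. 0"]) simp

setup_lifting type_definition_l2

lemma summable_l2: "summable (\<lambda>n. (norm (nth_l2 f n))\<^sup>2)"
  using nth_l2[of f] by simp

lemma l2_eqI: "(\<And>n. nth_l2 f n = nth_l2 g n) \<Longrightarrow> f = g"
  by (metis nth_l2_inject ext)

lemma norm_add_power2_le:
  "(norm (x + y))\<^sup>2 \<le> 2 * (norm x)\<^sup>2 + 2 * (norm (y::'a::hilbert_space))\<^sup>2"
  using parallelogram[of x y] zero_le_power2[of "norm (x - y)"] by linarith

lemma summable_l2_add:
  assumes "summable (\<lambda>n. (norm (f n))\<^sup>2)" "summable (\<lambda>n. (norm (g n))\<^sup>2)"
  shows "summable (\<lambda>n. (norm (f n + (g n :: 'a::hilbert_space)))\<^sup>2)"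
proof (rule summable_comparison_test')
  show "summable (\<lambda>n. 2 * (norm (f n))\<^sup>2 + 2 * (norm (g n))\<^sup>2)"
    using assms by (intro summable_add summable_mult)
  show "norm ((norm (f n + g n))\<^sup>2) \<le> 2 * (norm (f n))\<^sup>2 + 2 * (norm (g n))\<^sup>2" if "n \<ge> 0" for n
    using norm_add_power2_le by simp
qed

lemma summable_cinner:
  assumes "summable (\<lambda>n. (norm (f n))\<^sup>2)" "summable (\<lambda>n. (norm (g n))\<^sup>2)"
  shows "summable (\<lambda>n. cinner (f n) (g n :: 'a::hilbert_space))"
proof (rule summable_comparison_test')
  show "summable (\<lambda>n. (norm (f n))\<^sup>2 + (norm (g n))\<^sup>2)"
    using assms by (rule summable_add)
  show "norm (cinner (f n) (g n)) \<le> (norm (f n))\<^sup>2 + (norm (g n))\<^sup>2" if "n \<ge> 0" for n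
  proof -
    have "norm (cinner (f n) (g n)) \<le> norm (f n) * norm (g n)"
      by (rule cmod_cinner_le)
    also have "\<dots> \<le> (norm (f n))\<^sup>2 + (norm (g n))\<^sup>2"
    proof -
      have "2 * (norm (f n) * norm (g n)) \<le> (norm (f n))\<^sup>2 + (norm (g n))\<^sup>2"
        using sum_squares_bound[of "norm (f n)" "norm (g n)"] by (simp only: mult.assoc)
      moreover have "0 \<le> norm (f n) * norm (g n)"
        by simp
      ultimately show ?thesis
        by linarith
    qed
    finally show ?thesis .
  qed
qed

instantiation l2 :: (hilbert_space) complex_normed_vector
begin

lift_definition zero_l2 :: "'a l2" is "\<lambda>_. 0"
  by simp

lift_definition plus_l2 :: "'a l2 \<Rightarrow> 'a l2 \<Rightarrow> 'a l2" is "\<lambda>f g n. f n + g n"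
  by (rule summable_l2_add)

lift_definition uminus_l2 :: "'a l2 \<Rightarrow> 'a l2" is "\<lambda>f n. - f n"
  by simp

lift_definition minus_l2 :: "'a l2 \<Rightarrow> 'a l2 \<Rightarrow> 'a l2" is "\<lambda>f g n. f n - g n"
  by (use summable_l2_add[of _ "\<lambda>n. - _ n"] in auto)

lift_definition scaleC_l2 :: "complex \<Rightarrow> 'a l2 \<Rightarrow> 'a l2" is "\<lambda>c f n. c *\<^sub>C f n"
  by (simp add: norm_scaleC power_mult_distrib summable_mult)

definition scaleR_l2 :: "real \<Rightarrow> 'a l2 \<Rightarrow> 'a l2"
  where "scaleR_l2 r f = complex_of_real r *\<^sub>C f"

definition norm_l2 :: "'a l2 \<Rightarrow> real"
  where "norm_l2 f = sqrt (\<Sum>n. (norm (nth_l2 f n))\<^sup>2)"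

definition dist_l2 :: "'a l2 \<Rightarrow> 'a l2 \<Rightarrow> real"
  where "dist_l2 f g = norm (f - g)"

definition sgn_l2 :: "'a l2 \<Rightarrow> 'a l2"
  where "sgn_l2 f = inverse (norm f) *\<^sub>R f"

definition uniformity_l2 :: "('a l2 \<times> 'a l2) filter"
  where "uniformity_l2 = (INF e\<in>{0<..}. principal {(x, y). dist x y < e})"

definition open_l2 :: "'a l2 set \<Rightarrow> bool"
  where "open_l2 U \<longleftrightarrow> (\<forall>x\<in>U. \<forall>\<^sub>F (x', y) in uniformity. x' = x \<longrightarrow> y \<in> U)"

instance
proof
  fix f g h :: "'a l2" and r s :: real and c d :: complex
  show "f + g + h = f + (g + h)" "f + g = g + f" "0 + f = f" "- f + f = 0" "f - g = f + - g"
    by (rule l2_eqI; simp add: plus_l2.rep_eq minus_l2.rep_eq uminus_l2.rep_eq zero_l2.rep_eq)+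
  show "c *\<^sub>C (f + g) = c *\<^sub>C f + c *\<^sub>C g" "(c + d) *\<^sub>C f = c *\<^sub>C f + d *\<^sub>C f"
    "c *\<^sub>C d *\<^sub>C f = (c * d) *\<^sub>C f"
    by (rule l2_eqI; simp add: plus_l2.rep_eq scaleC_l2.rep_eq scaleC_add_right scaleC_add_left scaleC_scaleC)+
  have one: "1 *\<^sub>C f = f"
    by (rule l2_eqI) (simp add: scaleC_l2.rep_eq)
  show "r *\<^sub>R f = complex_of_real r *\<^sub>C f"
    by (rule scaleR_l2_def)
  show "r *\<^sub>R (f + g) = r *\<^sub>R f + r *\<^sub>R g" "(r + s) *\<^sub>R f = r *\<^sub>R f + s *\<^sub>R f"
    "r *\<^sub>R s *\<^sub>R f = (r * s) *\<^sub>R f"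
    unfolding scaleR_l2_def
    by (rule l2_eqI; simp add: plus_l2.rep_eq scaleC_l2.rep_eq scaleC_add_right scaleC_add_left
        scaleC_scaleC)+
  show "1 *\<^sub>R f = f"
    by (simp add: scaleR_l2_def one)
  show "dist f g = norm (f - g)" "sgn f = inverse (norm f) *\<^sub>R f"
    "uniformity = (INF e\<in>{0<..}. principal {(x, y). dist (x::'a l2) y < e})"
    by (simp_all add: dist_l2_def sgn_l2_def uniformity_l2_def)
  show "open U \<longleftrightarrow> (\<forall>x\<in>U. \<forall>\<^sub>F (x', y) in uniformity. x' = x \<longrightarrow> y \<in> U)" for U :: "'a l2 set"
    by (rule open_l2_def)
  show "norm f = 0 \<longleftrightarrow> f = 0"
  proof
    assume "norm f = 0"
    then have "(norm (nth_l2 f n))\<^sup>2 = 0" for n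
      using suminf_eq_zero_iff[OF summable_l2[of f]] by (simp add: norm_l2_def)
    then show "f = 0"
      by (intro l2_eqI) (simp add: zero_l2.rep_eq)
  qed (simp add: norm_l2_def zero_l2.rep_eq)
  have scale: "norm (c *\<^sub>C f) = cmod c * norm f" for c
    by (simp add: norm_l2_def scaleC_l2.rep_eq norm_scaleC power_mult_distrib
        suminf_mult summable_l2 real_sqrt_mult)
  then show "norm (c *\<^sub>C f) = cmod c * norm f" .
  show "norm (r *\<^sub>R f) = \<bar>r\<bar> * norm f"
    by (simp add: scaleR_l2_def scale)
  have part: "L2_set (\<lambda>i. norm (nth_l2 f i)) {..<N} \<le> norm f" for f :: "'a l2" and N
    unfolding L2_set_def norm_l2_def
    by (intro real_sqrt_le_mono sum_le_suminf summable_l2) auto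
  show "norm (f + g) \<le> norm f + norm g"
  proof -
    have n0: "0 \<le> norm f" "0 \<le> norm g"
      by (simp_all add: norm_l2_def suminf_nonneg summable_l2)
    have "(\<Sum>n. (norm (nth_l2 (f + g) n))\<^sup>2) \<le> (norm f + norm g)\<^sup>2"
    proof (rule suminf_le_const[OF summable_l2])
      fix N
      have "L2_set (\<lambda>n. norm (nth_l2 (f + g) n)) {..<N}
          \<le> L2_set (\<lambda>n. norm (nth_l2 f n) + norm (nth_l2 g n)) {..<N}"
        by (intro L2_set_mono) (auto simp: plus_l2.rep_eq norm_triangle_ineq)
      also have "\<dots> \<le> L2_set (\<lambda>n. norm (nth_l2 f n)) {..<N} + L2_set (\<lambda>n. norm (nth_l2 g n)) {..<N}"
        by (rule L2_set_triangle_ineq)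
      also have "\<dots> \<le> norm f + norm g"
        by (intro add_mono part)
      finally have "(L2_set (\<lambda>n. norm (nth_l2 (f + g) n)) {..<N})\<^sup>2 \<le> (norm f + norm g)\<^sup>2"
        by (intro power_mono L2_set_nonneg)
      then show "(\<Sum>n<N. (norm (nth_l2 (f + g) n))\<^sup>2) \<le> (norm f + norm g)\<^sup>2"
        by (simp add: L2_set_def sum_nonneg)
    qed
    then show ?thesis
      using n0 by (simp add: norm_l2_def[of "f + g"] real_le_lsqrt suminf_nonneg summable_l2)
  qed
qed

end

lemma nth_l2_scaleR: "nth_l2 (r *\<^sub>R f) n = r *\<^sub>R nth_l2 f n"
  by (simp add: scaleR_scaleC scaleC_l2.rep_eq)

lemma norm_l2_power2: "(norm f)\<^sup>2 = (\<Sum>n. (norm (nth_l2 f n))\<^sup>2)"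
  by (simp add: norm_l2_def suminf_nonneg summable_l2)

lemma norm_l2_le:
  assumes "C \<ge> 0" "\<And>N. (\<Sum>n<N. (norm (nth_l2 f n))\<^sup>2) \<le> C\<^sup>2"
  shows "norm f \<le> C"
proof (rule power2_le_imp_le)
  show "(norm f)\<^sup>2 \<le> C\<^sup>2"
    unfolding norm_l2_power2 by (intro suminf_le_const summable_l2 assms)
qed fact

lemma norm_nth_l2_le: "norm (nth_l2 f n) \<le> norm f"
proof (rule power2_le_imp_le)
  have "(\<Sum>i\<in>{n}. (norm (nth_l2 f i))\<^sup>2) \<le> (norm f)\<^sup>2"
    unfolding norm_l2_power2 by (intro sum_le_suminf summable_l2) auto
  then show "(norm (nth_l2 f n))\<^sup>2 \<le> (norm f)\<^sup>2"
    by simp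
qed simp

instance l2 :: (hilbert_space) complete_space
proof
  fix X :: "nat \<Rightarrow> 'a l2"
  assume X: "Cauchy X"
  have coord: "dist (nth_l2 (X m) i) (nth_l2 (X n) i) \<le> dist (X m) (X n)" for m n i
    using norm_nth_l2_le[of "X m - X n" i] by (simp add: dist_norm minus_l2.rep_eq)
  have "Cauchy (\<lambda>n. nth_l2 (X n) i)" for i
  proof (rule metric_CauchyI)
    fix e :: real assume "e > 0"
    from metric_CauchyD[OF X this]
    show "\<exists>M. \<forall>m\<ge>M. \<forall>n\<ge>M. dist (nth_l2 (X m) i) (nth_l2 (X n) i) < e"
      using coord le_less_trans by blast
  qed
  then have "\<exists>l. (\<lambda>n. nth_l2 (X n) i) \<longlonglongrightarrow> l" for i
    using Cauchy_convergent convergent_def by blast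
  then obtain l where l: "\<And>i. (\<lambda>n. nth_l2 (X n) i) \<longlonglongrightarrow> l i"
    by metis
  have tail: "(\<Sum>i<K. (norm (nth_l2 (X m) i - l i))\<^sup>2) \<le> e\<^sup>2"
    if M: "\<forall>m\<ge>M. \<forall>n\<ge>M. dist (X m) (X n) < e" and m: "m \<ge> M" for e M m K
  proof (rule tendsto_upperbound)
    show "(\<lambda>n. \<Sum>i<K. (norm (nth_l2 (X m) i - nth_l2 (X n) i))\<^sup>2)
        \<longlonglongrightarrow> (\<Sum>i<K. (norm (nth_l2 (X m) i - l i))\<^sup>2)"
      by (intro tendsto_intros l)
    show "\<forall>\<^sub>F n in sequentially. (\<Sum>i<K. (norm (nth_l2 (X m) i - nth_l2 (X n) i))\<^sup>2) \<le> e\<^sup>2"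
      using eventually_ge_at_top[of M]
    proof eventually_elim
      case (elim n)
      have "(\<Sum>i<K. (norm (nth_l2 (X m - X n) i))\<^sup>2) \<le> (norm (X m - X n))\<^sup>2"
        unfolding norm_l2_power2 by (intro sum_le_suminf summable_l2) auto
      also have "\<dots> \<le> e\<^sup>2"
        using M m elim by (intro power_mono) (auto simp: dist_norm less_imp_le)
      finally show ?case
        by (simp add: minus_l2.rep_eq)
    qed
  qed simp
  obtain M1 where M1: "\<forall>m\<ge>M1. \<forall>n\<ge>M1. dist (X m) (X n) < 1"
    using metric_CauchyD[OF X, of 1] by auto
  have "summable (\<lambda>i. (norm (nth_l2 (X M1) i - l i))\<^sup>2)"
    using tail[OF M1 order_refl]
    by (intro bounded_imp_summable[where B = 1])
       (auto simp: lessThan_Suc_atMost[symmetric] simp del: sum.lessThan_Suc)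
  then have "summable (\<lambda>i. (norm (nth_l2 (X M1) i + - (nth_l2 (X M1) i - l i)))\<^sup>2)"
    by (intro summable_l2_add summable_l2) (simp only: norm_minus_cancel)
  then have sl: "summable (\<lambda>i. (norm (l i))\<^sup>2)"
    by simp
  define L where "L = Abs_l2 l"
  have L: "nth_l2 L = l"
    using sl by (simp add: L_def Abs_l2_inverse)
  have "X \<longlonglongrightarrow> L"
  proof (rule metric_LIMSEQ_I)
    fix e :: real assume e: "e > 0"
    obtain M where M: "\<forall>m\<ge>M. \<forall>n\<ge>M. dist (X m) (X n) < e / 2"
      using metric_CauchyD[OF X, of "e / 2"] e by auto
    have "dist (X m) L < e" if "m \<ge> M" for m
    proof -
      have "norm (X m - L) \<le> e / 2"
        using tail[OF M that] e by (intro norm_l2_le) (auto simp: minus_l2.rep_eq L)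
      then show ?thesis
        using e by (simp add: dist_norm)
    qed
    then show "\<exists>N. \<forall>n\<ge>N. dist (X n) L < e"
      by blast
  qed
  then show "convergent X"
    by (auto simp: convergent_def)
qed

text \<open>
  Finite sequences with entries in a countable dense set are dense: cut off a small tail, then approximate
  the finitely many remaining entries.
\<close>

lemma separable_l2:
  "\<exists>D :: 'a::hilbert_space l2 set. countable D \<and> (\<forall>x. \<forall>e>0. \<exists>d\<in>D. dist x d < e)"
proof -
  obtain D0 :: "'a set" where D0: "countable D0" "\<And>x e. e > 0 \<Longrightarrow> \<exists>d\<in>D0. dist x d < e"
    using separable by blast
  define F :: "'a list \<Rightarrow> nat \<Rightarrow> 'a" where "F xs i = (if i < length xs then xs ! i else 0)" for xs i
  have Fsum: "summable (\<lambda>i. (norm (F xs i))\<^sup>2)" for xs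
    by (rule summable_finite[of "{..<length xs}"]) (auto simp: F_def)
  then have nth_F: "nth_l2 (Abs_l2 (F xs)) = F xs" for xs
    by (simp add: Abs_l2_inverse)
  show ?thesis
  proof (intro exI conjI allI impI)
    show "countable ((\<lambda>xs. Abs_l2 (F xs)) ` lists D0)"
      using D0 by (intro countable_image countable_lists)
    fix f :: "'a l2" and e :: real assume e: "e > 0"
    have "(\<lambda>n. \<Sum>i. (norm (nth_l2 f (i + n)))\<^sup>2) \<longlonglongrightarrow> 0"
      using suminf_exist_split2[OF summable_l2] .
    then have "\<forall>\<^sub>F n in sequentially. (\<Sum>i. (norm (nth_l2 f (i + n)))\<^sup>2) < e\<^sup>2 / 2"
      using e by (intro order_tendstoD) auto
    then obtain n where n: "(\<Sum>i. (norm (nth_l2 f (i + n)))\<^sup>2) < e\<^sup>2 / 2"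
      by (auto simp: eventually_sequentially)
    \<comment> \<open>The first \<open>n\<close> entries contribute at most \<open>n \<delta>\<^sup>2 \<le> e\<^sup>2 / 2\<close>.\<close>
    define \<delta> where "\<delta> = e / sqrt (2 * (real n + 1))"
    have \<delta>: "\<delta> > 0"
      using e by (simp add: \<delta>_def)
    then have "\<exists>d\<in>D0. dist (nth_l2 f i) d < \<delta>" for i
      by (rule D0)
    then obtain d where d: "\<And>i. d i \<in> D0" "\<And>i. dist (nth_l2 f i) (d i) < \<delta>"
      by metis
    define g where "g = Abs_l2 (F (map d [0..<n]))"
    have g: "nth_l2 g i = (if i < n then d i else 0)" for i
      by (simp add: g_def nth_F F_def)
    have "(norm (f - g))\<^sup>2 = (\<Sum>i. (norm (nth_l2 (f - g) (i + n)))\<^sup>2) + (\<Sum>i<n. (norm (nth_l2 (f - g) i))\<^sup>2)"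
      unfolding norm_l2_power2 by (rule suminf_split_initial_segment[OF summable_l2])
    also have "(\<Sum>i. (norm (nth_l2 (f - g) (i + n)))\<^sup>2) = (\<Sum>i. (norm (nth_l2 f (i + n)))\<^sup>2)"
      by (simp add: minus_l2.rep_eq g)
    also have "(\<Sum>i<n. (norm (nth_l2 (f - g) i))\<^sup>2) \<le> real (card {..<n}) * \<delta>\<^sup>2"
      by (intro sum_bounded_above power_mono)
         (use d in \<open>auto simp: minus_l2.rep_eq g dist_norm less_imp_le\<close>)
    also have "real (card {..<n}) * \<delta>\<^sup>2 \<le> e\<^sup>2 / 2"
      using e by (simp add: \<delta>_def power_divide field_simps)
    finally have "(norm (f - g))\<^sup>2 < e\<^sup>2"
      using n by simp
    then have "dist f g < e"
      using e by (simp add: dist_norm power2_less_imp_less)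
    moreover have "g \<in> (\<lambda>xs. Abs_l2 (F xs)) ` lists D0"
      unfolding g_def by (rule imageI) (use d in auto)
    ultimately show "\<exists>d\<in>(\<lambda>xs. Abs_l2 (F xs)) ` lists D0. dist f d < e"
      by blast
  qed
qed

instantiation l2 :: (hilbert_space) hilbert_space
begin

definition cinner_l2 :: "'a l2 \<Rightarrow> 'a l2 \<Rightarrow> complex"
  where "cinner_l2 f g = (\<Sum>n. cinner (nth_l2 f n) (nth_l2 g n))"

instance
proof
  fix f g h :: "'a l2" and c :: complex
  have s: "summable (\<lambda>n. cinner (nth_l2 f n) (nth_l2 g n))" for f g :: "'a l2"
    by (intro summable_cinner summable_l2)
  show "cinner f g = cnj (cinner g f)"
  proof -
    have "cnj (cinner g f) = (\<Sum>n. cnj (cinner (nth_l2 g n) (nth_l2 f n)))"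
      unfolding cinner_l2_def
      by (rule bounded_linear.suminf[OF bounded_linear_cnj s])
    then show ?thesis
      by (simp add: cinner_l2_def cinner_commute[of "nth_l2 f _"])
  qed
  show "cinner f (g + h) = cinner f g + cinner f h"
    by (simp add: cinner_l2_def plus_l2.rep_eq cinner_add_right suminf_add s)
  show "cinner f (c *\<^sub>C g) = c * cinner f g"
    by (simp add: cinner_l2_def scaleC_l2.rep_eq cinner_scaleC_right suminf_mult s)
  show "cinner f f = complex_of_real ((norm f)\<^sup>2)"
    unfolding cinner_l2_def norm_l2_power2 cinner_self
    by (rule bounded_linear.suminf[OF bounded_linear_of_real summable_l2, symmetric])
  show "\<exists>D :: 'a l2 set. countable D \<and> (\<forall>x. \<forall>e>0. \<exists>d\<in>D. dist x d < e)"
    by (rule separable_l2)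
qed

end

text \<open>The diagonal operator \<open>x \<oplus> x \<oplus> \<cdots>\<close>.\<close>

lift_definition amplify :: "('a::hilbert_space \<Rightarrow>\<^sub>L 'a) \<Rightarrow> 'a l2 \<Rightarrow> 'a l2"
  is "\<lambda>x f n. blinfun_apply x (f n)"
proof -
  fix x :: "'a \<Rightarrow>\<^sub>L 'a" and f :: "nat \<Rightarrow> 'a"
  assume "summable (\<lambda>n. (norm (f n))\<^sup>2)"
  then have "summable (\<lambda>n. (norm x)\<^sup>2 * (norm (f n))\<^sup>2)"
    by (rule summable_mult)
  then show "summable (\<lambda>n. (norm (blinfun_apply x (f n)))\<^sup>2)"
  proof (rule summable_comparison_test')
    show "norm ((norm (blinfun_apply x (f n)))\<^sup>2) \<le> (norm x)\<^sup>2 * (norm (f n))\<^sup>2" if "n \<ge> 0" for n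
      using power_mono[OF norm_blinfun[of x "f n"], of 2] by (simp add: power_mult_distrib)
  qed
qed

lift_definition single :: "nat \<Rightarrow> 'a::hilbert_space \<Rightarrow> 'a l2" is "\<lambda>m v n. if n = m then v else 0"
  by (rule summable_finite[of "{_}"]) auto

lemma norm_amplify_le: "norm (amplify x f) \<le> norm x * norm f"
proof (rule norm_l2_le)
  fix N
  have "(\<Sum>n<N. (norm (nth_l2 (amplify x f) n))\<^sup>2) \<le> (\<Sum>n<N. (norm x)\<^sup>2 * (norm (nth_l2 f n))\<^sup>2)"
    using power_mono[OF norm_blinfun, of x _ 2]
    by (intro sum_mono) (simp add: amplify.rep_eq power_mult_distrib)
  also have "\<dots> \<le> (norm x)\<^sup>2 * (norm f)\<^sup>2"
    unfolding sum_distrib_left[symmetric] norm_l2_power2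
    by (intro mult_left_mono sum_le_suminf summable_l2) auto
  finally show "(\<Sum>n<N. (norm (nth_l2 (amplify x f) n))\<^sup>2) \<le> (norm x * norm f)\<^sup>2"
    by (simp add: power_mult_distrib)
qed simp

lemma bounded_linear_amplify: "bounded_linear (amplify x)"
proof (rule bounded_linear_intro[where K = "norm x"])
  show "amplify x (f + g) = amplify x f + amplify x g" for f g
    by (rule l2_eqI) (simp add: amplify.rep_eq plus_l2.rep_eq blinfun.add_right)
  show "amplify x (r *\<^sub>R f) = r *\<^sub>R amplify x f" for r f
    by (rule l2_eqI) (simp add: amplify.rep_eq nth_l2_scaleR blinfun.scaleR_right)
  show "norm (amplify x f) \<le> norm f * norm x" for f
    using norm_amplify_le by (simp add: mult.commute)
qed

lemma amplify_diff_left: "amplify (x - y) f = amplify x f - amplify y f"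
  and amplify_add_left: "amplify (x + y) f = amplify x f + amplify y f"
  and amplify_scaleC_left: "amplify (c *\<^sub>C x) f = c *\<^sub>C amplify x f"
  and amplify_compose: "amplify (x o\<^sub>L y) f = amplify x (amplify y f)"
  and amplify_id [simp]: "amplify id_blinfun f = f"
  by (auto intro!: l2_eqI simp: amplify.rep_eq minus_l2.rep_eq plus_l2.rep_eq scaleC_l2.rep_eq
      scaleC_blinfun.rep_eq blinfun.bilinear_simps)

lemma cinner_amplify:
  assumes "clinear_op x"
  shows "cinner f (amplify x g) = cinner (amplify (adj x) f) g"
  by (simp add: cinner_l2_def amplify.rep_eq cinner_adj_left[OF assms])

lemma amplify_single: "amplify x (single n v) = single n (blinfun_apply x v)"
  by (rule l2_eqI) (simp add: amplify.rep_eq single.rep_eq)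

lemma norm_single: "norm (single n v) \<le> norm v"
proof (rule norm_l2_le)
  fix N
  have "(\<Sum>i<N. (norm (nth_l2 (single n v) i))\<^sup>2) = (\<Sum>i<N. if i = n then (norm v)\<^sup>2 else 0)"
    by (intro sum.cong) (auto simp: single.rep_eq)
  also have "\<dots> \<le> (norm v)\<^sup>2"
    by simp
  finally show "(\<Sum>i<N. (norm (nth_l2 (single n v) i))\<^sup>2) \<le> (norm v)\<^sup>2" .
qed simp

lemma single_scaleC: "single n (c *\<^sub>C v) = c *\<^sub>C single n v"
  by (rule l2_eqI) (simp add: single.rep_eq scaleC_l2.rep_eq)

lemma bounded_linear_single: "bounded_linear (single n)"
proof (rule bounded_linear_intro[where K = 1])
  show "single n (u + v) = single n u + single n v" for u v :: 'a
    by (rule l2_eqI) (simp add: single.rep_eq plus_l2.rep_eq)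
qed (simp_all add: scaleR_scaleC single_scaleC norm_single)

lemma bounded_linear_nth_l2: "bounded_linear (\<lambda>f. nth_l2 f n)"
  by (rule bounded_linear_intro[where K = 1])
     (simp_all add: plus_l2.rep_eq scaleR_scaleC scaleC_l2.rep_eq norm_nth_l2_le)

lemma single_sums: "(\<lambda>n. single n (nth_l2 f n)) sums f"
  unfolding sums_def
proof (rule Lim_null[THEN iffD2], rule Lim_null_comparison)
  have nth_part: "nth_l2 (\<Sum>i<N. single i (nth_l2 f i)) n = (if n < N then nth_l2 f n else 0)" for N n
    by (induction N) (auto simp: zero_l2.rep_eq plus_l2.rep_eq single.rep_eq)
  have "(norm ((\<Sum>i<N. single i (nth_l2 f i)) - f))\<^sup>2 = (\<Sum>i. (norm (nth_l2 f (i + N)))\<^sup>2)" for N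
  proof -
    let ?g = "(\<Sum>i<N. single i (nth_l2 f i)) - f"
    have "(norm ?g)\<^sup>2 = (\<Sum>i. (norm (nth_l2 ?g (i + N)))\<^sup>2) + (\<Sum>i<N. (norm (nth_l2 ?g i))\<^sup>2)"
      unfolding norm_l2_power2 by (rule suminf_split_initial_segment[OF summable_l2])
    then show ?thesis
      by (simp add: minus_l2.rep_eq nth_part)
  qed
  then show "\<forall>\<^sub>F N in sequentially. norm ((\<Sum>i<N. single i (nth_l2 f i)) - f)
      \<le> sqrt (\<Sum>i. (norm (nth_l2 f (i + N)))\<^sup>2)"
    by (metis (no_types, lifting) always_eventually norm_ge_zero order_refl real_sqrt_unique)
  show "(\<lambda>N. sqrt (\<Sum>i. (norm (nth_l2 f (i + N)))\<^sup>2)) \<longlonglongrightarrow> 0"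
    using tendsto_real_sqrt[OF suminf_exist_split2[OF summable_l2[of f]]] by simp
qed


section \<open>The bicommutant theorem\<close>

lemma orthogonal_projection_exists:
  fixes M :: "'a::hilbert_space set"
  assumes M: "complex_vector.subspace M" and cl: "closed M"
  obtains P where "bounded_linear P" "\<And>c v. P (c *\<^sub>C v) = c *\<^sub>C P v" "\<And>v. P v \<in> M"
    "\<And>v m. m \<in> M \<Longrightarrow> (\<And>w. w \<in> M \<Longrightarrow> cinner w (v - m) = 0) \<Longrightarrow> P v = m"
    "\<And>v w. w \<in> M \<Longrightarrow> cinner w (v - P v) = 0"
proof -
  have "\<exists>m. m \<in> M \<and> (\<forall>w\<in>M. cinner w (v - m) = 0)" for v
    using orthogonal_decomposition[OF M cl, of v] by metis
  then obtain P where PM: "\<And>v. P v \<in> M" and orth: "\<And>v w. w \<in> M \<Longrightarrow> cinner w (v - P v) = 0"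
    by metis
  have uniq: "P v = m" if "m \<in> M" and m: "\<And>w. w \<in> M \<Longrightarrow> cinner w (v - m) = 0" for v m
  proof -
    have w: "P v - m \<in> M"
      using that PM by (intro complex_vector.subspace_diff[OF M])
    have "cinner (P v - m) (P v - m) = cinner (P v - m) (v - m) - cinner (P v - m) (v - P v)"
      by (simp flip: cinner_diff_right)
    then have "cinner (P v - m) (P v - m) = 0"
      using orth[OF w] m[OF w] by simp
    then show ?thesis
      by simp
  qed
  have add: "P (u + v) = P u + P v" for u v
  proof (rule uniq)
    show "P u + P v \<in> M"
      by (intro complex_vector.subspace_add[OF M] PM)
    show "cinner w (u + v - (P u + P v)) = 0" if "w \<in> M" for w
      using orth[OF that, of u] orth[OF that, of v] by (simp add: cinner_simps)
  qed
  have scale: "P (c *\<^sub>C v) = c *\<^sub>C P v" for c v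
  proof (rule uniq)
    show "c *\<^sub>C P v \<in> M"
      by (intro complex_vector.subspace_scale[OF M] PM)
    show "cinner w (c *\<^sub>C v - c *\<^sub>C P v) = 0" if "w \<in> M" for w
      using orth[OF that, of v] by (simp add: cinner_simps)
  qed
  have "norm (P v) \<le> norm v" for v
  proof (rule power2_le_imp_le)
    have "(norm (P v + (v - P v)))\<^sup>2 = (norm (P v))\<^sup>2 + (norm (v - P v))\<^sup>2"
      unfolding norm_power2_add using orth[OF PM, of v v] by simp
    then show "(norm (P v))\<^sup>2 \<le> (norm v)\<^sup>2"
      by simp
  qed simp
  then have "bounded_linear P"
    by (intro bounded_linear_intro[where K = 1]) (simp_all add: add scale scaleR_scaleC)
  then show ?thesis
    using that scale PM uniq orth by blast
qed

text \<open>
  Let \<open>P\<close> project \<open>\<ell>\<^sup>2(\<H>)\<close> onto the closure of \<open>{(z \<oplus> z \<oplus> \<cdots>) e | z \<in> N}\<close>. This space is invariant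
  under the amplified \<open>*\<close>-algebra \<open>N\<close>, so \<open>P\<close> commutes with it, which says that the matrix
  entries of \<open>P\<close> lie in the commutant of \<open>N\<close>. They therefore commute with \<open>y \<in> N''\<close>, so \<open>P\<close> commutes
  with the amplified \<open>y\<close>, and \<open>y\<close> maps \<open>e\<close> into the closure.
\<close>

lemma bicommutant_density:
  fixes N :: "('a::hilbert_space \<Rightarrow>\<^sub>L 'a) set"
  assumes N: "N \<subseteq> bounded_ops" "id_blinfun \<in> N" "\<And>x. x \<in> N \<Longrightarrow> adj x \<in> N"
    "\<And>x y. x \<in> N \<Longrightarrow> y \<in> N \<Longrightarrow> x + y \<in> N" "\<And>c x. x \<in> N \<Longrightarrow> c *\<^sub>C x \<in> N"
    "\<And>x y. x \<in> N \<Longrightarrow> y \<in> N \<Longrightarrow> x o\<^sub>L y \<in> N"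
    and y: "y \<in> commutant (commutant N)" and \<delta>: "\<delta> > 0"
  shows "\<exists>z\<in>N. norm (amplify (z - y) e) < \<delta>"
proof -
  let ?V = "(\<lambda>z. amplify z e) ` N"
  let ?M = "closure ?V"
  interpret amp: bounded_linear "amplify x" for x :: "'a \<Rightarrow>\<^sub>L 'a"
    by (rule bounded_linear_amplify)
  have "0 \<in> N"
    using N(5)[OF N(2), of 0] by simp
  have V: "complex_vector.subspace ?V"
    unfolding complex_vector.subspace_def
  proof (intro conjI ballI allI)
    have "amplify (0 :: 'a \<Rightarrow>\<^sub>L 'a) e = 0"
      using amplify_diff_left[of 0 0 e] by simp
    then show "0 \<in> ?V"
      using \<open>0 \<in> N\<close> by (metis imageI)
    show "u + v \<in> ?V" if "u \<in> ?V" "v \<in> ?V" for u v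
      using that N(4) by (auto simp flip: amplify_add_left)
    show "c *\<^sub>C u \<in> ?V" if "u \<in> ?V" for c u
      using that N(5) by (auto simp flip: amplify_scaleC_left)
  qed
  then have spanV: "cspan ?V = ?V"
    by (rule complex_vector.span_eq_iff[THEN iffD2])
  have M: "complex_vector.subspace ?M"
    using closure_cspan_subspace[of ?V] by (simp only: spanV)
  obtain P where P: "bounded_linear P" "\<And>c v. P (c *\<^sub>C v) = c *\<^sub>C P v" "\<And>v. P v \<in> ?M"
    "\<And>v m. m \<in> ?M \<Longrightarrow> (\<And>w. w \<in> ?M \<Longrightarrow> cinner w (v - m) = 0) \<Longrightarrow> P v = m"
    "\<And>v w. w \<in> ?M \<Longrightarrow> cinner w (v - P v) = 0"
    using orthogonal_projection_exists[OF M closed_closure] by blast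
  interpret P: bounded_linear P
    by (rule P)
  have invariant: "amplify z v \<in> ?M" if z: "z \<in> N" and v: "v \<in> ?M" for z v
  proof -
    have "amplify z ` ?M \<subseteq> closure (amplify z ` ?V)"
      by (rule closure_bounded_linear_image_subset[OF bounded_linear_amplify])
    also have "\<dots> \<subseteq> ?M"
      using N(6)[OF z] by (intro closure_mono) (auto simp flip: amplify_compose)
    finally show ?thesis
      using v by blast
  qed
  have P_commutes: "P (amplify z v) = amplify z (P v)" if z: "z \<in> N" for z v
  proof (rule P(4))
    show "amplify z (P v) \<in> ?M"
      by (intro invariant z P(3))
    fix w assume w: "w \<in> ?M"
    have "clinear_op z"
      using z N(1) by (auto simp: bounded_ops_def)
    then have "cinner w (amplify z (v - P v)) = cinner (amplify (adj z) w) (v - P v)"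
      by (rule cinner_amplify)
    also have "\<dots> = 0"
      by (intro P(5) invariant N(3) z w)
    finally show "cinner w (amplify z v - amplify z (P v)) = 0"
      by (simp add: amp.diff)
  qed
  have cly: "clinear_op y"
    using y by (rule commutantD(1))
  have entry: "nth_l2 (P (single n (blinfun_apply y v))) m = blinfun_apply y (nth_l2 (P (single n v)) m)"
    for m n v
  proof -
    \<comment> \<open>The matrix entry of \<open>P\<close> at position \<open>(m, n)\<close>.\<close>
    define E where "E = Blinfun (\<lambda>v. nth_l2 (P (single n v)) m)"
    have E: "blinfun_apply E v = nth_l2 (P (single n v)) m" for v
      unfolding E_def
      by (subst bounded_linear_Blinfun_apply)
         (intro bounded_linear_compose[OF bounded_linear_nth_l2] bounded_linear_compose[OF P(1)]
           bounded_linear_single, rule refl)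
    have "E \<in> commutant N"
    proof (rule commutantI)
      show "clinear_op E"
        by (simp add: clinear_op_def E single_scaleC P(2) scaleC_l2.rep_eq)
      show "E o\<^sub>L z = z o\<^sub>L E" if "z \<in> N" for z
        by (rule blinfun_eqI)
           (simp add: E P_commutes[OF that] amplify.rep_eq flip: amplify_single)
    qed
    from commutantD(2)[OF y this] have "blinfun_apply (y o\<^sub>L E) v = blinfun_apply (E o\<^sub>L y) v"
      by simp
    then show ?thesis
      by (simp add: E)
  qed
  have P_single: "P (amplify y (single n v)) = amplify y (P (single n v))" for n v
    by (rule l2_eqI) (simp add: amplify_single entry amplify.rep_eq)
  have "P (amplify y e) = amplify y (P e)"
  proof -
    have "(\<lambda>n. P (amplify y (single n (nth_l2 e n)))) sums P (amplify y e)"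
      by (intro P.sums amp.sums single_sums)
    moreover have "(\<lambda>n. amplify y (P (single n (nth_l2 e n)))) sums amplify y (P e)"
      by (intro P.sums amp.sums single_sums)
    ultimately show ?thesis
      unfolding P_single by (rule sums_unique2)
  qed
  moreover have "P e = e"
  proof (rule P(4))
    have "amplify id_blinfun e \<in> ?V"
      using N(2) by (rule imageI)
    then show "e \<in> ?M"
      using closure_subset by fastforce
  qed simp
  ultimately have "amplify y e \<in> ?M"
    using P(3)[of "amplify y e"] by simp
  then obtain z where "z \<in> N" "dist (amplify z e) (amplify y e) < \<delta>"
    using \<delta> by (auto simp: closure_approachable)
  then show ?thesis
    by (auto simp: dist_norm amplify_diff_left)
qed


section \<open>Ultraweak neighbourhoods and fixed points\<close>

text \<open>Interleaving two sequences turns two ultrastrong conditions into one.\<close>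

lift_definition interleave :: "'a::hilbert_space l2 \<Rightarrow> 'a l2 \<Rightarrow> 'a l2"
  is "\<lambda>f g n. if even n then f (n div 2) else g ((n - 1) div 2)"
proof -
  fix f g :: "nat \<Rightarrow> 'a"
  assume f: "summable (\<lambda>n. (norm (f n))\<^sup>2)" and g: "summable (\<lambda>n. (norm (g n))\<^sup>2)"
  have "summable (\<lambda>n. if even n then (norm (f (n div 2)))\<^sup>2 else (norm (g ((n - 1) div 2)))\<^sup>2)"
    using sums_if[OF summable_sums[OF g] summable_sums[OF f]] by (rule sums_summable)
  then show "summable (\<lambda>n. (norm (if even n then f (n div 2) else g ((n - 1) div 2)))\<^sup>2)"
    by (rule summable_cong[THEN iffD1, rotated]) (auto intro!: always_eventually)
qed

lemma norm_interleave: "(norm (interleave f g))\<^sup>2 = (norm f)\<^sup>2 + (norm g)\<^sup>2"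
proof -
  have "(\<lambda>n. if even n then (norm (nth_l2 f (n div 2)))\<^sup>2 else (norm (nth_l2 g ((n - 1) div 2)))\<^sup>2)
      sums ((norm g)\<^sup>2 + (norm f)\<^sup>2)"
    unfolding norm_l2_power2 by (intro sums_if summable_sums summable_l2)
  moreover have "(\<lambda>n. if even n then (norm (nth_l2 f (n div 2)))\<^sup>2 else (norm (nth_l2 g ((n - 1) div 2)))\<^sup>2)
      = (\<lambda>n. (norm (nth_l2 (interleave f g) n))\<^sup>2)"
    by (auto simp: interleave.rep_eq)
  ultimately show ?thesis
    by (simp add: norm_l2_power2[of "interleave f g"] sums_iff add.commute)
qed

lemma amplify_interleave: "amplify x (interleave f g) = interleave (amplify x f) (amplify x g)"
  by (rule l2_eqI) (simp add: amplify.rep_eq interleave.rep_eq)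

lemma ultraweak_basis_eq:
  "{x. (\<Sum>n. cinner (nth_l2 f n) (blinfun_apply x (nth_l2 e n))) \<in> U} = {x. cinner f (amplify x e) \<in> U}"
  by (simp add: cinner_l2_def amplify.rep_eq)

text \<open>
  By the Cauchy--Schwarz inequality in \<open>\<ell>\<^sup>2\<close>, each functional that defines the topology is controlled by a
  single seminorm \<open>x \<mapsto> \<parallel>(x \<oplus> x \<oplus> \<cdots>) e\<parallel>\<close>, and these are the seminorms of the density theorem.
\<close>

lemma ultraweak_open_neighbourhood:
  assumes "openin ultraweak_topology U" "y \<in> U"
  shows "\<exists>e \<delta>. \<delta> > 0 \<and> (\<forall>z. norm (amplify (z - y) e) < \<delta> \<longrightarrow> z \<in> U)"
proof -
  have "generate_topology_on {{x. (\<Sum>n. cinner (\<xi> n) (blinfun_apply x (\<eta> n))) \<in> U} | \<xi> \<eta> U.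
      summable (\<lambda>n. (norm (\<xi> n))\<^sup>2) \<and> summable (\<lambda>n. (norm (\<eta> n))\<^sup>2) \<and> open U} U"
    using assms(1) unfolding ultraweak_topology_def by (rule openin_topology_generated_by)
  then show ?thesis
    using assms(2)
  proof (induction U)
    case Empty
    then show ?case
      by simp
  next
    case (Int a b)
    then obtain e d e' d' where
      a: "d > 0" "\<And>z. norm (amplify (z - y) e) < d \<Longrightarrow> z \<in> a" and
      b: "d' > 0" "\<And>z. norm (amplify (z - y) e') < d' \<Longrightarrow> z \<in> b"
      by (metis IntD1 IntD2)
    have "z \<in> a \<inter> b" if z: "norm (amplify (z - y) (interleave e e')) < min d d'" for z
    proof -
      have "norm (amplify (z - y) e) \<le> norm (amplify (z - y) (interleave e e'))"
        "norm (amplify (z - y) e') \<le> norm (amplify (z - y) (interleave e e'))"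
        by (rule power2_le_imp_le; simp add: amplify_interleave norm_interleave)+
      with z a(2)[of z] b(2)[of z] show ?thesis
        by simp
    qed
    then show ?case
      using a(1) b(1) by (intro exI[of _ "interleave e e'"] exI[of _ "min d d'"]) auto
  next
    case (UN K)
    then obtain k where "k \<in> K" "y \<in> k"
      by blast
    with UN.IH[of k] show ?case
      by (meson UnionI)
  next
    case (Basis s)
    then obtain \<xi> \<eta> W where s: "s = {x. (\<Sum>n. cinner (\<xi> n) (blinfun_apply x (\<eta> n))) \<in> W}"
      and sm: "summable (\<lambda>n. (norm (\<xi> n))\<^sup>2)" "summable (\<lambda>n. (norm (\<eta> n))\<^sup>2)" and W: "open W"
      by blast
    define f e where "f = Abs_l2 \<xi>" and "e = Abs_l2 \<eta>"
    have "nth_l2 f = \<xi>" "nth_l2 e = \<eta>"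
      using sm by (simp_all add: f_def e_def Abs_l2_inverse)
    then have s': "s = {x. cinner f (amplify x e) \<in> W}"
      using ultraweak_basis_eq[of f e W] s by simp
    then obtain r where r: "r > 0" "ball (cinner f (amplify y e)) r \<subseteq> W"
      using W Basis.prems by (auto simp: open_contains_ball)
    have "z \<in> s" if z: "norm (amplify (z - y) e) < r / (norm f + 1)" for z
    proof -
      have pos: "norm f + 1 > 0"
        using norm_ge_zero[of f] by linarith
      have "dist (cinner f (amplify y e)) (cinner f (amplify z e)) = cmod (cinner f (amplify (z - y) e))"
        by (simp add: dist_norm amplify_diff_left cinner_diff_right norm_minus_commute)
      also have "\<dots> \<le> norm f * norm (amplify (z - y) e)"
        by (rule cmod_cinner_le)
      also have "\<dots> \<le> (norm f + 1) * norm (amplify (z - y) e)"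
        by (intro mult_right_mono) auto
      also have "\<dots> < r"
        using z pos by (simp add: field_simps)
      finally show ?thesis
        using r by (auto simp: s')
    qed
    moreover have "r / (norm f + 1) > 0"
      using r by (simp add: add_nonneg_pos)
    ultimately show ?case
      by blast
  qed
qed

lemma openin_ultraweak_vector_functional:
  assumes "open U"
  shows "openin ultraweak_topology {x. cinner u (blinfun_apply x v) \<in> U}"
proof -
  have "cinner (single 0 u) (amplify x (single 0 v)) = cinner u (blinfun_apply x v)" for x
  proof -
    have "(\<lambda>n. cinner (nth_l2 (single 0 u) n) (nth_l2 (amplify x (single 0 v)) n))
        = (\<lambda>n. if n = 0 then cinner u (blinfun_apply x v) else 0)"
      by (auto simp: amplify_single single.rep_eq)
    then show ?thesis
      using sums_single[of 0 "\<lambda>_. cinner u (blinfun_apply x v)"] by (simp add: cinner_l2_def sums_iff)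
  qed
  then have "{x. cinner u (blinfun_apply x v) \<in> U} =
      {x. (\<Sum>n. cinner (nth_l2 (single 0 u) n) (blinfun_apply x (nth_l2 (single 0 v) n))) \<in> U}"
    by (simp add: ultraweak_basis_eq)
  then show ?thesis
    unfolding ultraweak_topology_def
    using assms summable_l2 by (intro topology_generated_by_Basis) blast
qed

context star_endomorphism
begin

text \<open>
  The fixed points form a \<open>*\<close>-algebra \<open>N\<close>, and by the density theorem every \<open>y \<in> N'' \<subseteq> B\<close> lies in
  its ultraweak closure, on which the ultraweakly continuous \<open>\<theta>\<close> is still the identity.
\<close>

lemma fixed_points_von_neumann: "von_neumann_algebra {z \<in> B. \<theta> z = z}"
proof -
  let ?N = "{z \<in> B. \<theta> z = z}"
  have NB: "?N \<subseteq> bounded_ops"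
    using vN_clinear[OF vN] by (auto simp: bounded_ops_def)
  have N_adj: "adj x \<in> ?N" if "x \<in> ?N" for x
    using that by (simp add: vN_adj[OF vN] adj)
  have bicommutant_sub: "y \<in> ?N" if y: "y \<in> commutant (commutant ?N)" for y
  proof -
    have "commutant (commutant ?N) \<subseteq> commutant (commutant B)"
      by (intro commutant_antimono) auto
    then have yB: "y \<in> B"
      using y by (auto simp: vN_bicommutant[OF vN])
    have "\<theta> y = y"
    proof (intro blinfun_eqI cinner_ext)
      fix v u
      show "cinner u (blinfun_apply (\<theta> y) v) = cinner u (blinfun_apply y v)"
      proof (rule ccontr)
        assume ne: "cinner u (blinfun_apply (\<theta> y) v) \<noteq> cinner u (blinfun_apply y v)"
        from hausdorff[OF ne] obtain S T where ST: "open S" "open T" "cinner u (blinfun_apply (\<theta> y) v) \<in> S"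
          "cinner u (blinfun_apply y v) \<in> T" "S \<inter> T = {}"
          by blast
        have "openin (subtopology ultraweak_topology B) {x \<in> topspace (subtopology ultraweak_topology B).
            \<theta> x \<in> {x. cinner u (blinfun_apply x v) \<in> S}}"
          using normal[unfolded continuous_map_in_subtopology] openin_ultraweak_vector_functional[OF ST(1)]
          by (intro openin_continuous_map_preimage) auto
        moreover have top: "topspace (subtopology ultraweak_topology B) = B"
          using openin_subset[OF openin_ultraweak_vector_functional[OF open_UNIV, of u v]] by auto
        ultimately obtain Q where Q: "openin ultraweak_topology Q"
          "{x \<in> B. cinner u (blinfun_apply (\<theta> x) v) \<in> S} = Q \<inter> B"
          by (auto simp: openin_subtopology)
        have "openin ultraweak_topology (Q \<inter> {x. cinner u (blinfun_apply x v) \<in> T})"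
          by (intro openin_Int Q openin_ultraweak_vector_functional ST)
        moreover have "y \<in> Q \<inter> {x. cinner u (blinfun_apply x v) \<in> T}"
          using Q(2) ST yB by auto
        ultimately obtain e \<delta> where \<delta>: "\<delta> > 0"
          "\<And>z. norm (amplify (z - y) e) < \<delta> \<Longrightarrow> z \<in> Q \<inter> {x. cinner u (blinfun_apply x v) \<in> T}"
          using ultraweak_open_neighbourhood by metis
        obtain z where z: "z \<in> ?N" "norm (amplify (z - y) e) < \<delta>"
          using bicommutant_density[OF NB _ N_adj _ _ _ y \<delta>(1), of e]
          by (auto simp: vN_id[OF vN] one vN_add[OF vN] add vN_scaleC[OF vN] scaleC vN_compose[OF vN] mult)
        then have "z \<in> Q \<inter> B" "cinner u (blinfun_apply z v) \<in> T"
          using \<delta>(2) by auto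
        then show False
          using z(1) ST(5) unfolding Q(2)[symmetric] by auto
      qed
    qed
    with yB show ?thesis
      by simp
  qed
  have sub_bicommutant: "x \<in> commutant (commutant ?N)" if x: "x \<in> ?N" for x
  proof (rule commutantI)
    show "clinear_op x"
      using x vN_clinear[OF vN] by simp
    show "x o\<^sub>L y = y o\<^sub>L x" if "y \<in> commutant ?N" for y
      using commutantD(2)[OF that x] by (rule sym)
  qed
  have "commutant (commutant ?N) = ?N"
    by (intro equalityI subsetI) (erule bicommutant_sub, erule sub_bicommutant)
  with NB N_adj show ?thesis
    unfolding von_neumann_algebra_def by (intro conjI ballI)
qed

end

section \<open>Cyclic boundaries\<close>

lemma unit_circle_power:
  assumes "k \<ge> 1"
  shows "{z. z ^ k \<in> unit_circle} = unit_circle"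
  using assms power_eq_iff_eq_base[of k "cmod _" 1] by (auto simp: norm_power)

lemma make_cstar_cong:
  assumes "S = S'" "\<And>x y. x \<in> S' \<Longrightarrow> y \<in> S' \<Longrightarrow> m x y = m' x y"
  shows "make_cstar S m s \<nu> = make_cstar S' m' s \<nu>"
  using assms by (auto simp: make_cstar_def restrict_def fun_eq_iff)

text \<open>
  The carriers agree by the decomposition of the eigenspaces of a power; the products agree on the whole
  peripheral space, which contains both carriers.
\<close>

lemma poisson_boundary_funpow:
  assumes dil: "dilation A \<tau> \<iota> B \<theta>" "dilation A (\<tau> ^^ k) \<iota>' B' \<theta>'" and k: "k \<ge> 1"
    and G: "G \<subseteq> unit_circle"
  shows "poisson_boundary G A (\<tau> ^^ k) \<iota>' B' \<theta>' = poisson_boundary {z. z ^ k \<in> G} A \<tau> \<iota> B \<theta>"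
  unfolding poisson_boundary_def
proof (rule make_cstar_cong)
  interpret dilation A \<tau> \<iota> B \<theta>
    by (rule dil)
  have power: "peripheral_space H A (\<tau> ^^ k) = peripheral_space {z. z ^ k \<in> H} A \<tau>" if "H \<subseteq> unit_circle" for H
    using that by (intro peripheral_space_funpow vN_subspace[OF vN_A] lin_\<tau> k) auto
  have circle: "{z. z ^ k \<in> unit_circle} = unit_circle"
    by (rule unit_circle_power[OF k])
  have mono: "peripheral_space {z. z ^ k \<in> G} A \<tau> \<subseteq> peripheral_space unit_circle A \<tau>"
    unfolding peripheral_space_def using G circle
    by (intro closure_mono complex_vector.span_mono) blast
  show "peripheral_space G A (\<tau> ^^ k) = peripheral_space {z. z ^ k \<in> G} A \<tau>"
    by (rule power[OF G])
  fix x y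
  assume "x \<in> peripheral_space {z. z ^ k \<in> G} A \<tau>" "y \<in> peripheral_space {z. z ^ k \<in> G} A \<tau>"
  then show "boundary_mult \<iota>' B' \<theta>' x y = boundary_mult \<iota> B \<theta> x y"
    using mono power[of unit_circle] circle by (intro boundary_mult_funpow[OF dil k]) auto
qed

context dilation
begin

text \<open>
  The cyclic peripheral space is the closed span of the eigenspace of \<open>\<theta>\<^sup>k\<close> for \<open>1\<close>, and this eigenspace is
  already a closed subspace.
\<close>

lemma peripheral_cyclic_eq_fixed_points:
  assumes k: "k \<ge> 1"
  shows "peripheral_space (cyclic_subgroup k) B \<theta> = {z \<in> B. (\<theta> ^^ k) z = z}"
proof -
  interpret k: star_endomorphism B "\<theta> ^^ k"
    by (rule star_endomorphism_funpow) (rule star_endomorphism_axioms)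
  let ?N = "{z \<in> B. (\<theta> ^^ k) z = z}"
  have N: "von_neumann_algebra ?N"
    by (rule k.fixed_points_von_neumann)
  have eig: "eigenspace B (\<theta> ^^ k) 1 = ?N"
    by (simp add: eigenspace_def)
  have "peripheral_space (cyclic_subgroup k) B \<theta> = peripheral_space {1} B (\<theta> ^^ k)"
    using peripheral_space_funpow[OF vN_subspace[OF vN] unital_linear k, of "{1}"] cyclic_subgroup_eq[OF k]
    by simp
  also have "\<dots> = ?N"
  proof
    show "peripheral_space {1} B (\<theta> ^^ k) \<subseteq> ?N"
      by (intro peripheral_space_subset vN_subspace[OF N] vN_closed[OF N]) (simp add: eig)
    show "?N \<subseteq> peripheral_space {1} B (\<theta> ^^ k)"
      using eigenspace_subset_peripheral[of 1 "{1}" B "\<theta> ^^ k"] by (simp add: eig)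
  qed
  finally show ?thesis .
qed

text \<open>
  The boundary product was transported from \<open>B\<close> by the compression, so inverting the compression on the
  fixed points of \<open>\<theta>\<^sup>k\<close> returns the operator product.
\<close>

lemma cyclic_boundary_isomorphism:
  assumes k: "k \<ge> 1"
  defines "N \<equiv> {z \<in> B. (\<theta> ^^ k) z = z}"
  shows "von_neumann_algebra N"
    and "cstar_isomorphism (inv_into N (compress_op \<iota>))
      (poisson_boundary (cyclic_subgroup k) A \<tau> \<iota> B \<theta>) (operator_cstar N)"
proof -
  interpret k: star_endomorphism B "\<theta> ^^ k"
    by (rule star_endomorphism_funpow) (rule star_endomorphism_axioms)
  show N: "von_neumann_algebra N"
    unfolding N_def by (rule k.fixed_points_von_neumann)
  have circle: "cyclic_subgroup k \<subseteq> unit_circle"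
  proof
    fix z assume "z \<in> cyclic_subgroup k"
    then have "z \<in> {z. z ^ k \<in> unit_circle}"
      by (simp add: cyclic_subgroup_eq[OF k])
    then show "z \<in> unit_circle"
      by (simp only: unit_circle_power[OF k])
  qed
  have N_eq: "peripheral_space (cyclic_subgroup k) B \<theta> = N"
    unfolding N_def by (rule peripheral_cyclic_eq_fixed_points[OF k])
  have N_sub: "N \<subseteq> peripheral_space unit_circle B \<theta>"
    unfolding N_eq[symmetric] peripheral_space_def using circle
    by (intro closure_mono complex_vector.span_mono) blast
  have inj: "inj_on (compress_op \<iota>) N"
    using inj_on_compress N_sub by (rule inj_on_subset)
  have carrier: "peripheral_space (cyclic_subgroup k) A \<tau> = compress_op \<iota> ` N"
    using compress_peripheral[OF circle] by (simp add: N_eq)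
  let ?\<phi> = "inv_into N (compress_op \<iota>)"
  have \<phi>: "?\<phi> (compress_op \<iota> Z) = Z" if "Z \<in> N" for Z
    using inj that by (rule inv_into_f_f)
  show "cstar_isomorphism ?\<phi> (poisson_boundary (cyclic_subgroup k) A \<tau> \<iota> B \<theta>) (operator_cstar N)"
    unfolding cstar_isomorphism_def poisson_boundary_def operator_cstar_def make_cstar_def
      cstar.simps carrier
  proof (intro conjI ballI allI)
    show "bij_betw ?\<phi> (compress_op \<iota> ` N) N"
      using inj by (intro bij_betw_inv_into) (simp add: bij_betw_def)
    fix x assume "x \<in> compress_op \<iota> ` N"
    then obtain Z where Z: "Z \<in> N" "x = compress_op \<iota> Z"
      by blast
    show "?\<phi> (c *\<^sub>C x) = c *\<^sub>C ?\<phi> x" for c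
      using \<phi>[OF vN_scaleC[OF N Z(1), of c]] Z by (simp add: compress_scaleC \<phi>)
    have "adj x = compress_op \<iota> (adj Z)"
      by (simp add: Z compress_adj vN_clinear[OF N])
    then show "?\<phi> ((\<lambda>x\<in>compress_op \<iota> ` N. adj x) x) = (\<lambda>x\<in>N. adj x) (?\<phi> x)"
      using Z by (simp add: \<phi> vN_adj[OF N])
    show "(\<lambda>x\<in>N. norm x) (?\<phi> x) = (\<lambda>x\<in>compress_op \<iota> ` N. norm x) x"
      using Z N_sub by (auto simp: \<phi> norm_compress)
    fix y assume "y \<in> compress_op \<iota> ` N"
    then obtain W where W: "W \<in> N" "y = compress_op \<iota> W"
      by blast
    show "?\<phi> (x + y) = ?\<phi> x + ?\<phi> y"
      using Z W vN_add[OF N Z(1) W(1)] by (simp add: \<phi> flip: compress_add)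
    have "boundary_mult \<iota> B \<theta> x y = compress_op \<iota> (Z o\<^sub>L W)"
      using Z W N_sub by (auto intro: boundary_mult_compress)
    then show "?\<phi> ((\<lambda>x\<in>compress_op \<iota> ` N. \<lambda>y\<in>compress_op \<iota> ` N. boundary_mult \<iota> B \<theta> x y) x y)
        = (\<lambda>x\<in>N. \<lambda>y\<in>N. x o\<^sub>L y) (?\<phi> x) (?\<phi> y)"
      using Z W by (simp add: \<phi> vN_compose[OF N])
  qed
qed

end

theorem theorem4p3:
  fixes A :: "('h::hilbert_space \<Rightarrow>\<^sub>L 'h) set"
    and \<tau> :: "('h \<Rightarrow>\<^sub>L 'h) \<Rightarrow> ('h \<Rightarrow>\<^sub>L 'h)"
    and \<iota> :: "'h \<Rightarrow>\<^sub>L 'k::hilbert_space"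
    and B :: "('k \<Rightarrow>\<^sub>L 'k) set"
    and \<theta> :: "('k \<Rightarrow>\<^sub>L 'k) \<Rightarrow> ('k \<Rightarrow>\<^sub>L 'k)"
    and k :: nat
  assumes "von_neumann_algebra A"
    and "normal_ucp_map A \<tau>"
    and "k \<ge> 1"
    and "minimal_dilation A \<tau> \<iota> B \<theta>"
  shows "(\<forall>(\<iota>' :: 'h \<Rightarrow>\<^sub>L 'l::hilbert_space) B' \<theta>'. minimal_dilation A (\<tau> ^^ k) \<iota>' B' \<theta>' \<longrightarrow>
            poisson_boundary unit_circle A (\<tau> ^^ k) \<iota>' B' \<theta>'
              = poisson_boundary unit_circle A \<tau> \<iota> B \<theta> \<and>
            poisson_boundary {1} A (\<tau> ^^ k) \<iota>' B' \<theta>'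
              = poisson_boundary (cyclic_subgroup k) A \<tau> \<iota> B \<theta>) \<and>
         (\<exists>(N :: ('k \<Rightarrow>\<^sub>L 'k) set) \<phi>. von_neumann_algebra N \<and>
            cstar_isomorphism \<phi> (poisson_boundary (cyclic_subgroup k) A \<tau> \<iota> B \<theta>)
              (operator_cstar N))"
proof (intro conjI allI impI)
  have lin: "unital_linear_on A \<tau>"
    using assms(2) by (simp add: normal_ucp_map_def)
  have dil: "dilation A \<tau> \<iota> B \<theta>"
    by (rule dilationI[OF assms(1) lin assms(4)])
  show "\<exists>(N :: ('k \<Rightarrow>\<^sub>L 'k) set) \<phi>. von_neumann_algebra N \<and>
      cstar_isomorphism \<phi> (poisson_boundary (cyclic_subgroup k) A \<tau> \<iota> B \<theta>) (operator_cstar N)"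
    using dilation.cyclic_boundary_isomorphism[OF dil assms(3)] by blast
  fix \<iota>' :: "'h \<Rightarrow>\<^sub>L 'l" and B' \<theta>'
  assume min': "minimal_dilation A (\<tau> ^^ k) \<iota>' B' \<theta>'"
  have dil': "dilation A (\<tau> ^^ k) \<iota>' B' \<theta>'"
    by (rule dilationI[OF assms(1) unital_linear_on_funpow[OF lin] min'])
  show "poisson_boundary unit_circle A (\<tau> ^^ k) \<iota>' B' \<theta>' = poisson_boundary unit_circle A \<tau> \<iota> B \<theta>"
    using poisson_boundary_funpow[OF dil dil' assms(3) order_refl] by (simp only: unit_circle_power[OF assms(3)])
  show "poisson_boundary {1} A (\<tau> ^^ k) \<iota>' B' \<theta>' = poisson_boundary (cyclic_subgroup k) A \<tau> \<iota> B \<theta>"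
    using poisson_boundary_funpow[OF dil dil' assms(3), of "{1}"]
    by (simp add: cyclic_subgroup_eq[OF assms(3)])
qed

end
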